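(* Let $n\ge1$ and $f,g\in PO(1,n)\cong\mathbf I(\mathbb H^n)$. Then $\sigma_f=\sigma_g$ if and only if the centralizers $PO(1,n)_f=\{h:hf=fh\}$ and $PO(1,n)_g$ are conjugate subgroups of $PO(1,n)$.
   Context: $\mathbb R^{1,n}$ is $\mathbb R^{n+1}$ with $Q(x,y)=-x_0y_0+\sum_{i=1}^n x_iy_i$; $O(1,n)$ is its isometry group and $PO(1,n)$ the subgroup of $T$ with $Q(Tv)<0$ whenever $Q(v)<0$ (equivalently positive upper-left entry); $\mathbf I(\mathbb H^n)\cong PO(1,n)$ for $\mathbb H^n=\{Q(x)=-1,x_0>0\}$. For $T\in PO(1,n)$, the real primary components of $\mathbb R^{n+1}$ are $\ker p(T)^{N}$ ($N$ large) for the distinct monic irreducible real factors $p$ of the characteristic polynomial. Space-time decomposition: $V_s$ is the sum of the primary components on which $Q$ is positive definite, $V_t$ the sum of the remaining ones; $\mathbb R^{n+1}=V_t\oplus V_s$ orthogonally. Let $T_t=T|_{V_t}$, $T_s=T|_{V_s}$ (orthogonal), $r=\dim V_t$. Type: $e$ (elliptic) if $T_t=\mathrm{id}$; $p$ (parabolic) if $T_t$ is unipotent but $\ne\mathrm{id}$; $h$ (hyperbolic) if $T_t$ has an eigenvalue $\ne1$. Segre symbol: $\sigma_T=[t;r;\tilde\sigma_{T_s}]$, where for an orthogonal map $B$, $\tilde\sigma_B$ consists of the multiset of $\dim_{\mathbb C}\ker(B-\lambda)$ over distinct conjugate pairs $\{\lambda,\bar\lambda\}$ of non-real eigenvalues and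 the multiset of $\dim\ker(B-\varepsilon)$ over eigenvalues $\varepsilon\in\{\pm1\}$ of $B$. *)

theory Defs
  imports "HOL-Analysis.Analysis" "HOL-Computational_Algebra.Polynomial"
    "HOL-Library.Multiset"
begin

text \<open>Minkowski space R^{1,n} is modelled as real^('n option), where the
  index None is the time coordinate x_0 and the indices Some i (i :: 'n) are the
  n space coordinates; thus n = CARD('n) \<ge> 1.\<close>

type_synonym 'n lvec = "real ^ ('n option)"
type_synonym 'n lmat = "real ^ ('n option) ^ ('n option)"

definition Qf :: "'n::finite lvec \<Rightarrow> 'n lvec \<Rightarrow> real" where
  "Qf x y = - (x $ None) * (y $ None) + (\<Sum>i\<in>UNIV. x $ Some i * y $ Some i)"

definition O1n :: "'n::finite lmat set" where
  "O1n = {T. \<forall>x y. Qf (T *v x) (T *v y) = Qf x y}"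

definition PO1n :: "'n::finite lmat set" where
  "PO1n = {T \<in> O1n. T $ None $ None > 0}"

definition matpow :: "'a::comm_ring_1 ^'m::finite ^'m \<Rightarrow> nat \<Rightarrow> 'a ^'m ^'m" where
  "matpow A k = ((\<lambda>B. A ** B) ^^ k) (mat 1)"

definition poly_mat :: "real poly \<Rightarrow> real ^'m::finite ^'m \<Rightarrow> real ^'m ^'m" where
  "poly_mat p A = (\<Sum>i\<le>degree p. coeff p i *\<^sub>R matpow A i)"

definition charpoly :: "real ^'m::finite ^'m \<Rightarrow> real poly" where
  "charpoly T = det (\<chi> i j. (if i = j then [:0, 1:] else 0) - [:T $ i $ j:])"

definition prime_factors_cp :: "real ^'m::finite ^'m \<Rightarrow> real poly set" where
  "prime_factors_cp T = {p. lead_coeff p = 1 \<and> irreducible p \<and> p dvd charpoly T}"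

text \<open>Real primary component ker p(T)^N, with N = dimension of the space (large enough).\<close>
definition primary_comp :: "real ^'m::finite ^'m \<Rightarrow> real poly \<Rightarrow> (real ^'m) set" where
  "primary_comp T p = {v. matpow (poly_mat p T) CARD('m) *v v = 0}"

definition Qposdef :: "'n::finite lvec set \<Rightarrow> bool" where
  "Qposdef W \<longleftrightarrow> (\<forall>v\<in>W. v \<noteq> 0 \<longrightarrow> Qf v v > 0)"

definition Vs :: "'n::finite lmat \<Rightarrow> 'n lvec set" where
  "Vs T = span (\<Union>{primary_comp T p | p. p \<in> prime_factors_cp T \<and> Qposdef (primary_comp T p)})"

definition Vt :: "'n::finite lmat \<Rightarrow> 'n lvec set" where
  "Vt T = span (\<Union>{primary_comp T p | p. p \<in> prime_factors_cp T \<and> \<not> Qposdef (primary_comp T p)})"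

definition cvec :: "real ^'m::finite \<Rightarrow> complex ^'m" where
  "cvec v = (\<chi> i. complex_of_real (v $ i))"

definition cmat :: "real ^'m::finite ^'m \<Rightarrow> complex ^'m ^'m" where
  "cmat A = (\<chi> i j. complex_of_real (A $ i $ j))"

definition complexify :: "(real ^'m::finite) set \<Rightarrow> (complex ^'m) set" where
  "complexify W = vec.span (cvec ` W)"

definition restr_eigenvalue :: "real ^'m::finite ^'m \<Rightarrow> (real ^'m) set \<Rightarrow> complex \<Rightarrow> bool" where
  "restr_eigenvalue T W c \<longleftrightarrow>
     (\<exists>v \<in> complexify W. v \<noteq> 0 \<and> cmat T *v v = c *s v)"

datatype ttype = Ell | Par | Hyp

definition is_ell :: "'n::finite lmat \<Rightarrow> bool" where
  "is_ell T \<longleftrightarrow> (\<forall>v\<in>Vt T. T *v v = v)"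

definition is_par :: "'n::finite lmat \<Rightarrow> bool" where
  "is_par T \<longleftrightarrow> (\<exists>k. \<forall>v\<in>Vt T. matpow (T - mat 1) k *v v = 0) \<and> \<not> is_ell T"

definition is_hyp :: "'n::finite lmat \<Rightarrow> bool" where
  "is_hyp T \<longleftrightarrow> (\<exists>c. c \<noteq> 1 \<and> restr_eigenvalue T (Vt T) c)"

definition type_of :: "'n::finite lmat \<Rightarrow> ttype" where
  "type_of T = (THE t. (t = Ell \<and> is_ell T) \<or> (t = Par \<and> is_par T) \<or> (t = Hyp \<and> is_hyp T))"

text \<open>Reduced Segre symbol of the orthogonal part B = T_s (restriction of T to W = V_s):
  multiset of complex dimensions of ker(B - \<lambda>) over conjugate pairs of non-real
  eigenvalues (each pair represented by its member with positive imaginary part),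
  and multiset of dim ker(B - \<epsilon>) over eigenvalues \<epsilon> in {1,-1}.\<close>
definition segre_orth :: "real ^'m::finite ^'m \<Rightarrow> (real ^'m) set \<Rightarrow> nat multiset \<times> nat multiset" where
  "segre_orth T W =
     (image_mset (\<lambda>c. vec.dim {v \<in> complexify W. cmat T *v v = c *s v})
        (mset_set {c. Im c > 0 \<and> restr_eigenvalue T W c}),
      image_mset (\<lambda>e. vec.dim {v \<in> W. T *v v = e *s v})
        (mset_set {e \<in> {1, -1 :: real}. \<exists>v\<in>W. v \<noteq> 0 \<and> T *v v = e *s v}))"

definition segre :: "'n::finite lmat \<Rightarrow> ttype \<times> nat \<times> (nat multiset \<times> nat multiset)" where
  "segre T = (type_of T, vec.dim (Vt T), segre_orth T (Vs T))"

definition centralizer :: "'n::finite lmat \<Rightarrow> 'n lmat set" where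
  "centralizer f = {h \<in> PO1n. h ** f = f ** h}"

definition conj_subgroups :: "'n::finite lmat set \<Rightarrow> 'n lmat set \<Rightarrow> bool" where
  "conj_subgroups H K \<longleftrightarrow> (\<exists>k\<in>PO1n. (\<lambda>h. k ** h ** matrix_inv k) ` H = K)"

end

theory Submission
  imports Defs "HOL-Computational_Algebra.Field_as_Ring" "HOL-Computational_Algebra.Polynomial_Factorial"
    "HOL-Computational_Algebra.Fundamental_Theorem_Algebra"
begin

text \<open>
  The element \<open>f + f\<^sup>-\<^sup>1\<close> is self-adjoint for \<open>Q\<close>; its eigenspace for \<open>2 a\<close>, written
  \<open>eigsp f a\<close>, is the real block of the eigenvalues \<open>a \<plusminus> i sqrt (1 - a\<^sup>2)\<close> of \<open>f\<close>, and \<open>V\<^sub>s\<close> is the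
  orthogonal sum of the positive definite blocks. Brouwer's theorem on the closed ball of rays in
  the light cone yields a forward eigenvector that is not spacelike, which decides the type.

  Conjugate centralizers: one may assume that the centralizers of \<open>f\<close> and \<open>g\<close> agree. The reflection
  in a spacelike \<open>x\<close> commutes with \<open>f\<close> iff \<open>f x = \<plusminus>x\<close>, and the half-turn in a plane spanned by
  \<open>x, f x\<close> inside a complex block commutes with \<open>f\<close>, hence with \<open>g\<close>. So every vector of a block of
  \<open>f\<close> lies in a block of \<open>g\<close> of the same kind, the blocks coincide, and then so do \<open>V\<^sub>t\<close>
  and the types.

  Equal symbols: adapted frames of the two block decompositions have the same Gram matrix, and an
  isometry \<open>k\<close> matching them turns \<open>g\<close> on each block into an affine function of \<open>k f k\<^sup>-\<^sup>1\<close>, and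
  conversely. As centralizers preserve the blocks, \<open>k\<close> conjugates one centralizer to the other.
\<close>

section \<open>The Lorentz form\<close>

text \<open>Two hyperbolic maps with different multipliers, or two rotations by different angles,
  have conjugate centralizers without being conjugate. A centralizer thus sees blocks but not
  eigenvalues: hence everything is phrased by the subspaces \<open>eigsp f a\<close>, and in the
  converse \<open>g\<close> is compared with an affine function of \<open>k f k^-1\<close> whose
  coefficients change from block to block. Keeping the kinds of blocks apart is the obstacle of the
  first direction. A reflection cannot tell eigenvalue 1 from -1, so a block of \<open>f\<close> for
  -1 might sit inside the fixed vectors of \<open>V_t\<close> of \<open>g\<close>. This is excluded
  because an element of \<open>PO1n\<close> never negates a nonspacelike vector: if \<open>x\<close>
  and a nonspacelike \<open>y\<close> share an eigenvalue 1 or -1, it is 1. On \<open>V_t\<close>,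
  where \<open>Q\<close> is indefinite, blocks are not compared at all; \<open>V_t\<close> is
  recovered as the orthogonal complement of \<open>V_s\<close>. Positivity of the other blocks is
  what excludes nilpotent parts: a nilpotent step would produce a nonzero null vector.\<close>

lemma Qf_commute: "Qf x y = Qf y x"
  unfolding Qf_def by (simp add: mult.commute)

lemma Qf_add_left: "Qf (x + y) z = Qf x z + Qf y z"
  unfolding Qf_def by (simp add: algebra_simps sum.distrib)

lemma Qf_scaleR_left: "Qf (c *\<^sub>R x) z = c * Qf x z"
  unfolding Qf_def by (simp add: algebra_simps sum_distrib_left)

lemma Qf_add_right: "Qf z (x + y) = Qf z x + Qf z y"
  by (metis Qf_commute Qf_add_left)

lemma Qf_scaleR_right: "Qf z (c *\<^sub>R x) = c * Qf z x"
  by (metis Qf_commute Qf_scaleR_left)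

lemma Qf_minus_left: "Qf (- x) z = - Qf x z"
  using Qf_scaleR_left[of "-1" x z] by simp

lemma Qf_minus_right: "Qf z (- x) = - Qf z x"
  using Qf_scaleR_right[of z "-1" x] by simp

lemma Qf_diff_left: "Qf (x - y) z = Qf x z - Qf y z"
  using Qf_add_left[of x "- y" z] by (simp add: Qf_minus_left)

lemma Qf_diff_right: "Qf z (x - y) = Qf z x - Qf z y"
  using Qf_add_right[of z x "- y"] by (simp add: Qf_minus_right)

lemma Qf_zero_left [simp]: "Qf 0 z = 0"
  by (simp add: Qf_def)

lemma Qf_zero_right [simp]: "Qf z 0 = 0"
  by (simp add: Qf_def)

lemmas Qf_simps = Qf_add_left Qf_add_right Qf_scaleR_left Qf_scaleR_right
  Qf_minus_left Qf_minus_right Qf_diff_left Qf_diff_right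

lemma Qf_axis_None: "Qf (axis None 1) y = - y $ None"
  unfolding Qf_def by (simp add: axis_def)

lemma Qf_axis_Some: "Qf (axis (Some i) 1) y = y $ Some i"
  unfolding Qf_def by (simp add: axis_def if_distrib[of "\<lambda>x. x * _"] cong: if_cong)

lemma Qf_nondegenerate:
  assumes "\<And>y. Qf x y = 0"
  shows "x = 0"
proof -
  have "x $ i = 0" for i
  proof (cases i)
    case None
    then show ?thesis using assms[of "axis None 1"] by (simp add: Qf_commute[of x] Qf_axis_None)
  next
    case (Some j)
    then show ?thesis using assms[of "axis (Some j) 1"] by (simp add: Qf_commute[of x] Qf_axis_Some)
  qed
  then show ?thesis by (simp add: vec_eq_iff)
qed

lemma Qf_span_right:
  assumes "\<And>y. y \<in> S \<Longrightarrow> Qf x y = 0" and "y \<in> span S"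
  shows "Qf x y = 0"
  using assms(2) by (induction rule: span_induct_alt) (auto simp: Qf_simps assms(1))

lemma Qf_span_left:
  assumes "\<And>x. x \<in> S \<Longrightarrow> Qf x y = 0" and "x \<in> span S"
  shows "Qf x y = 0"
  using Qf_span_right[of S y x] assms by (simp add: Qf_commute)

lemma Qf_nondegenerate_span:
  assumes "span S = UNIV" and "\<And>y. y \<in> S \<Longrightarrow> Qf x y = 0"
  shows "x = 0"
  using Qf_nondegenerate[of x] Qf_span_right[of S x] assms by simp

text \<open>On the hyperplane of time coordinate 0 the form is a sum of squares. Mostly used
  contrapositively: a nonzero nonspacelike vector has a nonzero time coordinate, hence a time
  direction.\<close>

lemma zero_if_None_zero:
  assumes "x $ None = 0" and "Qf x x \<le> 0"
  shows "x = 0"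
proof -
  have s: "(\<Sum>i\<in>UNIV. x $ Some i * x $ Some i) = 0"
    using assms sum_nonneg[of UNIV "\<lambda>i. x $ Some i * x $ Some i"] by (simp add: Qf_def)
  have "x $ Some i = 0" for i
    using s sum_nonneg_eq_0_iff[of UNIV "\<lambda>i. x $ Some i * x $ Some i"] by simp
  with assms(1) have "x $ i = 0" for i by (cases i) auto
  then show ?thesis by (simp add: vec_eq_iff)
qed

text \<open>Subtract from \<open>y\<close> the multiple of \<open>x\<close> with the same time
  coordinate: by orthogonality the difference is still nonspacelike, and its time coordinate is 0.
  Most positivity arguments below rest on this.\<close>

lemma nonspacelike_orthogonal:
  assumes "x \<noteq> 0" "Qf x x \<le> 0" "Qf y y \<le> 0" "Qf x y = 0"
  shows "\<exists>t. y = t *\<^sub>R x"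
proof -
  have x0: "x $ None \<noteq> 0" using zero_if_None_zero assms by blast
  define t where "t = y $ None / x $ None"
  define z where "z = y - t *\<^sub>R x"
  have z0: "z $ None = 0" using x0 by (simp add: z_def t_def)
  have "Qf z z = Qf y y + t\<^sup>2 * Qf x x"
    using assms(4) by (simp add: z_def Qf_simps Qf_commute[of y x] power2_eq_square algebra_simps)
  also have "\<dots> \<le> 0" using assms by (simp add: add_nonpos_nonpos mult_nonneg_nonpos)
  finally have "z = 0" using z0 zero_if_None_zero by blast
  then show ?thesis unfolding z_def by auto
qed

lemma timelike_orthogonal:
  assumes "Qf x x < 0" "Qf x y = 0" "y \<noteq> 0"
  shows "Qf y y > 0"
proof (rule ccontr)
  assume a: "\<not> Qf y y > 0"
  have "x \<noteq> 0" using assms by auto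
  then obtain t where t: "y = t *\<^sub>R x" using nonspacelike_orthogonal[of x y] assms a by auto
  then show False using assms by (auto simp: Qf_simps)
qed

lemma null_orthogonal_null:
  assumes "Qf x x = 0" "Qf y y = 0" "x \<noteq> 0" "Qf x y = 0"
  shows "\<exists>t. y = t *\<^sub>R x"
  using nonspacelike_orthogonal[of x y] assms by auto

text \<open>Cauchy-Schwarz for the space parts, which are shorter than the time coordinates
  (strictly for \<open>x\<close>).\<close>

lemma forward_product_neg:
  assumes "Qf x x < 0" "Qf y y \<le> 0" "x $ None > 0" "y $ None > 0"
  shows "Qf x y < 0"
proof -
  define s where "s z = (\<chi> i. z $ Some i)" for z :: "'a lvec"
  have q: "Qf v w = - (v $ None) * (w $ None) + inner (s v) (s w)" for v w
    by (simp add: Qf_def s_def inner_vec_def)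
  have x: "norm (s x) < x $ None"
    using assms q[of x x] abs_le_square_iff[of "x $ None" "norm (s x)"]
    by (simp add: power2_eq_square[symmetric] power2_norm_eq_inner[symmetric] not_le[symmetric])
  have y: "norm (s y) \<le> y $ None"
    using assms q[of y y] abs_le_square_iff[of "norm (s y)" "y $ None"]
    by (simp add: power2_eq_square[symmetric] power2_norm_eq_inner[symmetric])
  have "inner (s x) (s y) \<le> norm (s x) * norm (s y)" by (rule norm_cauchy_schwarz)
  also have "\<dots> \<le> norm (s x) * y $ None" using y by (simp add: mult_left_mono)
  also have "\<dots> < x $ None * y $ None" using x assms by simp
  finally show ?thesis using q[of x y] by simp
qed

section \<open>The Lorentz group and its forward subgroup\<close>

lemma O1n_Qf: "T \<in> O1n \<Longrightarrow> Qf (T *v x) (T *v y) = Qf x y"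
  unfolding O1n_def by blast

lemma O1n_injective:
  assumes "T \<in> O1n" "T *v x = 0"
  shows "x = 0"
  using Qf_nondegenerate[of x] O1n_Qf[OF assms(1), of x] assms(2) by simp

lemma O1n_invertible:
  assumes "T \<in> O1n"
  shows "invertible T"
proof -
  have "\<forall>x. T *v x = 0 \<longrightarrow> x = 0" using O1n_injective[OF assms] by blast
  then obtain B where "B ** T = mat 1" using matrix_left_invertible_ker by blast
  then show ?thesis using invertible_def matrix_left_right_inverse by blast
qed

lemma O1n_inv:
  assumes "T \<in> O1n"
  shows "T ** matrix_inv T = mat 1" "matrix_inv T ** T = mat 1"
    "T *v (matrix_inv T *v x) = x" "matrix_inv T *v (T *v x) = x"
proof -
  show 1: "T ** matrix_inv T = mat 1" "matrix_inv T ** T = mat 1"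
    using someI_ex[OF O1n_invertible[OF assms, unfolded invertible_def]] unfolding matrix_inv_def by auto
  show "T *v (matrix_inv T *v x) = x" "matrix_inv T *v (T *v x) = x"
    by (simp_all add: matrix_vector_mul_assoc 1)
qed

lemma O1n_matrix_inv:
  assumes "T \<in> O1n"
  shows "matrix_inv T \<in> O1n"
  using O1n_Qf[OF assms, of "matrix_inv T *v _" "matrix_inv T *v _"]
  by (simp add: O1n_def O1n_inv[OF assms])

lemma O1n_mult: "A \<in> O1n \<Longrightarrow> B \<in> O1n \<Longrightarrow> A ** B \<in> O1n"
  unfolding O1n_def by (simp add: matrix_vector_mul_assoc[symmetric])

lemma PO1n_O1n: "T \<in> PO1n \<Longrightarrow> T \<in> O1n"
  unfolding PO1n_def by blast

lemma mult_axis_None: "(T *v axis None 1) $ None = (T::'n::finite lmat) $ None $ None"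
  by (simp add: matrix_vector_mult_basis column_def)

text \<open>The matrix entry in \<open>PO1n\<close> only records the image of the time axis
  \<open>e\<close>. If \<open>- T x\<close> were forward, \<open>forward_product_neg\<close> would
  make \<open>Q(T e, - T x) = - Q(e, x) = x_0\<close> negative.\<close>

lemma PO1n_forward:
  assumes "T \<in> PO1n" "Qf x x \<le> 0" "x $ None > 0"
  shows "(T *v x) $ None > 0"
proof (rule ccontr)
  assume n: "\<not> (T *v x) $ None > 0"
  have O: "T \<in> O1n" using assms PO1n_O1n by blast
  let ?e = "axis None 1 :: 'a lvec"
  have qe: "Qf ?e ?e = -1" by (simp add: Qf_axis_None) 
  have "(T *v x) $ None \<noteq> 0"
    using zero_if_None_zero[of "T *v x"] O1n_Qf[OF O, of x x] O1n_injective[OF O, of x] assms by auto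
  then have "(- (T *v x)) $ None > 0" using n by auto
  moreover have "(T *v ?e) $ None > 0" using assms(1) by (simp add: mult_axis_None PO1n_def)
  ultimately have "Qf (T *v ?e) (- (T *v x)) < 0"
    using forward_product_neg[of "T *v ?e" "- (T *v x)"] assms(2) qe
    by (simp add: Qf_simps O1n_Qf[OF O])
  then have "Qf ?e x > 0" by (simp add: Qf_simps O1n_Qf[OF O])
  then show False using assms(3) by (simp add: Qf_axis_None)
qed

text \<open>One forward vector kept forward suffices: otherwise \<open>- T\<close> lies in
  \<open>PO1n\<close> and reverses the conclusion.\<close>

lemma PO1n_I:
  assumes "T \<in> O1n" "Qf x x \<le> 0" "x $ None > 0" "(T *v x) $ None > 0"
  shows "T \<in> PO1n"
proof (rule ccontr)
  assume n: "T \<notin> PO1n"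
  let ?e = "axis None 1 :: 'a lvec"
  have qe: "Qf ?e ?e = -1" by (simp add: Qf_axis_None) 
  have "?e \<noteq> 0" using qe by auto
  have "(T *v ?e) $ None \<noteq> 0"
    using zero_if_None_zero[of "T *v ?e"] O1n_Qf[OF assms(1), of ?e ?e] O1n_injective[OF assms(1), of ?e] 
      qe \<open>?e \<noteq> 0\<close> by auto
  then have "T $ None $ None < 0" using n assms(1) by (simp add: PO1n_def mult_axis_None)
  moreover have m: "(- T) *v y = - (T *v y)" for y
    by (simp add: vec_eq_iff matrix_vector_mult_def sum_negf)
  then have "- T \<in> O1n" using assms(1) by (simp add: O1n_def Qf_simps)
  ultimately have "- T \<in> PO1n" by (simp add: PO1n_def)
  from PO1n_forward[OF this assms(2,3)] m assms(4) show False by simp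
qed

lemma PO1n_mult:
  assumes "A \<in> PO1n" "B \<in> PO1n"
  shows "A ** B \<in> PO1n"
proof -
  let ?e = "axis None 1 :: 'a lvec"
  have qe: "Qf ?e ?e = -1" "?e $ None > 0" by (simp_all add: Qf_axis_None)
  have "(B *v ?e) $ None > 0" using PO1n_forward[OF assms(2), of ?e] qe by simp
  then have "(A *v (B *v ?e)) $ None > 0"
    using PO1n_forward[OF assms(1), of "B *v ?e"] qe O1n_Qf[OF PO1n_O1n[OF assms(2)], of ?e ?e] by simp
  then show ?thesis
    using PO1n_I[of "A ** B" ?e] O1n_mult[OF PO1n_O1n PO1n_O1n, OF assms] qe
    by (simp add: matrix_vector_mul_assoc)
qed

lemma PO1n_matrix_inv:
  assumes "T \<in> PO1n"
  shows "matrix_inv T \<in> PO1n"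
proof -
  let ?e = "axis None 1 :: 'a lvec"
  have qe: "Qf ?e ?e = -1" "?e $ None > 0" by (simp_all add: Qf_axis_None)
  have O: "T \<in> O1n" using assms PO1n_O1n by blast
  have "(T *v ?e) $ None > 0" using PO1n_forward[OF assms, of ?e] qe by simp
  then show ?thesis
    using PO1n_I[of "matrix_inv T" "T *v ?e"] O1n_matrix_inv[OF O] qe O1n_inv[OF O] O1n_Qf[OF O, of ?e ?e] by simp
qed

section \<open>Isometries and their eigenvectors\<close>

lemma exists_forward_eigenvector:
  fixes f :: "'n::finite lmat"
  assumes "f \<in> PO1n"
  obtains u \<mu> where "u $ None > 0" "Qf u u \<le> 0" "\<mu> > 0" "f *v u = \<mu> *\<^sub>R u"
proof -
  define emb :: "real ^ 'n \<Rightarrow> 'n lvec" where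
    "emb x = (\<chi> k. case k of None \<Rightarrow> 1 | Some i \<Rightarrow> x $ i)" for x
  define sp :: "'n lvec \<Rightarrow> real ^ 'n" where "sp v = (\<chi> i. v $ Some i)" for v
  \<comment> \<open>The action of \<open>f\<close> on rays, read off in the slice of time coordinate
    1: \<open>emb\<close> lifts a point of the ball to that slice, and dividing by the time
    coordinate, positive by \<open>PO1n_forward\<close>, projects back.\<close>
  define F where "F x = (1 / (f *v emb x) $ None) *\<^sub>R sp (f *v emb x)" for x
  have q: "Qf v v = (norm (sp v))\<^sup>2 - (v $ None)\<^sup>2" for v
    unfolding power2_norm_eq_inner by (simp add: Qf_def sp_def inner_vec_def power2_eq_square)
  have sp_emb: "sp (emb x) = x" and emb_None: "emb x $ None = 1" for x
    by (simp_all add: sp_def emb_def vec_eq_iff)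
  have nonpos: "Qf (emb x) (emb x) \<le> 0" if "x \<in> cball 0 1" for x
    using that q[of "emb x"] by (simp add: sp_emb emb_None power_le_one)
  have forward: "(f *v emb x) $ None > 0" if "x \<in> cball 0 1" for x
    using PO1n_forward[OF assms nonpos[OF that]] by (simp add: emb_None)
  have "F \<in> cball 0 1 \<rightarrow> cball 0 1"
  proof
    fix x :: "real ^ 'n" assume x: "x \<in> cball 0 1"
    let ?y = "f *v emb x"
    have "Qf ?y ?y \<le> 0" using nonpos[OF x] O1n_Qf[OF PO1n_O1n[OF assms]] by simp
    then have "(norm (sp ?y))\<^sup>2 \<le> (?y $ None)\<^sup>2" using q[of ?y] by simp
    then have "norm (sp ?y) \<le> ?y $ None"
      using forward[OF x] by (auto intro: power2_le_imp_le)
    then show "F x \<in> cball 0 1" using forward[OF x] by (simp add: F_def)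
  qed
  moreover have "continuous_on (cball 0 1) F"
  proof -
    have e: "continuous_on (cball 0 1) emb"
      unfolding emb_def
    proof (rule continuous_on_vec_lambda)
      fix i :: "'n option"
      show "continuous_on (cball 0 1) (\<lambda>x. case i of None \<Rightarrow> 1 | Some j \<Rightarrow> x $ j)"
        by (cases i) (auto intro!: continuous_intros)
    qed
    have fe: "continuous_on (cball 0 1) (\<lambda>x. f *v emb x)"
      by (intro linear_continuous_on_compose[OF e] matrix_vector_mul_linear)
    have "continuous_on (cball 0 1) (\<lambda>x. sp (f *v emb x))"
      unfolding sp_def by (intro continuous_on_vec_lambda continuous_on_component fe)
    then show ?thesis
      unfolding F_def using forward
      by (intro continuous_on_scaleR continuous_on_divide continuous_on_const continuous_on_component fe)
         (auto simp: less_imp_neq[THEN not_sym] order_less_imp_not_eq2)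
  qed
  ultimately obtain x where x: "x \<in> cball 0 1" "F x = x"
    using brouwer[of "cball 0 1 :: (real ^ 'n) set" F] by auto
  define \<mu> where "\<mu> = (f *v emb x) $ None"
  have \<mu>: "\<mu> > 0" using forward[OF x(1)] by (simp add: \<mu>_def)
  have "sp (f *v emb x) = \<mu> *\<^sub>R F x" using \<mu> by (simp add: F_def \<mu>_def)
  then have "sp (f *v emb x) = \<mu> *\<^sub>R x" by (simp add: x)
  then have "(f *v emb x) $ i = (\<mu> *\<^sub>R emb x) $ i" for i
    by (cases i) (auto simp: \<mu>_def emb_def sp_def vec_eq_iff)
  then have "f *v emb x = \<mu> *\<^sub>R emb x" by (simp add: vec_eq_iff)
  then show thesis using that[of "emb x" \<mu>] nonpos[OF x(1)] \<mu> by (simp add: emb_None)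
qed

lemma isometry_eigenvalue_square:
  assumes "f \<in> O1n" "f *v x = \<mu> *\<^sub>R x" "Qf x x \<noteq> 0"
  shows "\<mu>\<^sup>2 = 1"
  using O1n_Qf[OF assms(1), of x x] assms by (simp add: Qf_simps power2_eq_square)

text \<open>The line spanned by \<open>u\<close> is orthogonal to the range of \<open>f - 1/\<mu>\<close>, which is therefore singular.\<close>
lemma exists_dual_eigenvector:
  assumes f: "f \<in> O1n" and u: "f *v u = \<mu> *\<^sub>R u" "u \<noteq> 0" and \<mu>: "\<mu> \<noteq> 0"
  obtains w where "w \<noteq> 0" "f *v w = (1 / \<mu>) *\<^sub>R w"
proof (rule ccontr)
  assume n: "\<not> thesis"
  define L where "L y = f *v y - (1 / \<mu>) *\<^sub>R y" for y
  have lin: "linear L"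
    unfolding L_def by (intro linear_compose_sub matrix_vector_mul_linear linear_compose_scale_right linear_ident)
  have "inj L"
    unfolding linear_injective_0[OF lin] using n that by (auto simp: L_def)
  then have "surj L" using lin linear_injective_imp_surjective by blast
  have "Qf u (L y) = 0" for y
    using O1n_Qf[OF f, of u y] u \<mu> by (simp add: L_def Qf_simps field_simps)
  then have "Qf u z = 0" for z using \<open>surj L\<close> by (metis surj_def)
  then show False using Qf_nondegenerate u by blast
qed

text \<open>The forward eigenvector \<open>u\<close> decides. If \<open>\<mu> = 1\<close>, the
  question is whether some fixed vector is timelike. If \<open>\<mu> \<noteq> 1\<close>, then
  \<open>u\<close> and the dual eigenvector \<open>w\<close> are null, and they are not orthogonal,
  for otherwise they would be proportional and \<open>\<mu> = 1 / \<mu>\<close>.\<close>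

lemma PO1n_trichotomy:
  assumes "f \<in> PO1n"
  obtains 
    (elliptic) v where "v $ None > 0" "Qf v v < 0" "f *v v = v"
  | (parabolic) u where "\<And>v. f *v v = v \<Longrightarrow> Qf v v \<ge> 0" "u $ None > 0" "Qf u u = 0" "f *v u = u"
  | (hyperbolic) u w \<mu> where "\<mu> > 0" "\<mu> \<noteq> 1" "u $ None > 0" "Qf u u = 0" "Qf w w = 0" "Qf u w = -1"
      "f *v u = \<mu> *\<^sub>R u" "f *v w = (1 / \<mu>) *\<^sub>R w"
proof -
  obtain u \<mu> where u: "u $ None > 0" "Qf u u \<le> 0" "\<mu> > 0" "f *v u = \<mu> *\<^sub>R u"
    using exists_forward_eigenvector[OF assms] by blast
  have f: "f \<in> O1n" using assms PO1n_O1n by blast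
  have one: "c = 1" if "c > 0" "c\<^sup>2 = 1" for c :: real
    using that by (simp add: power2_eq_1_iff)
  have u0: "u \<noteq> 0" using u by auto
  show thesis
  proof (cases "\<mu> = 1")
    case True
    then have fu: "f *v u = u" using u by simp
    show thesis
    proof (cases "\<exists>v. f *v v = v \<and> Qf v v < 0")
      case True
      then obtain v where v: "f *v v = v" "Qf v v < 0" by blast
      show thesis
      proof (cases "v $ None > 0")
        case True
        then show thesis using elliptic v by blast
      next
        case False
        have "v $ None \<noteq> 0" using zero_if_None_zero[of v] v by fastforce
        then show thesis using False elliptic[of "- v"] v
          using matrix_vector_mult_scaleR[of f "-1" v] by (simp add: Qf_simps)
      qed
    next
      case False
      then have "Qf u u = 0" using u fu by force
      then show thesis using False parabolic[of u] u fu by force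
    qed
  next
    case False
    have uu: "Qf u u = 0" using isometry_eigenvalue_square[OF f u(4)] one[of \<mu>] u False by blast
    obtain w where w: "w \<noteq> 0" "f *v w = (1 / \<mu>) *\<^sub>R w"
      using exists_dual_eigenvector[OF f u(4)] u u0 by force
    have ww: "Qf w w = 0" using isometry_eigenvalue_square[OF f w(2)] one[of "1/\<mu>"] u False by force
    have uw: "Qf u w \<noteq> 0"
    proof
      assume "Qf u w = 0"
      then obtain t where t: "w = t *\<^sub>R u" using null_orthogonal_null uu ww u0 by blast
      then have "\<mu> *\<^sub>R w = (1 / \<mu>) *\<^sub>R w" using w(2) u(4) by (simp add: matrix_vector_mult_scaleR mult.commute)
      then have "\<mu>\<^sup>2 = 1" using w(1) u(3) by (simp add: field_simps power2_eq_square)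
      then show False using one u False by blast
    qed
    show thesis
    \<comment> \<open>The factor normalizes the product of \<open>u\<close> and \<open>w\<close> to
      -1, so that \<open>u + w\<close> is timelike.\<close>
    proof (rule hyperbolic[of \<mu> u "(- 1 / Qf u w) *\<^sub>R w"])
      show "f *v ((- 1 / Qf u w) *\<^sub>R w) = (1 / \<mu>) *\<^sub>R ((- 1 / Qf u w) *\<^sub>R w)"
        unfolding matrix_vector_mult_scaleR w(2) by simp
    qed (use u False uu ww uw in \<open>simp_all add: Qf_simps\<close>)
  qed
qed

text \<open>The equation \<open>(f + f^-1) x = 2 a x\<close> after applying \<open>f\<close>, which
  removes the inverse.\<close>

definition eigsp :: "'n::finite lmat \<Rightarrow> real \<Rightarrow> 'n lvec set" where
  "eigsp f a = {x. f *v (f *v x) + x = (2 * a) *\<^sub>R (f *v x)}"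

lemma eigsp_eq: "x \<in> eigsp f a \<longleftrightarrow> f *v (f *v x) = (2 * a) *\<^sub>R (f *v x) - x"
  by (simp add: eigsp_def eq_diff_eq)

lemma eigsp_subspace: "subspace (eigsp f a)"
proof (rule subspaceI)
  show "0 \<in> eigsp f a" by (simp add: eigsp_def)
  show "x + y \<in> eigsp f a" if "x \<in> eigsp f a" "y \<in> eigsp f a" for x y
    using that by (simp add: eigsp_eq matrix_vector_right_distrib scaleR_add_right)
  show "c *\<^sub>R x \<in> eigsp f a" if "x \<in> eigsp f a" for c x
    using that by (simp add: eigsp_eq matrix_vector_mult_scaleR scaleR_diff_right mult.commute)
qed

lemma eigsp_commute_closed:
  assumes "h ** f = f ** h" "x \<in> eigsp f a"
  shows "h *v x \<in> eigsp f a"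
proof -
  have c: "f *v (h *v y) = h *v (f *v y)" for y
    using assms(1) by (simp add: matrix_vector_mul_assoc)
  show ?thesis using assms(2)
    by (simp add: eigsp_eq c matrix_vector_mult_diff_distrib matrix_vector_mult_scaleR)
qed

lemma eigsp_mult_closed: "x \<in> eigsp f a \<Longrightarrow> f *v x \<in> eigsp f a"
  using eigsp_commute_closed by blast

text \<open>Since the adjoint of \<open>f\<close> is its inverse, the left side is the product of
  \<open>(f + f^-1) x\<close> with \<open>y\<close>; \<open>y\<close> may lie outside the
  block.\<close>

lemma eigsp_Qf:
  assumes "f \<in> O1n" "x \<in> eigsp f a"
  shows "Qf (f *v x) y + Qf x (f *v y) = 2 * a * Qf x y"
proof -
  have "Qf (f *v (f *v x) + x) (f *v y) = 2 * a * Qf (f *v x) (f *v y)"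
    using assms(2) by (simp add: eigsp_def Qf_simps)
  then show ?thesis by (simp add: Qf_simps O1n_Qf[OF assms(1)])
qed

text \<open>The symmetric left side of \<open>eigsp_Qf\<close>, evaluated through \<open>x\<close>
  and through \<open>y\<close>, equals both \<open>2 a Q(x, y)\<close> and
  \<open>2 b Q(x, y)\<close>.\<close>

lemma eigsp_orthogonal:
  assumes "f \<in> O1n" "x \<in> eigsp f a" "y \<in> eigsp f b" "a \<noteq> b"
  shows "Qf x y = 0"
  using eigsp_Qf[OF assms(1,2), of y] eigsp_Qf[OF assms(1,3), of x] assms(4)
  by (simp add: Qf_commute[of y] Qf_commute[of "f *v y"] add.commute)

text \<open>The parameter is symmetric in \<open>\<mu>\<close> and \<open>1 / \<mu>\<close>, so a
  hyperbolic pair of eigenvectors shares one block.\<close>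

lemma eigenvector_eigsp:
  assumes "f *v x = \<mu> *\<^sub>R x" "\<mu> \<noteq> 0"
  shows "x \<in> eigsp f ((\<mu> + 1 / \<mu>) / 2)"
proof -
  have "2 * ((\<mu> + 1 / \<mu>) / 2) * \<mu> = \<mu> * \<mu> + 1"
    using assms(2) by (simp add: distrib_right)
  then show ?thesis
    using assms by (simp add: eigsp_def matrix_vector_mult_scaleR del: mult_2 times_divide_eq_right)
      (metis scaleR_add_left scaleR_one)
qed

lemma fixed_eigsp: "f *v x = x \<Longrightarrow> x \<in> eigsp f 1"
  using eigenvector_eigsp[of f x 1] by simp

lemma negated_eigsp: "f *v x = - x \<Longrightarrow> x \<in> eigsp f (-1)"
  using eigenvector_eigsp[of f x "-1"] by simp

section \<open>Polynomials in a matrix and primary components\<close>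

lemma matrix_mult_scaleR_left: "(c *\<^sub>R (A :: real ^ 'k ^ 'm)) ** B = c *\<^sub>R (A ** B)"
  by (simp add: vec_eq_iff matrix_matrix_mult_def sum_distrib_left mult.assoc)

lemma matrix_mult_scaleR_right: "A ** (c *\<^sub>R (B :: real ^ 'k ^ 'm)) = c *\<^sub>R (A ** B)"
  by (simp add: vec_eq_iff matrix_matrix_mult_def sum_distrib_left mult.left_commute)

lemma matrix_mult_add_rdistrib: "(A + B) ** C = A ** C + B ** (C :: real ^ 'k ^ 'm)"
  by (simp add: vec_eq_iff matrix_matrix_mult_def distrib_right sum.distrib)

lemma matrix_mult_sum_right: "A ** (\<Sum>i\<in>I. B i) = (\<Sum>i\<in>I. A ** (B i :: real ^ 'k ^ 'm))"
  by (induction I rule: infinite_finite_induct) (simp_all add: matrix_add_ldistrib)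

lemma scaleR_matrix_vector: "(c *\<^sub>R (A :: real ^ 'k ^ 'm)) *v x = c *\<^sub>R (A *v x)"
  by (simp add: vec_eq_iff matrix_vector_mult_def sum_distrib_left mult.assoc)

lemma sum_matrix_vector: "(\<Sum>i\<in>I. B i) *v x = (\<Sum>i\<in>I. (B i :: real ^ 'k ^ 'm) *v x)"
  by (induction I rule: infinite_finite_induct) (simp_all add: matrix_vector_mult_add_rdistrib)

lemma matpow_0 [simp]: "matpow A 0 = mat 1"
  by (simp add: matpow_def)

lemma matpow_Suc [simp]: "matpow A (Suc k) = A ** matpow A k"
  by (simp add: matpow_def)

lemma poly_mat_bound:
  assumes "degree p \<le> n"
  shows "poly_mat p A = (\<Sum>i\<le>n. coeff p i *\<^sub>R matpow A i)"
  unfolding poly_mat_def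
  by (rule sum.mono_neutral_left) (use assms in \<open>auto simp: coeff_eq_0\<close>)

lemma poly_mat_0 [simp]: "poly_mat 0 A = 0"
  by (simp add: poly_mat_def)

text \<open>Horner's recursion; it makes polynomials in a matrix accessible to induction over
  \<open>pCons\<close>.\<close>

lemma poly_mat_pCons: "poly_mat (pCons a p) A = a *\<^sub>R mat 1 + A ** poly_mat p A"
proof -
  have "poly_mat (pCons a p) A = (\<Sum>i\<le>Suc (degree p). coeff (pCons a p) i *\<^sub>R matpow A i)"
    by (rule poly_mat_bound) (simp add: degree_pCons_le)
  also have "\<dots> = a *\<^sub>R mat 1 + (\<Sum>i\<le>degree p. coeff p i *\<^sub>R (A ** matpow A i))"
    by (subst sum.atMost_Suc_shift) simp
  also have "(\<Sum>i\<le>degree p. coeff p i *\<^sub>R (A ** matpow A i)) = A ** poly_mat p A"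
    by (simp add: poly_mat_def matrix_mult_sum_right matrix_mult_scaleR_right)
  finally show ?thesis .
qed

lemma poly_mat_add: "poly_mat (p + q) A = poly_mat p A + poly_mat q A"
  by (induction p q rule: poly_induct2) (simp_all add: poly_mat_pCons scaleR_add_left matrix_add_ldistrib)

lemma poly_mat_smult: "poly_mat (smult c p) A = c *\<^sub>R poly_mat p A"
  by (induction p) (simp_all add: poly_mat_pCons scaleR_add_right matrix_mult_scaleR_right)

lemma poly_mat_mult: "poly_mat (p * q) A = poly_mat p A ** poly_mat q A"
proof (induction p)
  case (pCons a p)
  have "(a *\<^sub>R mat 1 + A ** poly_mat p A) ** poly_mat q A
      = a *\<^sub>R (mat 1 ** poly_mat q A) + (A ** poly_mat p A) ** poly_mat q A"
    unfolding matrix_mult_add_rdistrib matrix_mult_scaleR_left ..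
  also have "\<dots> = poly_mat (pCons a p * q) A"
    by (simp add: poly_mat_add poly_mat_smult poly_mat_pCons pCons.IH matrix_mul_assoc)
  finally show ?case by (simp add: poly_mat_pCons)
qed simp

lemma poly_mat_sum: "poly_mat (\<Sum>i\<in>I. p i) A = (\<Sum>i\<in>I. poly_mat (p i) A)"
  by (induction I rule: infinite_finite_induct) (simp_all add: poly_mat_add)

lemma poly_mat_const: "poly_mat [:c:] A = c *\<^sub>R mat 1"
  by (simp add: poly_mat_pCons)

lemma poly_mat_1: "poly_mat 1 A = mat 1"
  by (simp add: one_pCons poly_mat_const)

lemma poly_mat_linear: "poly_mat [:- c, 1:] A *v x = A *v x - c *\<^sub>R x"
  by (simp add: poly_mat_pCons matrix_vector_mult_add_rdistrib matrix_vector_mul_assoc[symmetric]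
      scaleR_matrix_vector matrix_vector_mult_diff_rdistrib)

lemma poly_mat_quadratic: "poly_mat [:c, - d, 1:] A *v x = A *v (A *v x) - d *\<^sub>R (A *v x) + c *\<^sub>R x"
  by (simp add: poly_mat_pCons matrix_vector_mult_add_rdistrib matrix_vector_mul_assoc[symmetric] algebra_simps
      scaleR_matrix_vector)

lemma poly_mat_power: "poly_mat (p ^ k) A = matpow (poly_mat p A) k"
  by (induction k) (simp_all add: poly_mat_mult poly_mat_1)

lemma poly_mat_monom: "poly_mat (monom c k) A = c *\<^sub>R matpow A k"
  by (induction k) (simp_all add: monom_0 monom_Suc poly_mat_const poly_mat_pCons matrix_mult_scaleR_right)

lemma poly_mat_self: "poly_mat [:0, 1:] A = A"
  by (simp add: poly_mat_pCons)

lemma primary_comp_iff: "x \<in> primary_comp (A :: real ^ 'm ^ 'm) p \<longleftrightarrow> poly_mat (p ^ CARD('m)) A *v x = 0"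
  by (simp add: primary_comp_def poly_mat_power)

lemma primary_comp_subspace: "subspace (primary_comp A p)"
  unfolding subspace_def by (simp add: primary_comp_def matrix_vector_right_distrib matrix_vector_mult_scaleR)

lemma poly_mat_kernel_dvd:
  assumes "poly_mat p A *v x = 0" "p dvd q"
  shows "poly_mat q A *v x = 0"
proof -
  obtain r where "q = r * p" using assms(2) by (metis dvdE mult.commute)
  then show ?thesis using assms(1) by (simp add: poly_mat_mult matrix_vector_mul_assoc[symmetric])
qed

lemma poly_mat_kernel_mult_closed:
  assumes "poly_mat p A *v x = 0"
  shows "poly_mat p A *v (poly_mat q A *v x) = 0"
  using poly_mat_kernel_dvd[OF assms, of "p * q"] by (simp add: poly_mat_mult matrix_vector_mul_assoc)

lemma primary_comp_poly_closed: "x \<in> primary_comp A p \<Longrightarrow> poly_mat q A *v x \<in> primary_comp A p"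
  unfolding primary_comp_iff by (rule poly_mat_kernel_mult_closed)

lemma primary_comp_mult_closed: "x \<in> primary_comp A p \<Longrightarrow> A *v x \<in> primary_comp A p"
  using primary_comp_poly_closed[of x A p "[:0, 1:]"] by (simp add: poly_mat_self)

lemma poly_mat_kernel_primary_comp:
  assumes "poly_mat (p ^ k) A *v x = 0" "k \<le> CARD('m)"
  shows "x \<in> primary_comp (A :: real ^ 'm ^ 'm) p"
  unfolding primary_comp_iff using poly_mat_kernel_dvd[OF assms(1)] assms(2) by (simp add: le_imp_power_dvd)

text \<open>The N + 1 vectors \<open>A^i x\<close> with \<open>i \<le> N\<close> are dependent in
  dimension N. The degree bound later keeps multiplicities below the exponent N of
  \<open>primary_comp\<close>.\<close>

lemma ex_local_annihilator:
  fixes A :: "real ^ 'm ^ 'm"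
  shows "\<exists>q. q \<noteq> 0 \<and> degree q \<le> CARD('m) \<and> poly_mat q A *v x = 0"
proof -
  let ?N = "CARD('m)"
  define v where "v i = matpow A i *v x" for i
  have ev: "poly_mat (\<Sum>i\<le>?N. monom (c i) i) A *v x = (\<Sum>i\<le>?N. c i *\<^sub>R v i)" for c
    by (simp add: poly_mat_sum poly_mat_monom sum_matrix_vector scaleR_matrix_vector v_def)
  have "\<exists>c. (\<exists>i\<le>?N. c i \<noteq> 0) \<and> (\<Sum>i\<le>?N. c i *\<^sub>R v i) = 0"
  proof (cases "inj_on v {..?N}")
    case True
    have "dependent (v ` {..?N})"
    proof (rule dependent_biggerset)
      show "DIM(real ^ 'm) < card (v ` {..?N})" using True by (simp add: card_image)
    qed
    then obtain c where c: "\<exists>y\<in>v ` {..?N}. c y \<noteq> 0" "(\<Sum>y\<in>v ` {..?N}. c y *\<^sub>R y) = 0"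
      by (auto simp: dependent_finite)
    then show ?thesis
      by (intro exI[of _ "c \<circ> v"]) (auto simp: sum.reindex[OF True] o_def)
  next
    case False
    then obtain i j where ij: "i \<le> ?N" "j \<le> ?N" "i \<noteq> j" "v i = v j" by (auto simp: inj_on_def)
    \<comment> \<open>If two of the vectors coincide, their set may be too small to be dependent;
      the relation is then the difference of these two.\<close>
    define c where "c k = (if k = i then 1 else 0) - (if k = j then 1 else 0 :: real)" for k
    have "(\<Sum>k\<le>?N. c k *\<^sub>R v k) = (\<Sum>k\<le>?N. if k = i then v i else 0) - (\<Sum>k\<le>?N. if k = j then v j else 0)"
      unfolding sum_subtractf[symmetric] by (rule sum.cong) (auto simp: c_def)
    also have "\<dots> = 0" using ij by (simp add: sum.delta)
    finally show ?thesis using ij by (intro exI[of _ c]) (auto simp: c_def intro!: exI[of _ i])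
  qed
  then obtain c where c: "\<exists>i\<le>?N. c i \<noteq> 0" "(\<Sum>i\<le>?N. c i *\<^sub>R v i) = 0" by blast
  define q where "q = (\<Sum>i\<le>?N. monom (c i) i)"
  have cq: "coeff q i = (if i \<le> ?N then c i else 0)" for i
    by (simp add: q_def coeff_sum)
  have "q \<noteq> 0" using c(1) cq by (metis coeff_0)
  moreover have "degree q \<le> ?N" using cq by (simp add: degree_le)
  moreover have "poly_mat q A *v x = 0" using ev c(2) by (simp add: q_def)
  ultimately show ?thesis by blast
qed

lemma ex_monic_irreducible_factor:
  fixes q :: "real poly"
  assumes "q \<noteq> 0" "\<not> is_unit q"
  obtains p where "p dvd q" "lead_coeff p = 1" "irreducible p"
proof -
  obtain b where b: "b dvd q" "prime b" using prime_divisor_exists assms by blast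
  then have irr: "irreducible b" using prime_elem_imp_irreducible by blast
  then have b0: "b \<noteq> 0" by auto
  define u where "u = [:1 / lead_coeff b:]"
  have u: "is_unit u" using b0 by (simp add: u_def is_unit_const_poly_iff dvd_field_iff)
  show thesis
  proof (rule that[of "u * b"])
    show "u * b dvd q" using b(1) u by (simp add: mult_unit_dvd_iff')
    show "lead_coeff (u * b) = 1" using b0 by (simp add: u_def)
    show "irreducible (u * b)" using irr u by (simp add: irreducible_mult_unit_left)
  qed
qed

text \<open>Split off the full power \<open>p ^ k\<close> of one irreducible factor. A Bezout
  identity for \<open>p ^ k\<close> and the cofactor \<open>r\<close> writes \<open>x\<close> as a
  vector killed by \<open>p ^ k\<close> plus one killed by \<open>r\<close>, and the degree has
  dropped. As \<open>k\<close> is at most the degree of \<open>q\<close>, the exponent N in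
  \<open>primary_comp\<close> is large enough.\<close>

lemma kernel_in_span_primary_comps:
  fixes A :: "real ^ 'm ^ 'm"
  assumes "q \<noteq> 0" "degree q \<le> CARD('m)" "poly_mat q A *v x = 0"
  shows "x \<in> span (\<Union>{primary_comp A p | p. lead_coeff p = 1 \<and> irreducible p})" (is "_ \<in> ?S")
  using assms
proof (induction "degree q" arbitrary: q x rule: less_induct)
  case less
  show ?case
  proof (cases "is_unit q")
    case True
    then obtain c where "q = [:c:]" "c dvd 1" by (meson is_unit_poly_iff)
    then have "x = 0" using less.prems by (auto simp: poly_mat_const scaleR_matrix_vector)
    then show ?thesis by (simp add: span_zero)
  next
    case False
    then obtain p where p: "p dvd q" "lead_coeff p = 1" "irreducible p"
      using ex_monic_irreducible_factor less.prems by blast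
    define k where "k = multiplicity p q"
    obtain r where r: "q = p ^ k * r" "\<not> p dvd r"
      using multiplicity_decompose'[of q p] p less.prems(1) unfolding k_def
      by (metis irreducible_not_unit)
    have r0: "r \<noteq> 0" "p \<noteq> 0" using r less.prems(1) p by auto
    have "k \<noteq> 0" using r p by (cases k) auto
    have degp: "degree p > 0" using p(3)
      by (metis irreducible_not_unit is_unit_iff_degree r0(2) gr0I)
    have degq: "degree q = k * degree p + degree r"
      using r r0 by (simp add: degree_mult_eq degree_power_eq)
    have "k \<le> k * degree p" using degp by simp
    then have kN: "k \<le> CARD('m)" using less.prems(2) degq by linarith
    have "coprime p r"
      using p r irreducible_imp_prime_elem_gcd prime_elem_imp_coprime by blast
    then have "coprime (p ^ k) r" by simp
    then obtain a b where ab: "a * p ^ k + b * r = 1"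
      using bezout_coefficients_fst_snd[of "p ^ k" r] by (metis coprime_iff_gcd_eq_1)
    define y1 where "y1 = poly_mat (b * r) A *v x"
    define y2 where "y2 = poly_mat (a * p ^ k) A *v x"
    have x: "x = y2 + y1"
      unfolding y1_def y2_def matrix_vector_mult_add_rdistrib[symmetric] poly_mat_add[symmetric] ab
      by (simp add: poly_mat_1)
    have "poly_mat (p ^ k) A *v y1 = poly_mat (b * q) A *v x"
      by (simp add: y1_def matrix_vector_mul_assoc poly_mat_mult[symmetric] r ac_simps)
    also have "\<dots> = 0" by (rule poly_mat_kernel_dvd[OF less.prems(3)]) simp
    finally have "y1 \<in> primary_comp A p" using kN poly_mat_kernel_primary_comp by blast
    then have y1: "y1 \<in> ?S" using p by (intro span_base) blast
    have "poly_mat r A *v y2 = poly_mat (a * q) A *v x"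
      by (simp add: y2_def matrix_vector_mul_assoc poly_mat_mult[symmetric] r ac_simps)
    also have "\<dots> = 0" by (rule poly_mat_kernel_dvd[OF less.prems(3)]) simp
    finally have "y2 \<in> ?S"
      using less.hyps[of r y2] degq degp \<open>k \<noteq> 0\<close> less.prems(2) r0 by simp
    then show ?thesis using x y1 by (simp add: span_add)
  qed
qed

lemma span_primary_comps:
  "span (\<Union>{primary_comp A p | p. lead_coeff p = 1 \<and> irreducible p}) = (UNIV :: (real ^ 'm) set)"
  using kernel_in_span_primary_comps ex_local_annihilator[of A] by blast

section \<open>Complex roots of real polynomials and the characteristic polynomial\<close>

lemma poly_of_real_eval:
  "poly (map_poly complex_of_real p) (complex_of_real c) = complex_of_real (poly p c)"
  by (induction p) (simp_all add: map_poly_pCons)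

lemma map_poly_of_real_add:
  "map_poly complex_of_real (p + q) = map_poly complex_of_real p + map_poly complex_of_real q"
  by (rule poly_eqI) (simp add: coeff_map_poly)

lemma map_poly_of_real_smult:
  "map_poly complex_of_real (smult c q) = smult (of_real c) (map_poly complex_of_real q)"
  by (rule poly_eqI) (simp add: coeff_map_poly)

lemma map_poly_of_real_mult:
  "map_poly complex_of_real (p * q) = map_poly complex_of_real p * map_poly complex_of_real q"
  by (induction p) (simp_all add: map_poly_of_real_add map_poly_of_real_smult map_poly_pCons)

text \<open>The remainder modulo the quadratic is a real linear polynomial that also vanishes at the
  non-real \<open>z\<close>, so both its coefficients are 0.\<close>

lemma quadratic_dvd_of_complex_root:
  fixes p :: "real poly"
  assumes "poly (map_poly complex_of_real p) z = 0" "Im z \<noteq> 0"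
  shows "[:(cmod z)\<^sup>2, - (2 * Re z), 1:] dvd p"
proof -
  let ?q = "[:(cmod z)\<^sup>2, - (2 * Re z), 1:]"
  define r where "r = p mod ?q"
  have "degree r < 2" using degree_mod_less[of ?q p] by (auto simp: r_def)
  then have "r = [:coeff r 0, coeff r 1:]"
    by (intro poly_eqI) (auto simp: coeff_pCons coeff_eq_0 split: nat.splits)
  then obtain a b where r: "r = [:a, b:]" by blast
  have "poly (map_poly complex_of_real ?q) z = of_real ((cmod z)\<^sup>2) - z * (of_real (2 * Re z) - z)"
    by (simp add: map_poly_pCons algebra_simps)
  also have "\<dots> = 0" unfolding complex_norm_square complex_add_cnj[symmetric] by (simp add: algebra_simps)
  finally have q0: "poly (map_poly complex_of_real ?q) z = 0" .
  have "p = (p div ?q) * ?q + r" unfolding r_def by (rule div_mult_mod_eq[symmetric])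
  then have "poly (map_poly complex_of_real p) z
      = poly (map_poly complex_of_real (p div ?q) * map_poly complex_of_real ?q + map_poly complex_of_real r) z"
    using map_poly_of_real_add map_poly_of_real_mult by metis
  then have "poly (map_poly complex_of_real r) z = 0"
    using assms(1) q0 by simp
  then have "of_real a + z * of_real b = 0" by (simp add: r map_poly_pCons)
  then have "b = 0 \<and> a = 0" using assms(2) by (auto simp: complex_eq_iff)
  then have "r = 0" by (simp add: r)
  then show ?thesis unfolding r_def by (simp add: dvd_eq_mod_eq_0)
qed

lemma monic_irreducible_unique:
  fixes p d :: "real poly"
  assumes "irreducible p" "lead_coeff p = 1" "d dvd p" "degree d > 0" "lead_coeff d = 1"
  shows "p = d"
proof -
  have "p dvd d" using irreducibleD'[OF assms(1,3)] assms(4)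
    by (metis degree_0 is_unit_iff_degree less_irrefl)
  obtain s where s: "p = d * s" using assms(3) by blast
  have p0: "p \<noteq> 0" and d0: "d \<noteq> 0" using assms by auto
  have "degree p \<le> degree d" using \<open>p dvd d\<close> d0 by (rule dvd_imp_degree_le)
  then have "degree s = 0" using s p0 by (auto simp: degree_mult_eq)
  then obtain c where c: "s = [:c:]" by (meson degree_eq_zeroE)
  moreover have "lead_coeff d * lead_coeff s = 1" using assms(2) unfolding s lead_coeff_mult .
  ultimately have "c = 1" using assms(5) by simp
  then show ?thesis using s c by simp
qed

lemma irreducible_real_poly_complex_root:
  fixes p :: "real poly"
  assumes "irreducible p" "lead_coeff p = 1"
  obtains z where "poly (map_poly complex_of_real p) z = 0" 
    "Im z = 0 \<Longrightarrow> p = [:- Re z, 1:]" "Im z \<noteq> 0 \<Longrightarrow> p = [:(cmod z)\<^sup>2, - (2 * Re z), 1:]"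
proof -
  have "degree p > 0"
    using assms by (metis irreducible_not_unit is_unit_iff_degree gr0I not_irreducible_zero)
  then have "degree (map_poly complex_of_real p) \<noteq> 0"
    by (subst degree_map_poly) auto
  then obtain z where z: "poly (map_poly complex_of_real p) z = 0"
    using fundamental_theorem_of_algebra[of "map_poly complex_of_real p"]
      constant_degree[of "map_poly complex_of_real p"] by auto
  show thesis
  proof (rule that[OF z])
    assume "Im z = 0"
    then have "z = of_real (Re z)" by (simp add: complex_eq_iff)
    then have "poly p (Re z) = 0" using z poly_of_real_eval[of p "Re z"] by simp
    then show "p = [:- Re z, 1:]"
      using assms by (intro monic_irreducible_unique) (auto simp: poly_eq_0_iff_dvd)
  next
    assume "Im z \<noteq> 0"
    then show "p = [:(cmod z)\<^sup>2, - (2 * Re z), 1:]"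
      using assms quadratic_dvd_of_complex_root[OF z] by (intro monic_irreducible_unique) auto
  qed
qed

lemma cmat_cvec: "cmat A *v cvec x = cvec (A *v x)"
  by (simp add: vec_eq_iff cmat_def cvec_def matrix_vector_mult_def)

lemma cvec_add: "cvec (x + y) = cvec x + cvec y"
  by (simp add: vec_eq_iff cvec_def)

lemma cvec_diff: "cvec (x - y) = cvec x - cvec y"
  by (simp add: vec_eq_iff cvec_def)

lemma cvec_scaleR: "cvec (c *\<^sub>R x) = complex_of_real c *s cvec x"
  by (simp add: vec_eq_iff cvec_def)

lemma cvec_0 [simp]: "cvec 0 = 0"
  by (simp add: vec_eq_iff cvec_def)

lemma cvec_ReIm_eq:
  "cvec x + \<i> *s cvec y = cvec x' + \<i> *s cvec y' \<longleftrightarrow> x = x' \<and> y = y'"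
  by (auto simp: vec_eq_iff cvec_def complex_eq_iff)

lemma poly_charpoly:
  fixes A :: "real ^ 'm ^ 'm"
  shows "poly (map_poly complex_of_real (charpoly A)) z = det (mat z - cmat A)"
proof -
  \<comment> \<open>Evaluation at \<open>z\<close> is a ring homomorphism, so it passes through the
    Leibniz formula of the determinant.\<close>
  define h where "h p = poly (map_poly complex_of_real p) z" for p
  have h_add: "h (p + q) = h p + h q" and h_mult: "h (p * q) = h p * h q" for p q
    by (simp_all add: h_def map_poly_of_real_add map_poly_of_real_mult)
  have h0: "h 0 = 0" and h1: "h 1 = 1" by (simp_all add: h_def)
  have h_sum: "h (sum F S) = (\<Sum>i\<in>S. h (F i))" for F and S :: "('m \<Rightarrow> 'm) set"
    by (induction S rule: infinite_finite_induct) (simp_all add: h_add h0)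
  have h_prod: "h (prod F S) = (\<Prod>i\<in>S. h (F i))" for F and S :: "'m set"
    by (induction S rule: infinite_finite_induct) (simp_all add: h_mult h1)
  have h_minus: "h (- p) = - h p" for p using h_add[of p "- p"] by (simp add: h0 eq_neg_iff_add_eq_0 add.commute)
  have h_sign: "h (of_int (sign \<sigma>)) = of_int (sign \<sigma>)" for \<sigma> :: "'m \<Rightarrow> 'm"
    by (simp add: sign_def h1 h_minus)
  have h_entry: "h ((if i = j then [:0, 1:] else 0) - [:A $ i $ j:]) = (mat z - cmat A) $ i $ j" for i j
    by (simp add: h_def map_poly_pCons mat_def cmat_def)
  have "h (charpoly A) = det (mat z - cmat A)"
    unfolding charpoly_def det_def h_sum h_mult h_prod h_sign by (simp add: h_entry del: vector_minus_component)
  then show ?thesis by (simp add: h_def)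
qed

lemma eigenvalue_charpoly_root:
  assumes "w \<noteq> 0" "cmat A *v w = z *s w"
  shows "poly (map_poly complex_of_real (charpoly A)) z = 0"
proof -
  let ?M = "mat z - cmat A"
  have "mat z *v w = z *s w"
    by (simp add: vec_eq_iff mat_def matrix_vector_mult_def if_distrib[of "\<lambda>x. x * _"] cong: if_cong)
  then have "?M *v w = 0" using assms(2) by (simp add: matrix_vector_mult_diff_rdistrib)
  then have "\<not> invertible ?M"
    using assms(1) matrix_left_invertible_ker[of ?M] unfolding invertible_def by blast
  then show ?thesis by (simp add: invertible_det_nz poly_charpoly)
qed

text \<open>The last nonzero vector among \<open>x\<close>, \<open>p(A) x\<close>,
  \<open>p(A)^2 x\<close>, ... is a witness.\<close>

lemma poly_mat_power_kernel_nontrivial: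
  assumes "poly_mat (p ^ k) A *v x = 0" "x \<noteq> 0"
  shows "\<exists>y. y \<noteq> 0 \<and> poly_mat p A *v y = 0"
  using assms
proof (induction k arbitrary: x)
  case 0
  then show ?case by (simp add: poly_mat_1)
next
  case (Suc k)
  show ?case
  proof (cases "poly_mat p A *v x = 0")
    case True
    then show ?thesis using Suc.prems by blast
  next
    case False
    have "poly_mat (p ^ k) A *v (poly_mat p A *v x) = 0"
      using Suc.prems by (simp add: matrix_vector_mul_assoc poly_mat_mult[symmetric] mult.commute)
    then show ?thesis using Suc.IH False by blast
  qed
qed

text \<open>Bridges \<open>span_primary_comps\<close>, which ranges over all monic irreducible
  \<open>p\<close>, and \<open>Vs\<close>, \<open>Vt\<close>, which range over factors of
  \<open>charpoly\<close>: the remaining components are zero.\<close>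

lemma primary_comp_nontrivial_dvd_charpoly:
  fixes A :: "real ^ 'm ^ 'm"
  assumes "irreducible p" "lead_coeff p = 1" "x \<in> primary_comp A p" "x \<noteq> 0"
  shows "p dvd charpoly A"
proof -
  obtain y where y: "y \<noteq> 0" "poly_mat p A *v y = 0"
    using poly_mat_power_kernel_nontrivial assms(3,4) unfolding primary_comp_iff by blast
  obtain z where z: "Im z = 0 \<Longrightarrow> p = [:- Re z, 1:]" "Im z \<noteq> 0 \<Longrightarrow> p = [:(cmod z)\<^sup>2, - (2 * Re z), 1:]"
    using irreducible_real_poly_complex_root[OF assms(1,2)] by metis
  show ?thesis
  proof (cases "Im z = 0")
    case True
    have "A *v y = Re z *\<^sub>R y" using y(2) unfolding z(1)[OF True] poly_mat_linear by simp
    then have "cmat A *v cvec y = of_real (Re z) *s cvec y" by (simp add: cmat_cvec cvec_scaleR)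
    moreover have "cvec y \<noteq> 0" using y(1) by (simp add: vec_eq_iff cvec_def)
    ultimately have "poly (map_poly complex_of_real (charpoly A)) (of_real (Re z)) = 0"
      using eigenvalue_charpoly_root by blast
    then show ?thesis unfolding z(1)[OF True] poly_of_real_eval by (simp add: poly_eq_0_iff_dvd)
  next
    case False
    have Ay: "A *v (A *v y) = (2 * Re z) *\<^sub>R (A *v y) - ((cmod z)\<^sup>2) *\<^sub>R y"
      using y(2) unfolding z(2)[OF False] poly_mat_quadratic by (simp add: algebra_simps)
    \<comment> \<open>\<open>A - z\<close> and \<open>A - cnj z\<close> multiply to the quadratic,
      which kills \<open>y\<close>; hence \<open>(A - cnj z) y\<close> is an eigenvector for
      \<open>z\<close>.\<close>
    define w where "w = cvec (A *v y) - cnj z *s cvec y"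
    have "cmat A *v w = cvec (A *v (A *v y)) - cnj z *s cvec (A *v y)"
      by (simp add: w_def matrix_vector_mult_diff_distrib cmat_cvec vec.scale vector_scalar_commute)
    also have "\<dots> = (of_real (2 * Re z) - cnj z) *s cvec (A *v y) - of_real ((cmod z)\<^sup>2) *s cvec y"
      unfolding Ay cvec_diff cvec_scaleR by (simp add: vector_sub_rdistrib)
    also have "of_real (2 * Re z) - cnj z = z" by (simp add: complex_eq_iff)
    also have "of_real ((cmod z)\<^sup>2) = z * cnj z" by (rule complex_norm_square)
    finally have "cmat A *v w = z *s w" by (simp add: w_def vector_ssub_ldistrib)
    moreover have "w \<noteq> 0"
    proof
      assume "w = 0"
      then have "w $ i = 0" for i by simp
      then have "y $ i = 0" for i using False by (auto simp: w_def cvec_def complex_eq_iff) 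
      then show False using y(1) by (simp add: vec_eq_iff)
    qed
    ultimately show ?thesis
      unfolding z(2)[OF False] using False quadratic_dvd_of_complex_root eigenvalue_charpoly_root by blast
  qed
qed

section \<open>Blocks against primary components of an isometry\<close>

lemma poly_mat_eigenvector:
  assumes "f *v u = \<mu> *\<^sub>R u"
  shows "poly_mat q f *v u = poly q \<mu> *\<^sub>R u"
  using assms
  by (induction q) (simp_all add: poly_mat_pCons matrix_vector_mult_add_rdistrib scaleR_matrix_vector
      matrix_vector_mul_assoc[symmetric] matrix_vector_mult_scaleR scaleR_add_left mult.commute)

text \<open>Moving \<open>f\<close> to the other side of \<open>Q\<close> turns it into its inverse,
  which acts on \<open>u\<close> as \<open>1 / \<mu>\<close>.\<close>

lemma Qf_poly_mat_eigenvector: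
  assumes "f \<in> O1n" "f *v u = \<mu> *\<^sub>R u" "\<mu> \<noteq> 0"
  shows "Qf (poly_mat q f *v x) u = poly q (1 / \<mu>) * Qf x u"
proof (induction q)
  case (pCons a q)
  have "Qf (f *v y) u = (1 / \<mu>) * Qf y u" for y
    using O1n_Qf[OF assms(1), of y u] assms(2,3) by (simp add: Qf_simps field_simps)
  then show ?case using pCons.IH
    by (simp add: poly_mat_pCons matrix_vector_mult_add_rdistrib scaleR_matrix_vector
        matrix_vector_mul_assoc[symmetric] Qf_simps algebra_simps)
qed simp

abbreviation quad :: "real \<Rightarrow> real poly" where "quad a \<equiv> [:1, - (2 * a), 1:]"

lemma poly_mat_quad: "poly_mat (quad a) f *v x = f *v (f *v x) - (2 * a) *\<^sub>R (f *v x) + x"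
  using poly_mat_quadratic[of 1 "2 * a" f x] by simp

lemma eigsp_iff_quad: "x \<in> eigsp f a \<longleftrightarrow> poly_mat (quad a) f *v x = 0"
  unfolding eigsp_eq poly_mat_quad by (simp add: eq_diff_eq diff_add_eq)

text \<open>Up to the factor \<open>f\<close>, \<open>quad a\<close> at \<open>f\<close> is
  \<open>f + f^-1 - 2 a\<close>. In the product of \<open>y\<close> with itself this self-adjoint
  operator can be moved from \<open>x\<close> to \<open>y\<close>, which it kills.\<close>

lemma quad_kernel_null:
  assumes f: "f \<in> O1n" and "poly_mat (quad a) f *v x \<in> eigsp f a"
  shows "Qf (poly_mat (quad a) f *v x) (poly_mat (quad a) f *v x) = 0"
proof -
  define y where "y = poly_mat (quad a) f *v x"
  have "Qf (f *v y) (f *v x) + Qf y (f *v (f *v x)) = 2 * a * Qf y (f *v x)"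
    using eigsp_Qf[OF f assms(2)] by (simp add: y_def)
  then have "Qf y (f *v (f *v x) - (2 * a) *\<^sub>R (f *v x) + x) = 0"
    by (simp add: Qf_simps O1n_Qf[OF f])
  then show ?thesis by (simp add: y_def poly_mat_quad)
qed

text \<open>A null vector of \<open>W\<close> is 0, so by \<open>quad_kernel_null\<close> the
  kernels of the powers of \<open>quad a\<close> do not grow inside \<open>W\<close>. Needed to pass
  from a positive primary component to a block.\<close>

lemma kernel_quad_power_posdef:
  assumes f: "f \<in> O1n" and W: "Qposdef W" "\<And>x. x \<in> W \<Longrightarrow> poly_mat (quad a) f *v x \<in> W"
    and x: "x \<in> W" "poly_mat (quad a ^ k) f *v x = 0"
  shows "x \<in> eigsp f a"
  using x
proof (induction k arbitrary: x)
  case 0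
  then show ?case by (simp add: poly_mat_1 eigsp_def)
next
  case (Suc k)
  let ?y = "poly_mat (quad a) f *v x"
  have "poly_mat (quad a ^ k) f *v ?y = 0"
    using Suc.prems by (simp add: matrix_vector_mul_assoc poly_mat_mult[symmetric] mult.commute)
  then have "?y \<in> eigsp f a" using Suc.IH W(2) Suc.prems by blast
  then have "Qf ?y ?y = 0" by (rule quad_kernel_null[OF f])
  moreover have "?y \<in> W" using W(2) Suc.prems by blast
  ultimately have "?y = 0" using W(1) unfolding Qposdef_def by fastforce
  then show ?case by (simp add: eigsp_iff_quad)
qed

text \<open>The same descent for the opposite passage: here positivity is known on the block alone,
  and the induction hypothesis places the null vector there.\<close>

lemma kernel_quad_power_eigsp:
  assumes f: "f \<in> O1n" and D: "Qposdef (eigsp f a)" and x: "poly_mat (quad a ^ k) f *v x = 0"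
  shows "x \<in> eigsp f a"
  using x
proof (induction k arbitrary: x)
  case 0
  then show ?case by (simp add: poly_mat_1 eigsp_def)
next
  case (Suc k)
  let ?y = "poly_mat (quad a) f *v x"
  have "poly_mat (quad a ^ k) f *v ?y = 0"
    using Suc.prems by (simp add: matrix_vector_mul_assoc poly_mat_mult[symmetric] mult.commute)
  then have y: "?y \<in> eigsp f a" using Suc.IH by blast
  then have "Qf ?y ?y = 0" by (rule quad_kernel_null[OF f])
  then have "?y = 0" using D y unfolding Qposdef_def by fastforce
  then show ?case by (simp add: eigsp_iff_quad)
qed

lemma kernel_subset_primary_comp:
  assumes "poly_mat p A *v y = 0"
  shows "y \<in> primary_comp A p"
  using assms poly_mat_kernel_primary_comp[of p 1 A y] by (simp add: Suc_leI)

lemma quad_pm1: "c\<^sup>2 = 1 \<Longrightarrow> quad c = [:- c, 1:] ^ 2"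
  by (simp add: power2_eq_square)

lemma primary_comp_linear_subset:
  fixes f :: "'n::finite lmat"
  assumes "c\<^sup>2 = 1"
  shows "eigsp f c \<subseteq> primary_comp f [:- c, 1:]"
proof
  fix x assume "x \<in> eigsp f c"
  then have "poly_mat ([:- c, 1:] ^ 2) f *v x = 0" unfolding eigsp_iff_quad quad_pm1[OF assms] .
  \<comment> \<open>The exponent 2 is admissible because the dimension n + 1 is at least 2.\<close>
  then show "x \<in> primary_comp f [:- c, 1:]"
    by (rule poly_mat_kernel_primary_comp) (simp add: card_option Suc_leI)
qed

lemma primary_comp_linear_quad_power:
  fixes f :: "'n::finite lmat"
  assumes "c\<^sup>2 = 1" "x \<in> primary_comp f [:- c, 1:]"
  shows "poly_mat (quad c ^ CARD('n option)) f *v x = 0"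
  unfolding quad_pm1[OF assms(1)] power_mult[symmetric]
  by (rule poly_mat_kernel_dvd[OF assms(2)[unfolded primary_comp_iff]])
     (rule le_imp_power_dvd, simp)

text \<open>Here \<open>b\<close> is the determinant of \<open>f\<close> on the invariant plane of \<open>y\<close>.\<close>
lemma isometry_quadratic_norm:
  assumes f: "f \<in> O1n" and y: "Qf y y > 0" "f *v (f *v y) = (2 * a) *\<^sub>R (f *v y) - b *\<^sub>R y" and b: "b > a\<^sup>2"
  shows "b = 1"
proof -
  define q where "q = Qf y y"
  define t where "t = Qf y (f *v y)"
  have q1: "Qf (f *v y) (f *v y) = q" by (simp add: O1n_Qf[OF f] q_def)
  have t': "Qf (f *v y) y = t" by (simp add: t_def Qf_commute)
  have "t = Qf (f *v y) (f *v (f *v y))" by (simp add: O1n_Qf[OF f] t_def)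
  then have t1: "t = 2 * a * q - b * t" unfolding y(2) by (simp add: Qf_simps q1 t')
  have "q = Qf (f *v (f *v y)) (f *v (f *v y))" by (simp add: O1n_Qf[OF f] q_def)
  then have q2: "q = 4 * a\<^sup>2 * q - 4 * a * b * t + b\<^sup>2 * q"
    unfolding y(2) by (simp add: Qf_simps q1 t' t_def[symmetric] q_def[symmetric] power2_eq_square algebra_simps)
  have b0: "b \<ge> 0" using b zero_le_power2[of a] by linarith
  have t2: "t * (1 + b) = 2 * a * q" using t1 by (simp add: algebra_simps)
  \<comment> \<open>Multiplying by \<open>1 + b\<close> allows \<open>t\<close> to be eliminated
    through \<open>t2\<close>. What remains factors as \<open>q (1 - b) ((1 + b)^2 - 4 a^2)\<close>,
    and the last factor is positive: \<open>(1 + b)^2 \<ge> 4 b > 4 a^2\<close>.\<close>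
  have "q * (1 + b) = 4 * a\<^sup>2 * q * (1 + b) - 4 * a * b * (t * (1 + b)) + b\<^sup>2 * q * (1 + b)"
    using arg_cong[OF q2, of "\<lambda>x. x * (1 + b)"] by (simp add: algebra_simps)
  then have "q * ((1 - b) * ((1 + b)\<^sup>2 - 4 * a\<^sup>2)) = 0"
    unfolding t2 by (simp add: algebra_simps power2_eq_square)
  then have "b = 1 \<or> (1 + b)\<^sup>2 = 4 * a\<^sup>2" using y(1) by (auto simp: q_def)
  moreover have "(1 + b)\<^sup>2 \<noteq> 4 * a\<^sup>2"
  proof
    assume h: "(1 + b)\<^sup>2 = 4 * a\<^sup>2"
    have "(1 - b)\<^sup>2 + 4 * b = (1 + b)\<^sup>2" by (simp add: power2_eq_square algebra_simps)
    then have "4 * b \<le> 4 * a\<^sup>2" using h zero_le_power2[of "1 - b"] by linarith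
    then show False using b by simp
  qed
  ultimately show ?thesis by blast
qed

text \<open>By irreducibility \<open>p\<close> is linear or a quadratic without real roots. A kernel
  vector of positive length forces the root to be 1 or -1, or the constant term to be 1, and
  positivity rules out a nilpotent part.\<close>

lemma posdef_primary_comp_eigsp:
  fixes f :: "'n::finite lmat"
  assumes f: "f \<in> O1n" and p: "irreducible p" "lead_coeff p = 1"
    and P: "Qposdef (primary_comp f p)" and x: "x \<in> primary_comp f p" "x \<noteq> 0"
  obtains a where "- 1 \<le> a" "a \<le> 1" "primary_comp f p = eigsp f a"
proof -
  let ?P = "primary_comp f p"
  obtain z where z: "Im z = 0 \<Longrightarrow> p = [:- Re z, 1:]" "Im z \<noteq> 0 \<Longrightarrow> p = [:(cmod z)\<^sup>2, - (2 * Re z), 1:]"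
    using irreducible_real_poly_complex_root[OF p] by metis
  obtain y where y: "y \<noteq> 0" "poly_mat p f *v y = 0"
    using poly_mat_power_kernel_nontrivial x unfolding primary_comp_iff by blast
  then have "y \<in> ?P" using kernel_subset_primary_comp by blast
  then have yy: "Qf y y > 0" using P y(1) by (simp add: Qposdef_def)
  show thesis
  proof (cases "Im z = 0")
    case True
    define c where "c = Re z"
    have pc: "p = [:- c, 1:]" using z(1)[OF True] by (simp add: c_def)
    have "f *v y = c *\<^sub>R y" using y(2) unfolding pc poly_mat_linear by simp
    then have c: "c\<^sup>2 = 1" using isometry_eigenvalue_square[OF f] yy by force
    have "?P = eigsp f c"
    proof
      show "eigsp f c \<subseteq> ?P" unfolding pc by (rule primary_comp_linear_subset[OF c])
      show "?P \<subseteq> eigsp f c"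
      proof
        fix w assume w: "w \<in> ?P"
        then have "poly_mat (quad c ^ CARD('n option)) f *v w = 0"
          using primary_comp_linear_quad_power[OF c] unfolding pc by blast
        then show "w \<in> eigsp f c"
          using kernel_quad_power_posdef[OF f P _ w] primary_comp_poly_closed by blast
      qed
    qed
    moreover have "- 1 \<le> c \<and> c \<le> 1" using c by (auto simp: power2_eq_1_iff)
    ultimately show thesis using that by blast
  next
    case False
    define a where "a = Re z"
    define b where "b = (cmod z)\<^sup>2"
    have pb: "p = [:b, - (2 * a), 1:]" using z(2)[OF False] by (simp add: a_def b_def)
    have bIm: "b = a\<^sup>2 + (Im z)\<^sup>2" by (simp add: a_def b_def cmod_power2)
    then have "b > a\<^sup>2" using False by simp
    moreover have "f *v (f *v y) = (2 * a) *\<^sub>R (f *v y) - b *\<^sub>R y"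
      using y(2) unfolding pb poly_mat_quadratic by (simp add: eq_diff_eq diff_add_eq)
    ultimately have b1: "b = 1" using isometry_quadratic_norm[OF f yy] by blast
    have pq: "p = quad a" using pb b1 by simp
    have "?P = eigsp f a"
    proof
      show "eigsp f a \<subseteq> ?P" unfolding pq using kernel_subset_primary_comp eigsp_iff_quad by blast
      show "?P \<subseteq> eigsp f a"
      proof
        fix w assume w: "w \<in> ?P"
        then have "poly_mat (quad a ^ CARD('n option)) f *v w = 0"
          unfolding pq primary_comp_iff .
        then show "w \<in> eigsp f a"
          using kernel_quad_power_posdef[OF f P _ w] primary_comp_poly_closed by blast
      qed
    qed
    moreover have "a\<^sup>2 \<le> 1" using bIm b1 zero_le_power2[of "Im z"] by linarith
    then have "- 1 \<le> a \<and> a \<le> 1" using abs_le_square_iff[of a 1] by auto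
    ultimately show thesis using that by blast
  qed
qed

text \<open>Completing the square gives \<open>(X - a)^2 + 1 - a^2 > 0\<close>, so a monic
  irreducible factor has no real root; it has degree 2 and exhausts \<open>quad a\<close>.\<close>

lemma irreducible_quad:
  assumes "\<bar>a\<bar> < 1"
  shows "irreducible (quad a)"
proof -
  have "\<not> is_unit (quad a)" "quad a \<noteq> 0" by (simp_all add: is_unit_pCons_iff)
  then obtain p where p: "p dvd quad a" "lead_coeff p = 1" "irreducible p"
    using ex_monic_irreducible_factor by blast
  obtain z where z: "Im z = 0 \<Longrightarrow> p = [:- Re z, 1:]" "Im z \<noteq> 0 \<Longrightarrow> p = [:(cmod z)\<^sup>2, - (2 * Re z), 1:]"
    using irreducible_real_poly_complex_root[OF p(3,2)] by metis
  have "Im z \<noteq> 0"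
  proof
    assume "Im z = 0"
    then have "poly (quad a) (Re z) = 0" using z(1) p(1) by (simp only: poly_eq_0_iff_dvd)
    then have "(Re z - a)\<^sup>2 + (1 - a\<^sup>2) = 0" by (simp add: power2_eq_square algebra_simps)
    moreover have "a\<^sup>2 < 1" using assms by (simp add: abs_square_less_1)
    ultimately show False using zero_le_power2[of "Re z - a"] by linarith
  qed
  then have deg: "degree p = 2" using z(2) by simp
  obtain s where s: "quad a = p * s" using p(1) by blast
  then have "s \<noteq> 0" "p \<noteq> 0" by auto
  then have "2 = degree p + degree s" using s degree_mult_eq[of p s] by (metis degree_pCons_eq_if numeral_2_eq_2 one_neq_zero pCons_eq_0_iff degree_0)
  then have "degree s = 0" using deg by simp
  then obtain c where "s = [:c:]" by (meson degree_eq_zeroE)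
  moreover have "lead_coeff p * lead_coeff s = 1" using arg_cong[OF s, of lead_coeff] by (simp only: lead_coeff_mult) simp
  ultimately show ?thesis using s p by simp
qed

text \<open>The prime is \<open>quad a\<close> inside the interval. At the endpoints it is
  \<open>X - a\<close>, of which \<open>quad a\<close> is the square.\<close>

lemma posdef_eigsp_primary_comp:
  fixes f :: "'n::finite lmat"
  assumes f: "f \<in> O1n" and D: "Qposdef (eigsp f a)" and a: "- 1 \<le> a" "a \<le> 1"
  obtains p where "irreducible p" "lead_coeff p = 1" "primary_comp f p = eigsp f a"
proof (cases "\<bar>a\<bar> < 1")
  case True
  have "primary_comp f (quad a) = eigsp f a"
  proof
    show "primary_comp f (quad a) \<subseteq> eigsp f a"
      using kernel_quad_power_eigsp[OF f D] primary_comp_iff by blast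
    show "eigsp f a \<subseteq> primary_comp f (quad a)"
      using kernel_subset_primary_comp eigsp_iff_quad by blast
  qed
  then show thesis using that irreducible_quad[OF True] by simp
next
  case False
  then have c: "a\<^sup>2 = 1" using a by (auto simp: power2_eq_1_iff)
  have "primary_comp f [:- a, 1:] = eigsp f a"
    using primary_comp_linear_subset[OF c] primary_comp_linear_quad_power[OF c] kernel_quad_power_eigsp[OF f D]
    by blast
  then show thesis using that[of "[:- a, 1:]"] by (simp add: irreducible_linear_field_poly)
qed

section \<open>The space-time decomposition\<close>

text \<open>Index set of the blocks that make up \<open>V_s\<close>: interior values are real parts
  of non-real eigenvalue pairs, the endpoints are the eigenvalues 1 and -1.\<close>

definition pos_params :: "'n::finite lmat \<Rightarrow> real set" where
  "pos_params f = {a. - 1 \<le> a \<and> a \<le> 1 \<and> Qposdef (eigsp f a) \<and> eigsp f a \<noteq> {0}}"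

lemma Vs_eq_span_eigsp:
  assumes f: "f \<in> O1n"
  shows "Vs f = span (\<Union>a\<in>pos_params f. eigsp f a)" (is "_ = span ?U")
proof
  show "Vs f \<subseteq> span ?U"
    unfolding Vs_def
  proof (rule span_minimal, rule subsetI)
    fix x assume "x \<in> \<Union>{primary_comp f p | p. p \<in> prime_factors_cp f \<and> Qposdef (primary_comp f p)}"
    then obtain p where p: "irreducible p" "lead_coeff p = 1" "Qposdef (primary_comp f p)" "x \<in> primary_comp f p"
      by (auto simp: prime_factors_cp_def)
    show "x \<in> span ?U"
    proof (cases "x = 0")
      case False
      then obtain a where a: "- 1 \<le> a" "a \<le> 1" "primary_comp f p = eigsp f a"
        using posdef_primary_comp_eigsp[OF f p] by blast
      then have "a \<in> pos_params f" using p False by (auto simp: pos_params_def)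
      then show ?thesis using p(4) a(3) by (intro span_base) blast
    qed (simp add: span_zero)
  qed simp
  show "span ?U \<subseteq> Vs f"
    unfolding Vs_def
  proof (rule span_mono, rule subsetI)
    fix x assume "x \<in> ?U"
    then obtain a where a: "a \<in> pos_params f" "x \<in> eigsp f a" by blast
    then obtain p where p: "irreducible p" "lead_coeff p = 1" "primary_comp f p = eigsp f a"
      using posdef_eigsp_primary_comp[OF f] by (auto simp: pos_params_def)
    obtain y where "y \<in> eigsp f a" "y \<noteq> 0"
      using a(1) subspace_0[OF eigsp_subspace, of f a] by (auto simp: pos_params_def)
    then have "p \<in> prime_factors_cp f"
      using primary_comp_nontrivial_dvd_charpoly[OF p(1,2)] p by (auto simp: prime_factors_cp_def)
    then show "x \<in> \<Union>{primary_comp f p | p. p \<in> prime_factors_cp f \<and> Qposdef (primary_comp f p)}"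
      using a p(3) by (auto simp: pos_params_def intro!: exI[of _ p])
  qed
qed

lemma Vs_subspace: "subspace (Vs f)" and Vt_subspace: "subspace (Vt f)"
  by (simp_all add: Vs_def Vt_def)

lemma span_Vs_Vt: "span (Vs f \<union> Vt f) = UNIV"
proof -
  have "\<Union>{primary_comp f p | p. lead_coeff p = 1 \<and> irreducible p} \<subseteq> span (Vs f \<union> Vt f)"
  proof
    fix x assume "x \<in> \<Union>{primary_comp f p | p. lead_coeff p = 1 \<and> irreducible p}"
    then obtain p where p: "lead_coeff p = 1" "irreducible p" "x \<in> primary_comp f p" by blast
    show "x \<in> span (Vs f \<union> Vt f)"
    proof (cases "x = 0")
      case False
      then have "p \<in> prime_factors_cp f"
        using p primary_comp_nontrivial_dvd_charpoly by (auto simp: prime_factors_cp_def)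
      then have "x \<in> Vs f \<union> Vt f"
        unfolding Vs_def Vt_def using p(3) by (cases "Qposdef (primary_comp f p)") (blast intro: span_base)+
      then show ?thesis by (rule span_base)
    qed (simp add: span_zero)
  qed
  then have "span (\<Union>{primary_comp f p | p. lead_coeff p = 1 \<and> irreducible p}) \<subseteq> span (Vs f \<union> Vt f)"
    by (rule span_minimal) simp
  then show ?thesis unfolding span_primary_comps by blast
qed

lemma poly_power_nonzero: "poly p c \<noteq> 0 \<Longrightarrow> poly (p ^ k) c \<noteq> (0::real)"
  by (simp add: poly_power)

text \<open>The N-th power of \<open>p\<close> at \<open>f\<close> kills \<open>x\<close>, yet it
  multiplies the product of \<open>x\<close> with \<open>u\<close> by a power of
  \<open>p(1 / \<mu>)\<close>.\<close>

lemma primary_comp_orthogonal_eigenvector: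
  fixes f :: "'n::finite lmat"
  assumes f: "f \<in> O1n" and u: "f *v u = \<mu> *\<^sub>R u" "\<mu> \<noteq> 0" and p: "poly p (1 / \<mu>) \<noteq> 0" and x: "x \<in> primary_comp f p"
  shows "Qf x u = 0"
  using Qf_poly_mat_eigenvector[OF f u, of "p ^ CARD('n option)" x] poly_power_nonzero[OF p, of "CARD('n option)"] x
  unfolding primary_comp_iff by simp

text \<open>A nonspacelike \<open>x\<close> in the component is orthogonal to \<open>u\<close>,
  hence a multiple of it; but powers of \<open>p\<close> at \<open>f\<close> act on \<open>u\<close>
  by nonzero scalars. So only factors with root \<open>\<mu>\<close> or \<open>1 / \<mu>\<close> can
  contribute to \<open>V_t\<close>.\<close>

lemma primary_comp_posdef:
  fixes f :: "'n::finite lmat"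
  assumes f: "f \<in> O1n" and u: "f *v u = \<mu> *\<^sub>R u" "\<mu> \<noteq> 0" "u \<noteq> 0" "Qf u u \<le> 0"
    and p: "poly p \<mu> \<noteq> 0" "poly p (1 / \<mu>) \<noteq> 0"
  shows "Qposdef (primary_comp f p)"
  unfolding Qposdef_def
proof (intro ballI impI, rule ccontr)
  fix x assume x: "x \<in> primary_comp f p" "x \<noteq> 0" "\<not> Qf x x > 0"
  have "Qf x u = 0" using primary_comp_orthogonal_eigenvector[OF f u(1,2) p(2) x(1)] .
  then obtain t where t: "x = t *\<^sub>R u"
    using nonspacelike_orthogonal[of u x] u x by (auto simp: Qf_commute)
  let ?q = "p ^ CARD('n option)"
  have "poly_mat ?q f *v x = (t * poly ?q \<mu>) *\<^sub>R u"
    by (simp add: t matrix_vector_mult_scaleR poly_mat_eigenvector[OF u(1)])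
  then show False using x(1,2) u(3) t poly_power_nonzero[OF p(1), of "CARD('n option)"]
    unfolding primary_comp_iff by simp
qed

lemma eigenvector_primary_comp: "f *v u = \<mu> *\<^sub>R u \<Longrightarrow> u \<in> primary_comp f [:- \<mu>, 1:]"
  by (rule kernel_subset_primary_comp) (simp add: poly_mat_linear)

lemma monic_irreducible_root:
  fixes p :: "real poly"
  assumes "irreducible p" "lead_coeff p = 1" "poly p c = 0"
  shows "p = [:- c, 1:]"
  using assms by (intro monic_irreducible_unique) (auto simp: poly_eq_0_iff_dvd)

text \<open>By \<open>primary_comp_posdef\<close> with eigenvalue 1 only \<open>X - 1\<close> can
  fail to be positive, and it does, since its component contains \<open>u\<close>.\<close>

lemma Vt_of_fixed:
  assumes f: "f \<in> O1n" and u: "f *v u = u" "u \<noteq> 0" "Qf u u \<le> 0"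
  shows "Vt f = primary_comp f [:- 1, 1:]"
proof -
  have u': "f *v u = 1 *\<^sub>R u" using u by simp
  have n: "\<not> Qposdef (primary_comp f [:- 1, 1:])"
    using eigenvector_primary_comp[OF u'] u(2,3) by (force simp: Qposdef_def)
  have irr: "irreducible [:- 1, 1 :: real:]" by (rule irreducible_linear_field_poly) simp
  have pf: "[:- 1, 1:] \<in> prime_factors_cp f"
    using primary_comp_nontrivial_dvd_charpoly[OF irr _ eigenvector_primary_comp[OF u'] u(2)] irr
    by (simp add: prime_factors_cp_def)
  have "p = [:- 1, 1:]" if "p \<in> prime_factors_cp f" "\<not> Qposdef (primary_comp f p)" for p
  proof (rule ccontr)
    assume ne: "p \<noteq> [:- 1, 1:]"
    then have "poly p 1 \<noteq> 0" using monic_irreducible_root that(1) by (auto simp: prime_factors_cp_def)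
    then show False using primary_comp_posdef[OF f u' _ u(2,3), of p] that(2) by simp
  qed
  then have "{primary_comp f p | p. p \<in> prime_factors_cp f \<and> \<not> Qposdef (primary_comp f p)}
      = {primary_comp f [:- 1, 1:]}" using n pf by blast
  then show ?thesis unfolding Vt_def by (simp add: span_eq_iff primary_comp_subspace)
qed

text \<open>The orthogonal complement of \<open>u\<close> and \<open>w\<close> is positive definite
  because \<open>u + w\<close> is timelike, and a spacelike eigenvector has eigenvalue 1 or -1. So
  \<open>u\<close> alone is left for \<open>\<mu>\<close>.\<close>

lemma primary_comp_hyperbolic:
  fixes f :: "'n::finite lmat"
  assumes f: "f \<in> O1n" and \<mu>: "\<mu> > 0" "\<mu> \<noteq> 1" and uw: "Qf u u = 0" "Qf w w = 0" "Qf u w = - 1"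
    and fu: "f *v u = \<mu> *\<^sub>R u" and fw: "f *v w = (1 / \<mu>) *\<^sub>R w"
  shows "primary_comp f [:- \<mu>, 1:] = span {u}"
proof
  let ?p = "[:- \<mu>, 1:]"
  have ne: "\<mu>\<^sup>2 \<noteq> 1" using \<mu> by (auto simp: power2_eq_1_iff)
  have p1: "poly ?p (1 / \<mu>) \<noteq> 0" using ne \<mu> by (auto simp: field_simps power2_eq_square)
  \<comment> \<open>The complement of the plane meets the component trivially; the induction runs
    over the exponent, the complement being invariant under polynomials in \<open>f\<close>.\<close>
  have zero: "y = 0" if "poly_mat (?p ^ k) f *v y = 0" "Qf y u = 0" "Qf y w = 0" for k y
    using that
  proof (induction k arbitrary: y)
    case 0
    then show ?case by (simp add: poly_mat_1)
  next
    case (Suc k)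
    let ?z = "poly_mat ?p f *v y"
    have "poly_mat (?p ^ k) f *v ?z = 0"
      using Suc.prems by (simp only: matrix_vector_mul_assoc poly_mat_mult[symmetric] power_Suc2)
    moreover have "Qf ?z u = 0" "Qf ?z w = 0"
      using Qf_poly_mat_eigenvector[OF f fu, of ?p y] Qf_poly_mat_eigenvector[OF f fw, of ?p y] \<mu> Suc.prems(2,3)
      by simp_all
    ultimately have "?z = 0" using Suc.IH by blast
    then have fy: "f *v y = \<mu> *\<^sub>R y" unfolding poly_mat_linear by simp
    show ?case
    proof (rule ccontr)
      assume "y \<noteq> 0"
      moreover have "Qf (u + w) (u + w) < 0" "Qf (u + w) y = 0"
        using uw Suc.prems(2,3) by (simp_all add: Qf_simps Qf_commute)
      ultimately have "Qf y y > 0" using timelike_orthogonal by blast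
      then show False using isometry_eigenvalue_square[OF f fy] ne by simp
    qed
  qed
  show "primary_comp f ?p \<subseteq> span {u}"
  proof
    fix y assume y: "y \<in> primary_comp f ?p"
    have yu: "Qf y u = 0" using primary_comp_orthogonal_eigenvector[OF f fu _ p1 y] \<mu> by simp
    \<comment> \<open>Removes the \<open>u\<close>-component of \<open>y\<close>; the sign is plus
      because the product of \<open>u\<close> and \<open>w\<close> is -1.\<close>
    define z where "z = y + Qf y w *\<^sub>R u"
    have "z \<in> primary_comp f ?p"
      unfolding z_def
      by (intro subspace_add[OF primary_comp_subspace] subspace_scale[OF primary_comp_subspace] y
          eigenvector_primary_comp fu)
    moreover have "Qf z u = 0" "Qf z w = 0" by (simp_all add: z_def Qf_simps yu uw)
    ultimately have "z = 0" using zero unfolding primary_comp_iff by blast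
    then have "y = (- Qf y w) *\<^sub>R u" by (simp add: z_def eq_neg_iff_add_eq_0)
    then show "y \<in> span {u}" by (metis span_mul span_superset insertI1 subsetD)
  qed
  show "span {u} \<subseteq> primary_comp f ?p"
    by (rule span_minimal) (simp_all add: eigenvector_primary_comp fu primary_comp_subspace)
qed

text \<open>\<open>primary_comp_hyperbolic\<close> is used for \<open>\<mu>\<close> and, with
  \<open>u\<close> and \<open>w\<close> exchanged, for \<open>1 / \<mu>\<close>;
  \<open>primary_comp_posdef\<close> disposes of all other factors. In particular a hyperbolic
  \<open>V_t\<close> is always a plane.\<close>

lemma Vt_hyperbolic:
  fixes f :: "'n::finite lmat"
  assumes f: "f \<in> O1n" and \<mu>: "\<mu> > 0" "\<mu> \<noteq> 1" and uw: "Qf u u = 0" "Qf w w = 0" "Qf u w = - 1"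
    and fu: "f *v u = \<mu> *\<^sub>R u" and fw: "f *v w = (1 / \<mu>) *\<^sub>R w"
  shows "Vt f = span {u, w}"
proof -
  let ?p = "[:- \<mu>, 1:]" and ?q = "[:- (1 / \<mu>), 1:]"
  have u0: "u \<noteq> 0" and w0: "w \<noteq> 0" using uw by auto
  have P: "primary_comp f ?p = span {u}" by (rule primary_comp_hyperbolic[OF f \<mu> uw fu fw])
  have fu': "f *v u = (1 / (1 / \<mu>)) *\<^sub>R u" using fu by simp
  have R: "primary_comp f ?q = span {w}"
    by (rule primary_comp_hyperbolic[OF f _ _ uw(2,1) _ fw fu']) (use \<mu> uw in \<open>simp_all add: Qf_commute\<close>)
  have irr: "irreducible ?p" "irreducible ?q" by (rule irreducible_linear_field_poly; simp)+
  have pf: "?p \<in> prime_factors_cp f" "?q \<in> prime_factors_cp f"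
    using primary_comp_nontrivial_dvd_charpoly[OF irr(1) _ eigenvector_primary_comp[OF fu] u0] irr
      primary_comp_nontrivial_dvd_charpoly[OF irr(2) _ eigenvector_primary_comp[OF fw] w0]
    by (simp_all add: prime_factors_cp_def)
  have n: "\<not> Qposdef (primary_comp f ?p)" "\<not> Qposdef (primary_comp f ?q)"
    using eigenvector_primary_comp[OF fu] eigenvector_primary_comp[OF fw] u0 w0 uw(1,2)
    by (force simp: Qposdef_def)+
  have "p = ?p \<or> p = ?q" if "p \<in> prime_factors_cp f" "\<not> Qposdef (primary_comp f p)" for p
  proof (rule ccontr)
    assume ne: "\<not> (p = ?p \<or> p = ?q)"
    then have "poly p \<mu> \<noteq> 0" "poly p (1 / \<mu>) \<noteq> 0"
      using monic_irreducible_root that(1) by (auto simp: prime_factors_cp_def)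
    then show False using primary_comp_posdef[OF f fu _ u0, of p] that(2) \<mu> uw by simp
  qed
  then have e: "{primary_comp f p | p. p \<in> prime_factors_cp f \<and> \<not> Qposdef (primary_comp f p)}
      = {span {u}, span {w}}" using n pf P R by blast
  have "Vt f = span (span {u} \<union> span {w})" unfolding Vt_def e by simp
  also have "\<dots> = span {u, w}"
  proof
    have "span {u} \<union> span {w} \<subseteq> span {u, w}" by (simp add: span_mono)
    then show "span (span {u} \<union> span {w}) \<subseteq> span {u, w}" by (rule span_minimal) simp
    show "span {u, w} \<subseteq> span (span {u} \<union> span {w})"
      by (rule span_mono) (auto intro: span_base)
  qed
  finally show ?thesis .
qed

text \<open>Pairing \<open>(f - 1)^2 z\<close> with \<open>f y\<close> gives
  \<open>(2 a - 2) Q(z, y)\<close>, so orthogonality descends along the nilpotent filtration, with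
  \<open>y\<close> replaced by \<open>f y\<close> in the same block.\<close>

lemma unipotent_orthogonal:
  fixes f :: "'n::finite lmat"
  assumes f: "f \<in> O1n" and y: "y \<in> eigsp f a" "a \<noteq> 1" and z: "z \<in> primary_comp f [:- 1, 1:]"
  shows "Qf z y = 0"
proof -
  have "Qf z y = 0" if "poly_mat (quad 1 ^ k) f *v z = 0" "y \<in> eigsp f a" for k z y
    using that
  proof (induction k arbitrary: z y)
    case 0
    then show ?case by (simp add: poly_mat_1)
  next
    case (Suc k)
    let ?z = "poly_mat (quad 1) f *v z"
    have "poly_mat (quad 1 ^ k) f *v ?z = 0"
      using Suc.prems by (simp only: matrix_vector_mul_assoc poly_mat_mult[symmetric] power_Suc2)
    then have "Qf ?z (f *v y) = 0" using Suc.IH eigsp_mult_closed Suc.prems by blast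
    moreover have "Qf ?z (f *v y) = (2 * a - 2) * Qf z y"
      using eigsp_Qf[OF f Suc.prems(2), of z] unfolding poly_mat_quad
      by (simp add: Qf_simps O1n_Qf[OF f] Qf_commute[of z] Qf_commute[of "f *v z"] algebra_simps)
    ultimately show ?case using y(2) by simp
  qed
  then show ?thesis using primary_comp_linear_quad_power[of 1 z f] z y(1) by (metis power_one)
qed

lemma not_posdef_eigsp_1:
  assumes "f *v u = u" "u \<noteq> 0" "Qf u u \<le> 0"
  shows "1 \<notin> pos_params f"
  using assms fixed_eigsp[of f u] unfolding pos_params_def Qposdef_def by force

text \<open>Puts the block of a hyperbolic pair outside the interval from -1 to 1, and thus apart
  from all of \<open>pos_params\<close>.\<close>

lemma half_sum_inverse_gt_1:
  assumes "(\<mu>::real) > 0" "\<mu> \<noteq> 1"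
  shows "(\<mu> + 1 / \<mu>) / 2 > 1"
proof -
  have "0 < (\<mu> - 1) * (\<mu> - 1)" using assms(2) by (auto simp: zero_less_mult_iff)
  then have "2 * \<mu> < \<mu> * \<mu> + 1" by (simp add: right_diff_distrib left_diff_distrib)
  then have "2 < (\<mu> * \<mu> + 1) / \<mu>" unfolding pos_less_divide_eq[OF assms(1)] .
  moreover have "(\<mu> * \<mu> + 1) / \<mu> = \<mu> + 1 / \<mu>" using assms(1) by (simp add: add_divide_distrib)
  ultimately show ?thesis by simp
qed

text \<open>For a fixed nonspacelike vector \<open>V_t\<close> is the unipotent component and
  \<open>unipotent_orthogonal\<close> applies; for a hyperbolic map \<open>V_t\<close> lies in a
  single block with parameter above 1.\<close>

lemma Vs_orthogonal_Vt:
  fixes f :: "'n::finite lmat"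
  assumes f: "f \<in> PO1n" and x: "x \<in> Vs f" and y: "y \<in> Vt f"
  shows "Qf x y = 0"
proof -
  have O: "f \<in> O1n" using f PO1n_O1n by blast
  have "Qf z y = 0" if a: "a \<in> pos_params f" and z: "z \<in> eigsp f a" for a z
  proof -
    have fixed: ?thesis if u: "f *v u = u" "u \<noteq> 0" "Qf u u \<le> 0" for u
    proof -
      have "a \<noteq> 1" using a not_posdef_eigsp_1[OF u] by blast
      then show ?thesis using unipotent_orthogonal[OF O z] y Vt_of_fixed[OF O u] by (simp add: Qf_commute)
    qed
    from f show ?thesis
    proof (cases rule: PO1n_trichotomy)
      case (elliptic v)
      then show ?thesis using fixed[of v] by force
    next
      case (parabolic u)
      then show ?thesis using fixed[of u] by force
    next
      case (hyperbolic u w \<mu>)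
      let ?b = "(\<mu> + 1 / \<mu>) / 2"
      have "?b > 1" by (rule half_sum_inverse_gt_1[OF hyperbolic(1,2)])
      then have ne: "a \<noteq> ?b" using a by (auto simp: pos_params_def)
      have u: "u \<in> eigsp f ?b" and w: "w \<in> eigsp f ?b"
        using eigenvector_eigsp[of f u \<mu>] eigenvector_eigsp[of f w "1 / \<mu>"] hyperbolic(1,7,8)
        by (simp_all add: add.commute)
      have "y \<in> span {u, w}" using y Vt_hyperbolic[OF O hyperbolic(1,2,4-8)] by simp
      then show ?thesis
        by (rule Qf_span_right[rotated]) (use eigsp_orthogonal[OF O z _ ne] u w in auto)
    qed
  qed
  then show ?thesis
    using Qf_span_left[of "\<Union>a\<in>pos_params f. eigsp f a" y x] x unfolding Vs_eq_span_eigsp[OF O] by blast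
qed

lemma Vs_Int_Vt: 
  assumes "f \<in> PO1n" "\<And>y. y \<in> Vs f \<Longrightarrow> Qf x y = 0" "\<And>y. y \<in> Vt f \<Longrightarrow> Qf x y = 0"
  shows "x = 0"
  using Qf_nondegenerate_span[OF span_Vs_Vt[of f], of x] assms by blast

text \<open>Makes \<open>V_t\<close> depend on \<open>V_s\<close> only; this is how equal blocks
  yield equal \<open>V_t\<close>.\<close>

lemma Vt_eq_orthogonal:
  assumes f: "f \<in> PO1n"
  shows "Vt f = {x. \<forall>y\<in>Vs f. Qf x y = 0}"
proof
  show "Vt f \<subseteq> {x. \<forall>y\<in>Vs f. Qf x y = 0}"
  proof (intro subsetI CollectI ballI)
    fix x y assume "x \<in> Vt f" "y \<in> Vs f"
    then show "Qf x y = 0" using Vs_orthogonal_Vt[OF f, of y x] by (simp add: Qf_commute[of x])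
  qed
  show "{x. \<forall>y\<in>Vs f. Qf x y = 0} \<subseteq> Vt f"
  proof
    fix x assume x: "x \<in> {x. \<forall>y\<in>Vs f. Qf x y = 0}"
    have "x \<in> span (Vs f \<union> Vt f)" by (simp add: span_Vs_Vt)
    then obtain s t where st: "s \<in> Vs f" "t \<in> Vt f" "x = s + t"
      unfolding span_Un span_eq_iff[THEN iffD2, OF Vs_subspace] span_eq_iff[THEN iffD2, OF Vt_subspace] by blast
    have "s = 0"
    proof (rule Vs_Int_Vt[OF f])
      fix y assume y: "y \<in> Vs f"
      have "Qf x y = 0" "Qf t y = 0"
        using x y Vs_orthogonal_Vt[OF f y st(2)] by (simp_all add: Qf_commute[of t])
      then show "Qf s y = 0" by (simp add: st Qf_simps)
    qed (use Vs_orthogonal_Vt[OF f] st in blast)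
    then show "x \<in> Vt f" using st by simp
  qed
qed

lemma Vt_nonspacelike:
  assumes f: "f \<in> PO1n"
  obtains u where "u \<in> Vt f" "u \<noteq> 0" "Qf u u \<le> 0"
proof -
  have O: "f \<in> O1n" using f PO1n_O1n by blast
  note witness = that
  have fixed: thesis if u: "f *v u = u" "u \<noteq> 0" "Qf u u \<le> 0" for u
    using witness[of u] Vt_of_fixed[OF O u] eigenvector_primary_comp[of f u 1] u by simp
  from f show thesis
  proof (cases rule: PO1n_trichotomy)
    case (elliptic v)
    then show ?thesis using fixed[of v] by force
  next
    case (parabolic u)
    then show ?thesis using fixed[of u] by force
  next
    case (hyperbolic u w \<mu>)
    have "u \<in> Vt f" using Vt_hyperbolic[OF O hyperbolic(1,2,4-8)] by (simp add: span_base)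
    then show ?thesis using witness[of u] hyperbolic by fastforce
  qed
qed

text \<open>\<open>V_t\<close> contains a nonspacelike \<open>u\<close>. A nonspacelike vector of
  \<open>V_s\<close> would be orthogonal to it, hence proportional to it, hence in both
  summands.\<close>

lemma Vs_posdef:
  assumes f: "f \<in> PO1n"
  shows "Qposdef (Vs f)"
  unfolding Qposdef_def
proof (intro ballI impI, rule ccontr)
  fix x assume x: "x \<in> Vs f" "x \<noteq> 0" "\<not> Qf x x > 0"
  obtain u where u: "u \<in> Vt f" "u \<noteq> 0" "Qf u u \<le> 0" using Vt_nonspacelike[OF f] .
  have "Qf u x = 0" using Vs_orthogonal_Vt[OF f x(1) u(1)] by (simp add: Qf_commute)
  then obtain t where "x = t *\<^sub>R u" using nonspacelike_orthogonal[of u x] u x by auto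
  then have "x \<in> Vt f" using u(1) subspace_scale[OF Vt_subspace] by blast
  then have "x = 0"
    using Vs_Int_Vt[OF f, of x] Vs_orthogonal_Vt[OF f x(1)] Vs_orthogonal_Vt[OF f _ \<open>x \<in> Vt f\<close>]
    by (simp add: Qf_commute[of x])
  then show False using x(2) by simp
qed

text \<open>Decompose the time axis: its \<open>V_s\<close>-part has nonnegative square, so the
  \<open>V_t\<close>-part must be timelike.\<close>

lemma Vt_timelike:
  assumes f: "f \<in> PO1n"
  obtains t where "t \<in> Vt f" "Qf t t < 0"
proof -
  let ?e = "axis None 1 :: 'a lvec"
  have "?e \<in> span (Vs f \<union> Vt f)" by (simp add: span_Vs_Vt)
  then obtain s t where st: "s \<in> Vs f" "t \<in> Vt f" "?e = s + t"
    unfolding span_Un span_eq_iff[THEN iffD2, OF Vs_subspace] span_eq_iff[THEN iffD2, OF Vt_subspace] by blast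
  have "- 1 = Qf ?e ?e" by (simp add: Qf_axis_None)
  also have "\<dots> = Qf s s + Qf t t"
    using Vs_orthogonal_Vt[OF f st(1,2)] unfolding st(3) by (simp add: Qf_simps Qf_commute[of t s])
  finally have "Qf s s + Qf t t = - 1" by simp
  moreover have "Qf s s \<ge> 0"
    using Vs_posdef[OF f] st(1) by (cases "s = 0") (auto simp: Qposdef_def less_imp_le)
  ultimately have "Qf t t < 0" by linarith
  then show thesis using that st by blast
qed

section \<open>Complex eigenvectors as pairs of real vectors, and the types\<close>

lemma complexify_subspace:
  assumes "subspace W"
  shows "complexify W = {cvec x + \<i> *s cvec y | x y. x \<in> W \<and> y \<in> W}" (is "_ = ?R")
proof
  have scale: "c *s (cvec x + \<i> *s cvec y)
      = cvec (Re c *\<^sub>R x - Im c *\<^sub>R y) + \<i> *s cvec (Im c *\<^sub>R x + Re c *\<^sub>R y)" for c and x y :: "real ^ 'a"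
    by (simp add: vec_eq_iff cvec_def complex_eq_iff)
  have "vec.subspace ?R"
  proof (rule vec.subspaceI)
    show "0 \<in> ?R" using subspace_0[OF assms] by (auto intro!: exI[of _ 0])
    show "v + w \<in> ?R" if vw: "v \<in> ?R" "w \<in> ?R" for v w
    proof -
      obtain x y x' y' where *: "v = cvec x + \<i> *s cvec y" "w = cvec x' + \<i> *s cvec y'"
        "x \<in> W" "y \<in> W" "x' \<in> W" "y' \<in> W" using vw by blast
      then have "v + w = cvec (x + x') + \<i> *s cvec (y + y')"
        by (simp add: cvec_add vector_add_ldistrib)
      then show ?thesis using * subspace_add[OF assms] by blast
    qed
    show "c *s v \<in> ?R" if v: "v \<in> ?R" for c v
    proof -
      obtain x y where *: "v = cvec x + \<i> *s cvec y" "x \<in> W" "y \<in> W" using v by blast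
      have "Re c *\<^sub>R x - Im c *\<^sub>R y \<in> W" "Im c *\<^sub>R x + Re c *\<^sub>R y \<in> W"
        using *(2,3) by (simp_all add: subspace_add[OF assms] subspace_diff[OF assms] subspace_scale[OF assms])
      then show ?thesis using scale[of c x y] *(1) by blast
    qed
  qed
  moreover have "cvec ` W \<subseteq> ?R"
  proof
    fix v assume "v \<in> cvec ` W"
    then obtain x where "x \<in> W" "v = cvec x + \<i> *s cvec 0" by auto
    then show "v \<in> ?R" using subspace_0[OF assms] by blast
  qed
  ultimately show "complexify W \<subseteq> ?R" unfolding complexify_def by (intro vec.span_minimal)
  show "?R \<subseteq> complexify W"
  proof
    fix v assume "v \<in> ?R"
    then obtain x y where *: "v = cvec x + \<i> *s cvec y" "x \<in> W" "y \<in> W" by blast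
    then have "cvec x \<in> complexify W" "cvec y \<in> complexify W"
      by (simp_all add: complexify_def vec.span_base)
    then show "v \<in> complexify W"
      unfolding *(1) complexify_def by (intro vec.span_add vec.span_scale)
  qed
qed

lemma complex_eigenvector_iff:
  "cmat A *v (cvec x + \<i> *s cvec y) = c *s (cvec x + \<i> *s cvec y) \<longleftrightarrow>
     A *v x = Re c *\<^sub>R x - Im c *\<^sub>R y \<and> A *v y = Im c *\<^sub>R x + Re c *\<^sub>R y"
proof -
  have scale: "c *s (cvec x + \<i> *s cvec y)
      = cvec (Re c *\<^sub>R x - Im c *\<^sub>R y) + \<i> *s cvec (Im c *\<^sub>R x + Re c *\<^sub>R y)"
    by (simp add: vec_eq_iff cvec_def complex_eq_iff)
  have "cmat A *v (cvec x + \<i> *s cvec y) = cvec (A *v x) + \<i> *s cvec (A *v y)"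
    by (simp add: matrix_vector_right_distrib cmat_cvec vec.scale vector_scalar_commute)
  then show ?thesis unfolding scale by (simp only: cvec_ReIm_eq)
qed

lemma complexify_eigenvector_iff:
  assumes "subspace W"
  shows "(\<exists>v\<in>complexify W. v \<noteq> 0 \<and> cmat A *v v = c *s v) \<longleftrightarrow>
    (\<exists>x\<in>W. \<exists>y\<in>W. (x \<noteq> 0 \<or> y \<noteq> 0) \<and> A *v x = Re c *\<^sub>R x - Im c *\<^sub>R y \<and> A *v y = Im c *\<^sub>R x + Re c *\<^sub>R y)"
proof -
  have z: "cvec x + \<i> *s cvec y = 0 \<longleftrightarrow> x = 0 \<and> y = 0" for x y :: "real ^ 'a"
    using cvec_ReIm_eq[of x y 0 0] by simp
  show ?thesis (is "?L \<longleftrightarrow> ?R")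
  proof
    assume ?L
    then obtain x y where "x \<in> W" "y \<in> W" "cvec x + \<i> *s cvec y \<noteq> 0"
      "cmat A *v (cvec x + \<i> *s cvec y) = c *s (cvec x + \<i> *s cvec y)"
      unfolding complexify_subspace[OF assms] by blast
    then show ?R unfolding complex_eigenvector_iff z by blast
  next
    assume ?R
    then obtain x y where "x \<in> W" "y \<in> W" "cvec x + \<i> *s cvec y \<noteq> 0"
      "cmat A *v (cvec x + \<i> *s cvec y) = c *s (cvec x + \<i> *s cvec y)"
      unfolding complex_eigenvector_iff z by blast
    then show ?L unfolding complexify_subspace[OF assms] by blast
  qed
qed

text \<open>On \<open>x + i y\<close> the map \<open>A\<close> is multiplication by
  \<open>c = \<alpha> + i \<beta>\<close>, so the nilpotent \<open>A - 1\<close> is multiplication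
  by \<open>c - 1\<close>, which must be 0.\<close>

lemma unipotent_eigenvalue:
  assumes N: "\<And>x. x \<in> W \<Longrightarrow> poly_mat ([:- 1, 1:] ^ k) A *v x = 0"
    and xy: "x \<in> W" "y \<in> W" "x \<noteq> 0 \<or> y \<noteq> 0" "A *v x = \<alpha> *\<^sub>R x - \<beta> *\<^sub>R y" "A *v y = \<beta> *\<^sub>R x + \<alpha> *\<^sub>R y"
  shows "\<alpha> = 1 \<and> \<beta> = 0"
proof (rule ccontr)
  assume ne: "\<not> (\<alpha> = 1 \<and> \<beta> = 0)"
  \<comment> \<open>The square of \<open>|c - 1|\<close>, the determinant of the real 2 by 2 system
    below.\<close>
  define d where "d = (\<alpha> - 1)\<^sup>2 + \<beta>\<^sup>2"
  have d: "d \<noteq> 0" using ne by (auto simp: d_def sum_power2_eq_zero_iff)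
  let ?N = "\<lambda>x. A *v x - x"
  have "x = 0 \<and> y = 0"
    if "poly_mat ([:- 1, 1:] ^ k) A *v x = 0" "poly_mat ([:- 1, 1:] ^ k) A *v y = 0"
      "A *v x = \<alpha> *\<^sub>R x - \<beta> *\<^sub>R y" "A *v y = \<beta> *\<^sub>R x + \<alpha> *\<^sub>R y" for x y k
    using that
  proof (induction k arbitrary: x y)
    case 0
    then show ?case by (simp add: poly_mat_1)
  next
    case (Suc k)
    have N1: "poly_mat [:- 1, 1:] A *v w = ?N w" for w using poly_mat_linear[of 1 A w] by simp
    have "poly_mat ([:- 1, 1:] ^ k) A *v ?N w = poly_mat ([:- 1, 1:] ^ Suc k) A *v w" for w
      by (simp only: N1[symmetric] matrix_vector_mul_assoc poly_mat_mult[symmetric] power_Suc2)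
    then have "poly_mat ([:- 1, 1:] ^ k) A *v ?N x = 0" "poly_mat ([:- 1, 1:] ^ k) A *v ?N y = 0"
      using Suc.prems(1,2) by (simp_all only:)
    moreover have "A *v ?N x = \<alpha> *\<^sub>R ?N x - \<beta> *\<^sub>R ?N y"
      unfolding Suc.prems(3,4)
      by (simp add: matrix_vector_mult_diff_distrib matrix_vector_right_distrib matrix_vector_mult_scaleR
          Suc.prems(3,4) scaleR_diff_right scaleR_add_right)
    moreover have "A *v ?N y = \<beta> *\<^sub>R ?N x + \<alpha> *\<^sub>R ?N y"
      unfolding Suc.prems(3,4)
      by (simp add: matrix_vector_mult_diff_distrib matrix_vector_right_distrib matrix_vector_mult_scaleR
          Suc.prems(3,4) scaleR_diff_right scaleR_add_right)
    ultimately have "?N x = 0" "?N y = 0" using Suc.IH by blast+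
    then have e: "(\<alpha> - 1) *\<^sub>R x - \<beta> *\<^sub>R y = 0" "\<beta> *\<^sub>R x + (\<alpha> - 1) *\<^sub>R y = 0"
      using Suc.prems(3,4) by (simp_all add: scaleR_diff_left algebra_simps)
    \<comment> \<open>Multiplication by the conjugate of \<open>c - 1\<close>, in real and imaginary
      parts.\<close>
    have "d *\<^sub>R x = (\<alpha> - 1) *\<^sub>R ((\<alpha> - 1) *\<^sub>R x - \<beta> *\<^sub>R y) + \<beta> *\<^sub>R (\<beta> *\<^sub>R x + (\<alpha> - 1) *\<^sub>R y)"
      by (simp add: d_def power2_eq_square scaleR_add_left scaleR_diff_right scaleR_add_right mult.commute)
    moreover have "d *\<^sub>R y = (\<alpha> - 1) *\<^sub>R (\<beta> *\<^sub>R x + (\<alpha> - 1) *\<^sub>R y) - \<beta> *\<^sub>R ((\<alpha> - 1) *\<^sub>R x - \<beta> *\<^sub>R y)"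
      by (simp add: d_def power2_eq_square scaleR_add_left scaleR_diff_right scaleR_add_right mult.commute)
    ultimately have "d *\<^sub>R x = 0" "d *\<^sub>R y = 0"
      by (simp_all only: e scaleR_zero_right add_0_left diff_self)
    then show ?case using d by simp
  qed
  then show False using N xy by blast
qed

lemma type_of_eqI:
  assumes "(t = Ell \<and> is_ell T) \<or> (t = Par \<and> is_par T) \<or> (t = Hyp \<and> is_hyp T)"
    and "is_ell T \<Longrightarrow> \<not> is_hyp T" "is_par T \<Longrightarrow> \<not> is_hyp T"
  shows "type_of T = t"
  unfolding type_of_def
  by (rule the_equality) (use assms in \<open>auto simp: is_par_def\<close>)

lemma matpow_diff_mat1: "matpow (A - mat 1) k = poly_mat ([:- 1, 1:] ^ k) A"
proof -
  have "poly_mat [:- 1, 1:] A = A - mat 1" by (simp add: poly_mat_pCons)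
  then show ?thesis by (simp add: poly_mat_power)
qed

lemma is_ell_not_is_hyp:
  assumes "is_ell f"
  shows "\<not> is_hyp f"
proof
  assume "is_hyp f"
  then obtain c where c: "c \<noteq> 1" "restr_eigenvalue f (Vt f) c" by (auto simp: is_hyp_def)
  then obtain x y where xy: "x \<in> Vt f" "y \<in> Vt f" "x \<noteq> 0 \<or> y \<noteq> 0"
    "f *v x = Re c *\<^sub>R x - Im c *\<^sub>R y" "f *v y = Im c *\<^sub>R x + Re c *\<^sub>R y"
    unfolding restr_eigenvalue_def complexify_eigenvector_iff[OF Vt_subspace] by blast
  have "poly_mat ([:- 1, 1:] ^ 1) f *v w = 0" if "w \<in> Vt f" for w
    using assms that poly_mat_linear[of 1 f w] by (simp add: is_ell_def)
  from unipotent_eigenvalue[OF this xy] have "c = 1" by (simp add: complex_eq_iff)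
  then show False using c by simp
qed

lemma is_par_not_is_hyp:
  assumes "is_par f"
  shows "\<not> is_hyp f"
proof
  assume "is_hyp f"
  then obtain c where c: "c \<noteq> 1" "restr_eigenvalue f (Vt f) c" by (auto simp: is_hyp_def)
  then obtain x y where xy: "x \<in> Vt f" "y \<in> Vt f" "x \<noteq> 0 \<or> y \<noteq> 0"
    "f *v x = Re c *\<^sub>R x - Im c *\<^sub>R y" "f *v y = Im c *\<^sub>R x + Re c *\<^sub>R y"
    unfolding restr_eigenvalue_def complexify_eigenvector_iff[OF Vt_subspace] by blast
  obtain k where k: "\<And>w. w \<in> Vt f \<Longrightarrow> poly_mat ([:- 1, 1:] ^ k) f *v w = 0"
    using assms by (auto simp: is_par_def matpow_diff_mat1)
  from unipotent_eigenvalue[OF k xy] have "c = 1" by (simp add: complex_eq_iff)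
  then show False using c by simp
qed

lemma type_of_iff:
  "is_ell f \<Longrightarrow> type_of f = Ell" "is_par f \<Longrightarrow> type_of f = Par" "is_hyp f \<Longrightarrow> type_of f = Hyp"
  using is_ell_not_is_hyp is_par_not_is_hyp by (blast intro: type_of_eqI)+

text \<open>Expand \<open>Q(f n, f y) = Q(n, y)\<close> with \<open>f n = n\<close> and
  \<open>f y = y + n\<close>.\<close>

lemma isometry_unipotent_step_null:
  assumes f: "f \<in> O1n" and n: "n = f *v y - y" "f *v n = n"
  shows "Qf n n = 0"
proof -
  have fy: "f *v y = y + n" by (simp add: n(1))
  have "Qf (f *v n) (f *v y) = Qf n y" by (rule O1n_Qf[OF f])
  then show ?thesis unfolding n(2) fy by (simp add: Qf_simps)
qed

text \<open>A unipotent step \<open>f y - y\<close> is null once it is fixed, and it is orthogonal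
  to the fixed timelike \<open>v\<close>; so it vanishes and the unipotent component is just the
  fixed space.\<close>

lemma elliptic_Vt:
  assumes f: "f \<in> PO1n" and v: "f *v v = v" "Qf v v < 0"
  shows "Vt f = {x. f *v x = x}"
proof -
  have O: "f \<in> O1n" using f PO1n_O1n by blast
  have fixed: "f *v y = y" if "poly_mat ([:- 1, 1:] ^ k) f *v y = 0" for k y
    using that
  proof (induction k arbitrary: y)
    case 0
    then show ?case by (simp add: poly_mat_1)
  next
    case (Suc k)
    let ?n = "f *v y - y"
    have N1: "poly_mat [:- 1, 1:] f *v y = ?n" using poly_mat_linear[of 1 f y] by simp
    have "poly_mat ([:- 1, 1:] ^ k) f *v ?n = 0"
      using Suc.prems by (simp only: N1[symmetric] matrix_vector_mul_assoc poly_mat_mult[symmetric] power_Suc2)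
    then have "Qf ?n ?n = 0" using isometry_unipotent_step_null[OF O refl] Suc.IH by blast
    moreover have "Qf v ?n = 0" using O1n_Qf[OF O, of v y] v(1) by (simp add: Qf_simps)
    ultimately have "?n = 0" using timelike_orthogonal[OF v(2)] by fastforce
    then show ?case by simp
  qed
  have "Vt f = primary_comp f [:- 1, 1:]" using Vt_of_fixed[OF O v(1)] v(2) by force
  moreover have "f *v x = x \<Longrightarrow> x \<in> primary_comp f [:- 1, 1:]" for x
    using eigenvector_primary_comp[of f x 1] by simp
  ultimately show ?thesis using fixed primary_comp_iff by blast
qed

lemma elliptic_type:
  assumes f: "f \<in> PO1n" and v: "f *v v = v" "Qf v v < 0"
  shows "type_of f = Ell"
  by (rule type_of_iff(1)) (simp add: is_ell_def elliptic_Vt[OF assms])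

text \<open>\<open>V_t\<close> contains a timelike vector, which by assumption cannot be
  fixed.\<close>

lemma parabolic_type:
  assumes f: "f \<in> PO1n" and n: "\<And>v. f *v v = v \<Longrightarrow> Qf v v \<ge> 0" and u: "u \<noteq> 0" "Qf u u = 0" "f *v u = u"
  shows "type_of f = Par"
proof (rule type_of_iff(2))
  have O: "f \<in> O1n" using f PO1n_O1n by blast
  obtain t where t: "t \<in> Vt f" "Qf t t < 0" using Vt_timelike[OF f] .
  then have "f *v t \<noteq> t" using n by fastforce
  then have "\<not> is_ell f" using t(1) by (auto simp: is_ell_def)
  moreover have "matpow (f - mat 1) CARD('a option) *v v = 0" if "v \<in> Vt f" for v
    using that unfolding Vt_of_fixed[OF O u(3,1) eq_refl[OF u(2)]] primary_comp_iff matpow_diff_mat1 .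
  ultimately show "is_par f" unfolding is_par_def by blast
qed

lemma hyperbolic_type:
  assumes "u \<in> Vt f" "u \<noteq> 0" "f *v u = \<mu> *\<^sub>R u" "\<mu> \<noteq> 1"
  shows "type_of f = Hyp"
proof (rule type_of_iff(3))
  have "restr_eigenvalue f (Vt f) (of_real \<mu>)"
    unfolding restr_eigenvalue_def complexify_eigenvector_iff[OF Vt_subspace]
    using assms subspace_0[OF Vt_subspace] by (intro bexI[of _ u] bexI[of _ 0]) auto
  then show "is_hyp f" using assms(4) unfolding is_hyp_def by (metis of_real_eq_1_iff)
qed

lemma type_of_Ell_iff:
  assumes f: "f \<in> PO1n"
  shows "type_of f = Ell \<longleftrightarrow> (\<exists>v. f *v v = v \<and> Qf v v < 0)"
proof
  assume t: "type_of f = Ell"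
  from f show "\<exists>v. f *v v = v \<and> Qf v v < 0"
  proof (cases rule: PO1n_trichotomy)
    case (elliptic v)
    then show ?thesis by blast
  next
    case (parabolic u)
    then have "type_of f = Par" by (intro parabolic_type[OF f, of u]) auto
    then show ?thesis using t by simp
  next
    case (hyperbolic u w \<mu>)
    then have "u \<in> Vt f" using Vt_hyperbolic[OF PO1n_O1n[OF f]] by (simp add: span_base)
    then have "type_of f = Hyp" using hyperbolic by (intro hyperbolic_type[of u f \<mu>]) auto
    then show ?thesis using t by simp
  qed
qed (use elliptic_type[OF f] in blast)

section \<open>Orthonormal frames and the Segre symbol\<close>

lemma Qf_orthogonal_independent:
  assumes "\<And>x. x \<in> B \<Longrightarrow> Qf x x \<noteq> 0" "\<And>x y. x \<in> B \<Longrightarrow> y \<in> B \<Longrightarrow> x \<noteq> y \<Longrightarrow> Qf x y = 0"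
  shows "independent B"
  unfolding dependent_def
proof
  assume "\<exists>a\<in>B. a \<in> span (B - {a})"
  then obtain a where a: "a \<in> B" "a \<in> span (B - {a})" by blast
  have "Qf a a = 0" by (rule Qf_span_right[OF _ a(2)]) (use assms(2) a(1) in auto)
  then show False using assms(1) a(1) by blast
qed

text \<open>One Gram-Schmidt process for both kinds of blocks. For \<open>\<epsilon> = 0\<close>
  positivity forces \<open>J = 0\<close> on \<open>W\<close>, and the \<open>x j\<close> form an
  orthonormal basis; for \<open>\<epsilon> = 1\<close>, \<open>J\<close> is a complex structure, and
  they form a unitary basis.\<close>

lemma ex_skew_frame:
  assumes W: "subspace W" "Qposdef W" and J: "linear J" "\<And>x. x \<in> W \<Longrightarrow> J x \<in> W"
    and skew: "\<And>x y. x \<in> W \<Longrightarrow> y \<in> W \<Longrightarrow> Qf (J x) y = - Qf x (J y)"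
    and JJ: "\<And>x. x \<in> W \<Longrightarrow> J (J x) = - \<epsilon> *\<^sub>R x" and \<epsilon>: "\<epsilon> = 0 \<or> \<epsilon> = 1"
  obtains m x where "\<And>j. j < (m::nat) \<Longrightarrow> x j \<in> W"
    "\<And>i j. i < m \<Longrightarrow> j < m \<Longrightarrow> Qf (x i) (x j) = (if i = j then 1 else 0)"
    "\<And>i j. i < m \<Longrightarrow> j < m \<Longrightarrow> Qf (x i) (J (x j)) = 0"
    "W = span (x ` {..<m} \<union> (\<lambda>j. J (x j)) ` {..<m})"
proof -
  have "\<exists>(m::nat) x. (\<forall>j<m. x j \<in> U) \<and> (\<forall>i<m. \<forall>j<m. Qf (x i) (x j) = (if i = j then 1 else 0)) \<and>
      (\<forall>i<m. \<forall>j<m. Qf (x i) (J (x j)) = 0) \<and> U \<subseteq> span (x ` {..<m} \<union> (\<lambda>j. J (x j)) ` {..<m})"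
    if "subspace U" "U \<subseteq> W" "\<And>x. x \<in> U \<Longrightarrow> J x \<in> U" for U
    using that
  proof (induction "dim U" arbitrary: U rule: less_induct)
    case less
    show ?case
    proof (cases "U \<subseteq> {0}")
      case True
      then show ?thesis by (intro exI[of _ 0]) auto
    next
      case False
      then obtain w where w: "w \<in> U" "w \<noteq> 0" by blast
      have q: "Qf w w > 0" using W(2) w less.prems(2) by (auto simp: Qposdef_def)
      define e where "e = (1 / sqrt (Qf w w)) *\<^sub>R w"
      have e: "e \<in> U" using w subspace_scale[OF less.prems(1)] by (simp add: e_def)
      then have eW: "e \<in> W" "J e \<in> U" "J e \<in> W" using less.prems by auto
      have ee: "Qf e e = 1" using q by (simp add: e_def Qf_simps)
      have eJ: "Qf e (J e) = 0" "Qf (J e) e = 0" using skew[OF eW(1,1)] by (simp_all add: Qf_commute[of "J e"])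
      have JeJe: "Qf (J e) (J e) = \<epsilon>"
        using skew[OF eW(1,3)] JJ[OF eW(1)] ee by (simp add: Qf_simps)
      have Je0: "J e = 0" if "\<epsilon> = 0"
        using JeJe that W(2) eW(3) by (force simp: Qposdef_def)
      \<comment> \<open>By skewness the orthogonal complement of \<open>e\<close> and
        \<open>J e\<close> is again invariant under \<open>J\<close>; it misses \<open>e\<close>, so
        its dimension is smaller.\<close>
      define U' where "U' = {y \<in> U. Qf y e = 0 \<and> Qf y (J e) = 0}"
      have sub': "subspace U'"
        using less.prems(1) by (auto simp: U'_def subspace_def Qf_simps)
      have "U' \<subseteq> U" "e \<notin> U'" using ee by (auto simp: U'_def)
      then have "span U' \<subset> span U"
        using e sub' less.prems(1) by (metis psubsetI span_eq_iff)
      then have dim: "dim U' < dim U" by (rule dim_psubset)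
      have J': "J y \<in> U'" if y: "y \<in> U'" for y
      proof -
        have yW: "y \<in> U" "y \<in> W" using y less.prems(2) by (auto simp: U'_def)
        have "Qf (J y) e = 0" using skew[OF yW(2) eW(1)] y by (simp add: U'_def)
        moreover have "Qf (J y) (J e) = 0"
          using skew[OF yW(2) eW(3)] JJ[OF eW(1)] y by (simp add: U'_def Qf_simps)
        ultimately show ?thesis using less.prems(3) yW(1) by (simp add: U'_def)
      qed
      have "\<exists>(m::nat) x. (\<forall>j<m. x j \<in> U') \<and> (\<forall>i<m. \<forall>j<m. Qf (x i) (x j) = (if i = j then 1 else 0)) \<and>
          (\<forall>i<m. \<forall>j<m. Qf (x i) (J (x j)) = 0) \<and> U' \<subseteq> span (x ` {..<m} \<union> (\<lambda>j. J (x j)) ` {..<m})"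
        by (rule less.hyps[OF dim sub' order_trans[OF \<open>U' \<subseteq> U\<close> less.prems(2)]]) (rule J')
      then obtain m :: nat and x where IH: "\<forall>j<m. x j \<in> U'" "\<forall>i<m. \<forall>j<m. Qf (x i) (x j) = (if i = j then 1 else 0)"
        "\<forall>i<m. \<forall>j<m. Qf (x i) (J (x j)) = 0" "U' \<subseteq> span (x ` {..<m} \<union> (\<lambda>j. J (x j)) ` {..<m})"
        by blast
      define z where "z = x(m := e)"
      have zm: "z m = e" and zj: "j < m \<Longrightarrow> z j = x j" for j by (simp_all add: z_def)
      have xe: "Qf (x j) e = 0" "Qf e (x j) = 0" "Qf (x j) (J e) = 0" "Qf e (J (x j)) = 0" if "j < m" for j
      proof -
        have "x j \<in> U'" "J (x j) \<in> U'" using IH(1) J' that by blast+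
        then show "Qf (x j) e = 0" "Qf e (x j) = 0" "Qf (x j) (J e) = 0" "Qf e (J (x j)) = 0"
          by (simp_all add: U'_def Qf_commute[of e])
      qed
      have cases: "j < m \<or> j = m" if "j < Suc m" for j using that by auto
      let ?S = "z ` {..<Suc m} \<union> (\<lambda>j. J (z j)) ` {..<Suc m}"
      have S: "e \<in> span ?S" "J e \<in> span ?S" "x ` {..<m} \<union> (\<lambda>j. J (x j)) ` {..<m} \<subseteq> ?S"
      proof -
        have "z ` {..<m} = x ` {..<m}" "(\<lambda>j. J (z j)) ` {..<m} = (\<lambda>j. J (x j)) ` {..<m}"
          by (rule image_cong; simp add: zj)+
        then have "?S = insert e (x ` {..<m}) \<union> insert (J e) ((\<lambda>j. J (x j)) ` {..<m})"
          by (simp add: lessThan_Suc zm)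
        then show "e \<in> span ?S" "J e \<in> span ?S" "x ` {..<m} \<union> (\<lambda>j. J (x j)) ` {..<m} \<subseteq> ?S"
          by (auto intro: span_base)
      qed
      have "U \<subseteq> span ?S"
      proof
        fix y assume y: "y \<in> U"
        define y' where "y' = y - Qf y e *\<^sub>R e - Qf y (J e) *\<^sub>R J e"
        have "y' \<in> U'"
          unfolding U'_def y'_def using y e eW(2) less.prems(1) ee eJ JeJe Je0 \<epsilon>
          by (auto simp: Qf_simps subspace_diff subspace_scale)
        then have "y' \<in> span ?S" using IH(4) span_mono[OF S(3)] by blast
        moreover have "y = y' + Qf y e *\<^sub>R e + Qf y (J e) *\<^sub>R J e" by (simp add: y'_def)
        ultimately show "y \<in> span ?S" using S(1,2) by (metis span_add span_scale)
      qed
      moreover have "\<forall>j<Suc m. z j \<in> U" 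
        using cases zm zj e IH(1) \<open>U' \<subseteq> U\<close> by (metis subsetD)
      moreover have "\<forall>i<Suc m. \<forall>j<Suc m. Qf (z i) (z j) = (if i = j then 1 else 0)"
        using IH(2) xe ee by (auto simp: z_def less_Suc_eq)
      moreover have "\<forall>i<Suc m. \<forall>j<Suc m. Qf (z i) (J (z j)) = 0"
        using IH(3) xe eJ by (auto simp: z_def less_Suc_eq)
      ultimately show ?thesis by blast
    qed
  qed
  from this[OF W(1) order_refl J(2)] obtain m :: nat and x where
    *: "\<forall>j<m. x j \<in> W" "\<forall>i<m. \<forall>j<m. Qf (x i) (x j) = (if i = j then 1 else 0)"
      "\<forall>i<m. \<forall>j<m. Qf (x i) (J (x j)) = 0" "W \<subseteq> span (x ` {..<m} \<union> (\<lambda>j. J (x j)) ` {..<m})"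
    by blast
  have "span (x ` {..<m} \<union> (\<lambda>j. J (x j)) ` {..<m}) \<subseteq> W"
    using *(1) J(2) W(1) by (intro span_minimal) auto
  then show thesis using that[of m x] * by blast
qed

text \<open>For \<open>\<bar>a\<bar> < 1\<close> this is the complex structure of the block of \<open>a\<close>; for \<open>a = \<plusminus>1\<close> it vanishes because
  \<open>1 / sqrt 0 = 0\<close>, so that complex and real blocks can be treated alike.\<close>
definition rot :: "'n::finite lmat \<Rightarrow> real \<Rightarrow> 'n lvec \<Rightarrow> 'n lvec" where
  "rot f a x = (1 / sqrt (1 - a\<^sup>2)) *\<^sub>R (f *v x - a *\<^sub>R x)"

lemma rot_linear: "linear (rot f a)"
  unfolding rot_def by (intro linear_compose_scale_right linear_compose_sub matrix_vector_mul_linear linear_ident)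

lemma rot_eigsp: "x \<in> eigsp f a \<Longrightarrow> rot f a x \<in> eigsp f a"
  unfolding rot_def by (intro subspace_scale subspace_diff eigsp_subspace eigsp_mult_closed)

text \<open>\<open>eigsp_Qf\<close> says exactly that \<open>f - a\<close> is skew against block
  vectors.\<close>

lemma rot_skew:
  assumes f: "f \<in> O1n" and x: "x \<in> eigsp f a"
  shows "Qf (rot f a x) y = - Qf x (rot f a y)"
proof -
  let ?b = "1 / sqrt (1 - a\<^sup>2)"
  have "Qf (rot f a x) y = ?b * (Qf (f *v x) y - a * Qf x y)"
    by (simp only: rot_def Qf_scaleR_left Qf_diff_left)
  also have "Qf (f *v x) y - a * Qf x y = - (Qf x (f *v y) - a * Qf x y)"
    using eigsp_Qf[OF f x, of y] by linarith
  also have "?b * - (Qf x (f *v y) - a * Qf x y) = - Qf x (rot f a y)"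
    by (simp only: rot_def Qf_scaleR_right Qf_diff_right mult_minus_right)
  finally show ?thesis .
qed

text \<open>The vector \<open>(f - a) x\<close> has square \<open>(1 - a^2) Q(x, x) = 0\<close> and
  lies in the positive definite block.\<close>

lemma posdef_eigsp_pm1:
  assumes f: "f \<in> O1n" and D: "Qposdef (eigsp f a)" "a\<^sup>2 = 1" and x: "x \<in> eigsp f a"
  shows "f *v x = a *\<^sub>R x"
proof -
  let ?y = "f *v x - a *\<^sub>R x"
  have t: "Qf (f *v x) x = a * Qf x x"
    using eigsp_Qf[OF f x, of x] by (simp add: Qf_commute[of x "f *v x"])
  have "Qf ?y ?y = Qf x x - 2 * a * (a * Qf x x) + a\<^sup>2 * Qf x x"
    using t by (simp add: Qf_simps O1n_Qf[OF f] Qf_commute[of x "f *v x"] power2_eq_square algebra_simps)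
  also have "\<dots> = (1 - a\<^sup>2) * Qf x x" by (simp add: algebra_simps power2_eq_square)
  finally have "Qf ?y ?y = 0" using D(2) by simp
  moreover have "?y \<in> eigsp f a" using x by (intro subspace_diff subspace_scale eigsp_subspace eigsp_mult_closed)
  ultimately have "?y = 0" using D(1) by (force simp: Qposdef_def)
  then show ?thesis by simp
qed

text \<open>On the block \<open>(f - a)^2 = a^2 - 1\<close>; the normalization of \<open>rot\<close>
  divides by \<open>1 - a^2\<close>.\<close>

lemma rot_rot:
  assumes f: "f \<in> O1n" and D: "Qposdef (eigsp f a)" "- 1 \<le> a" "a \<le> 1" and x: "x \<in> eigsp f a"
  shows "rot f a (rot f a x) = - (if a\<^sup>2 = 1 then 0 else 1) *\<^sub>R x"
proof (cases "a\<^sup>2 = 1")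
  case True
  then show ?thesis by (simp add: rot_def)
next
  case False
  let ?b = "1 / sqrt (1 - a\<^sup>2)"
  have "a\<^sup>2 \<le> 1" using D(2,3) abs_le_square_iff[of a 1] by auto
  then have b: "?b * ?b * (1 - a\<^sup>2) = 1" using False by simp
  have scale: "c *\<^sub>R (c *\<^sub>R v - a *\<^sub>R (c *\<^sub>R w)) = (c * c) *\<^sub>R (v - a *\<^sub>R w)" for c and v w :: "'a lvec"
    by (simp add: scaleR_diff_right mult.commute mult.left_commute)
  have "rot f a (rot f a x) = ?b *\<^sub>R (?b *\<^sub>R (f *v (f *v x) - a *\<^sub>R (f *v x)) - a *\<^sub>R (?b *\<^sub>R (f *v x - a *\<^sub>R x)))"
    by (simp only: rot_def matrix_vector_mult_scaleR matrix_vector_mult_diff_distrib)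
  also have "\<dots> = (?b * ?b) *\<^sub>R ((f *v (f *v x) - a *\<^sub>R (f *v x)) - a *\<^sub>R (f *v x - a *\<^sub>R x))"
    by (rule scale)
  also have "(f *v (f *v x) - a *\<^sub>R (f *v x)) - a *\<^sub>R (f *v x - a *\<^sub>R x)
      = f *v (f *v x) - (2 * a) *\<^sub>R (f *v x) + a\<^sup>2 *\<^sub>R x"
  proof -
    have "(2 * a) *\<^sub>R v = a *\<^sub>R v + a *\<^sub>R v" for v :: "'a lvec" by (simp add: scaleR_add_left[symmetric])
    then show ?thesis by (simp add: scaleR_diff_right power2_eq_square)
  qed
  also have "f *v (f *v x) - (2 * a) *\<^sub>R (f *v x) + a\<^sup>2 *\<^sub>R x = - (1 - a\<^sup>2) *\<^sub>R x"
    using x by (simp add: eigsp_eq scaleR_diff_left)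
  also have "(?b * ?b) *\<^sub>R - (1 - a\<^sup>2) *\<^sub>R x = - (?b * ?b * (1 - a\<^sup>2)) *\<^sub>R x"
    by (simp only: scaleR_scaleR mult_minus_right)
  finally show ?thesis unfolding b using False by simp
qed

text \<open>\<open>ex_skew_frame\<close> for \<open>J = rot f a\<close>. The last claim counts: at
  the endpoints \<open>rot\<close> vanishes and \<open>m\<close> vectors remain, otherwise the
  \<open>2 m\<close> vectors \<open>x j\<close> and \<open>J (x j)\<close> are independent.\<close>

lemma pos_params_frame:
  fixes f :: "'n::finite lmat"
  assumes f: "f \<in> O1n" and a: "a \<in> pos_params f"
  obtains m x where "\<And>j. j < (m::nat) \<Longrightarrow> x j \<in> eigsp f a"
    "\<And>i j. i < m \<Longrightarrow> j < m \<Longrightarrow> Qf (x i) (x j) = (if i = j then 1 else 0)"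
    "\<And>i j. i < m \<Longrightarrow> j < m \<Longrightarrow> Qf (x i) (rot f a (x j)) = 0"
    "\<And>i j. i < m \<Longrightarrow> j < m \<Longrightarrow> Qf (rot f a (x i)) (rot f a (x j)) = (if i = j \<and> a\<^sup>2 \<noteq> 1 then 1 else 0)"
    "eigsp f a = span (x ` {..<m} \<union> (\<lambda>j. rot f a (x j)) ` {..<m})"
    "dim (eigsp f a) = (if a\<^sup>2 = 1 then m else 2 * m)"
proof -
  have D: "Qposdef (eigsp f a)" "- 1 \<le> a" "a \<le> 1" using a by (simp_all add: pos_params_def)
  let ?J = "rot f a"
  obtain m x where fr: "\<And>j. j < (m::nat) \<Longrightarrow> x j \<in> eigsp f a"
    "\<And>i j. i < m \<Longrightarrow> j < m \<Longrightarrow> Qf (x i) (x j) = (if i = j then 1 else 0)"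
    "\<And>i j. i < m \<Longrightarrow> j < m \<Longrightarrow> Qf (x i) (?J (x j)) = 0"
    "eigsp f a = span (x ` {..<m} \<union> (\<lambda>j. ?J (x j)) ` {..<m})"
    by (rule ex_skew_frame[OF eigsp_subspace D(1) rot_linear rot_eigsp rot_skew[OF f] rot_rot[OF f D]])
      auto
  have JJ: "Qf (?J (x i)) (?J (x j)) = (if i = j \<and> a\<^sup>2 \<noteq> 1 then 1 else 0)" if "i < m" "j < m" for i j
    using rot_skew[OF f fr(1)[OF that(1)], of "?J (x j)"] rot_rot[OF f D fr(1)[OF that(2)]] fr(2)[OF that]
    by (simp add: Qf_simps split: if_splits)
  have "dim (eigsp f a) = (if a\<^sup>2 = 1 then m else 2 * m)"
  proof -
    have inj: "inj_on x {..<m}" using fr(2) by (intro inj_onI) (metis lessThan_iff zero_neq_one)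
    show ?thesis
    proof (cases "a\<^sup>2 = 1")
      case True
      have "?J y = 0" for y using True by (simp add: rot_def)
      then have "x ` {..<m} \<union> (\<lambda>j. ?J (x j)) ` {..<m} \<subseteq> insert 0 (x ` {..<m})" by auto
      then have "eigsp f a \<subseteq> span (x ` {..<m})" unfolding fr(4) by (metis span_insert_0 span_mono)
      moreover have "span (x ` {..<m}) \<subseteq> eigsp f a" unfolding fr(4) by (rule span_mono) simp
      ultimately have "eigsp f a = span (x ` {..<m})" by blast
      moreover have "independent (x ` {..<m})"
        by (rule Qf_orthogonal_independent) (use fr(2) in auto)
      ultimately show ?thesis using inj True dim_span_eq_card_independent[of "x ` {..<m}"]
        by (simp add: card_image del: dim_span)
    next
      case False
      let ?B = "x ` {..<m} \<union> (\<lambda>j. ?J (x j)) ` {..<m}"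
      have inj': "inj_on (\<lambda>j. ?J (x j)) {..<m}"
        using JJ False by (intro inj_onI) (metis lessThan_iff zero_neq_one)
      have disj: "x ` {..<m} \<inter> (\<lambda>j. ?J (x j)) ` {..<m} = {}"
      proof (rule ccontr)
        assume "x ` {..<m} \<inter> (\<lambda>j. ?J (x j)) ` {..<m} \<noteq> {}"
        then obtain i j where ij: "i < m" "j < m" "x i = ?J (x j)" by auto
        have "Qf (x i) (x i) = 0" using fr(3)[OF ij(1,2)] ij(3) by simp
        then show False using fr(2)[OF ij(1,1)] by simp
      qed
      have "independent ?B"
      proof (rule Qf_orthogonal_independent)
        show "Qf y y \<noteq> 0" if "y \<in> ?B" for y using that fr(2) JJ False by auto
        show "Qf y z = 0" if "y \<in> ?B" "z \<in> ?B" "y \<noteq> z" for y z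
        proof -
          have "Qf (?J (x i)) (x j) = 0" if "i < m" "j < m" for i j
            using fr(3)[OF that(2,1)] by (simp add: Qf_commute[of _ "x j"])
          then show ?thesis using that fr(2,3) JJ by auto
        qed
      qed
      moreover have "card ?B = 2 * m"
        using card_Un_disjoint[OF _ _ disj] by (simp add: card_image inj inj')
      ultimately show ?thesis using False dim_span_eq_card_independent[of ?B] unfolding fr(4)
        by (simp del: dim_span)
    qed
  qed
  then show thesis using that fr JJ by blast
qed

lemma eigsp_subset_Vs: "f \<in> O1n \<Longrightarrow> a \<in> pos_params f \<Longrightarrow> eigsp f a \<subseteq> Vs f"
  unfolding Vs_eq_span_eigsp by (blast intro: span_base)

text \<open>For any other parameter \<open>x\<close> would be orthogonal to all blocks spanning
  \<open>V_s\<close>, and so to itself.\<close>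

lemma Vs_eigsp_pos_params:
  assumes f: "f \<in> PO1n" and x: "x \<in> Vs f" "x \<in> eigsp f a" "x \<noteq> 0"
  shows "a \<in> pos_params f"
proof (rule ccontr)
  assume a: "a \<notin> pos_params f"
  have O: "f \<in> O1n" using f PO1n_O1n by blast
  have orth: "Qf x y = 0" if "y \<in> (\<Union>b\<in>pos_params f. eigsp f b)" for y
    using that eigsp_orthogonal[OF O x(2)] a by blast
  have "Qf x x = 0"
    using Qf_span_right[of "\<Union>b\<in>pos_params f. eigsp f b" x x] orth x(1) Vs_eq_span_eigsp[OF O] by blast
  then show False using Vs_posdef[OF f] x by (force simp: Qposdef_def)
qed

lemma pos_params_nonzero:
  assumes "a \<in> pos_params f"
  obtains x where "x \<in> eigsp f a" "x \<noteq> 0" "Qf x x > 0"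
  using assms subspace_0[OF eigsp_subspace, of f a] by (auto simp: pos_params_def Qposdef_def)

lemma pos_params_inj:
  assumes f: "f \<in> O1n"
  shows "inj_on (eigsp f) (pos_params f)"
proof (rule inj_onI, rule ccontr)
  fix a b assume a: "a \<in> pos_params f" and e: "eigsp f a = eigsp f b" "a \<noteq> b"
  obtain x where x: "x \<in> eigsp f a" "Qf x x > 0" using pos_params_nonzero[OF a] by blast
  then show False using eigsp_orthogonal[OF f x(1) _ e(2), of x] e(1) by simp
qed

lemma finite_pos_params:
  assumes f: "f \<in> O1n"
  shows "finite (pos_params f)"
proof -
  define z where "z a = (SOME x. x \<in> eigsp f a \<and> Qf x x > 0)" for a
  have z: "z a \<in> eigsp f a" "Qf (z a) (z a) > 0" if "a \<in> pos_params f" for a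
    using someI_ex[of "\<lambda>x. x \<in> eigsp f a \<and> Qf x x > 0"] pos_params_nonzero[OF that] unfolding z_def by blast+
  have "independent (z ` pos_params f)"
  proof (rule Qf_orthogonal_independent)
    show "Qf x x \<noteq> 0" if "x \<in> z ` pos_params f" for x using that z(2) by force
    show "Qf x y = 0" if "x \<in> z ` pos_params f" "y \<in> z ` pos_params f" "x \<noteq> y" for x y
      using that z(1) eigsp_orthogonal[OF f] by blast
  qed
  then have "finite (z ` pos_params f)" by (rule independent_imp_finite)
  moreover have "inj_on z (pos_params f)"
  proof (rule inj_onI, rule ccontr)
    fix a b assume ab: "a \<in> pos_params f" "b \<in> pos_params f" "z a = z b" "a \<noteq> b"
    have "Qf (z a) (z b) = 0" using eigsp_orthogonal[OF f z(1)[OF ab(1)] z(1)[OF ab(2)] ab(4)] .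
    then show False using z(2)[OF ab(1)] ab(3) by simp
  qed
  ultimately show ?thesis by (rule finite_imageD)
qed

lemma rot_eq:
  assumes "\<bar>a\<bar> < 1"
  shows "f *v x = a *\<^sub>R x + sqrt (1 - a\<^sup>2) *\<^sub>R rot f a x"
proof -
  have "a\<^sup>2 < 1" using assms by (simp add: abs_square_less_1)
  then show ?thesis by (simp add: rot_def)
qed

section \<open>Complex eigenspaces and the Segre symbol in terms of blocks\<close>

definition cpair :: "'n::finite lmat \<Rightarrow> real \<Rightarrow> 'n lvec \<Rightarrow> complex ^ ('n option)" where
  "cpair f a x = cvec x + \<i> *s cvec (- rot f a x)"

text \<open>The eigenvectors of the complexification for the eigenvalue \<open>a + i sqrt (1 - a\<^sup>2)\<close>
  are the vectors \<open>x - i J x\<close> with \<open>x\<close> in the real block of \<open>a\<close> and \<open>J\<close> its complex structure.\<close>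
lemma complex_eigenspace:
  assumes f: "f \<in> PO1n" and a: "a \<in> pos_params f" "\<bar>a\<bar> < 1" and c: "c = Complex a (sqrt (1 - a\<^sup>2))"
  shows "{v \<in> complexify (Vs f). cmat f *v v = c *s v} = cpair f a ` eigsp f a"
proof
  have O: "f \<in> O1n" using f PO1n_O1n by blast
  have a2: "a\<^sup>2 < 1" using a(2) by (simp add: abs_square_less_1)
  let ?b = "sqrt (1 - a\<^sup>2)"
  have b: "?b > 0" "?b * ?b = 1 - a\<^sup>2" using a2 by simp_all
  have D: "Qposdef (eigsp f a)" "- 1 \<le> a" "a \<le> 1" using a by (auto simp: pos_params_def)
  show "cpair f a ` eigsp f a \<subseteq> {v \<in> complexify (Vs f). cmat f *v v = c *s v}"
  proof
    fix v assume "v \<in> cpair f a ` eigsp f a"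
    then obtain x where x: "x \<in> eigsp f a" "v = cpair f a x" by blast
    let ?y = "- rot f a x"
    have "x \<in> Vs f" "?y \<in> Vs f"
      using x(1) rot_eigsp eigsp_subset_Vs[OF O a(1)] subspace_neg[OF eigsp_subspace] by blast+
    moreover have "f *v x = a *\<^sub>R x - ?b *\<^sub>R ?y" using rot_eq[OF a(2)] by simp
    moreover have "f *v ?y = ?b *\<^sub>R x + a *\<^sub>R ?y"
    proof -
      have "f *v rot f a x = a *\<^sub>R rot f a x - ?b *\<^sub>R x"
        using rot_eq[OF a(2), of f "rot f a x"] rot_rot[OF O D x(1)] a2 by simp
      then show ?thesis using matrix_vector_mult_scaleR[of f "-1" "rot f a x"] by simp
    qed
    ultimately show "v \<in> {v \<in> complexify (Vs f). cmat f *v v = c *s v}"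
      unfolding x(2) cpair_def complexify_subspace[OF Vs_subspace]
      using complex_eigenvector_iff[of f x ?y c] by (auto simp: c)
  qed
  show "{v \<in> complexify (Vs f). cmat f *v v = c *s v} \<subseteq> cpair f a ` eigsp f a"
  proof
    fix v assume "v \<in> {v \<in> complexify (Vs f). cmat f *v v = c *s v}"
    then obtain x y where v: "v = cvec x + \<i> *s cvec y" "x \<in> Vs f" "y \<in> Vs f" "cmat f *v v = c *s v"
      unfolding complexify_subspace[OF Vs_subspace] by blast
    have xy: "f *v x = a *\<^sub>R x - ?b *\<^sub>R y" "f *v y = ?b *\<^sub>R x + a *\<^sub>R y"
      using v(4) unfolding v(1) complex_eigenvector_iff by (simp_all add: c)
    have y: "y = - rot f a x" using b(1) unfolding rot_def xy(1) by simp
    have "f *v (f *v x) = a *\<^sub>R (f *v x) - ?b *\<^sub>R (f *v y)"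
      by (subst xy(1)) (simp add: matrix_vector_mult_diff_distrib matrix_vector_mult_scaleR)
    also have "\<dots> = a *\<^sub>R (f *v x) - (?b * ?b) *\<^sub>R x - a *\<^sub>R (?b *\<^sub>R y)"
      by (simp add: xy(2) scaleR_add_right mult.commute del: real_sqrt_mult_self)
    also have "?b *\<^sub>R y = a *\<^sub>R x - f *v x" using xy(1) by simp
    finally have "f *v (f *v x) = (2 * a) *\<^sub>R (f *v x) - x"
      unfolding b(2) by (simp add: scaleR_diff_right scaleR_diff_left power2_eq_square scaleR_left_distrib[of a a, simplified])
    then have "x \<in> eigsp f a" by (simp add: eigsp_eq)
    then show "v \<in> cpair f a ` eigsp f a" unfolding v(1) cpair_def y by blast
  qed
qed

text \<open>\<open>cpair\<close> turns the complex structure of the block into multiplication by i,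
  so the unitary frame \<open>x j\<close> becomes a complex basis.\<close>

lemma dim_complex_eigenspace:
  fixes f :: "'n::finite lmat"
  assumes f: "f \<in> PO1n" and a: "a \<in> pos_params f" "\<bar>a\<bar> < 1"
  shows "vec.dim (cpair f a ` eigsp f a) = dim (eigsp f a) div 2"
proof -
  have O: "f \<in> O1n" using f PO1n_O1n by blast
  have a2: "a\<^sup>2 \<noteq> 1" using a(2) by (simp add: abs_square_less_1 less_imp_neq)
  have D: "Qposdef (eigsp f a)" "- 1 \<le> a" "a \<le> 1" using a by (auto simp: pos_params_def)
  obtain m x where fr: "\<And>j. j < (m::nat) \<Longrightarrow> x j \<in> eigsp f a"
    "\<And>i j. i < m \<Longrightarrow> j < m \<Longrightarrow> Qf (x i) (x j) = (if i = j then 1 else 0)"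
    "\<And>i j. i < m \<Longrightarrow> j < m \<Longrightarrow> Qf (x i) (rot f a (x j)) = 0"
    "\<And>i j. i < m \<Longrightarrow> j < m \<Longrightarrow> Qf (rot f a (x i)) (rot f a (x j)) = (if i = j \<and> a\<^sup>2 \<noteq> 1 then 1 else 0)"
    "eigsp f a = span (x ` {..<m} \<union> (\<lambda>j. rot f a (x j)) ` {..<m})"
    "dim (eigsp f a) = (if a\<^sup>2 = 1 then m else 2 * m)"
    using pos_params_frame[OF O a(1)] by blast
  let ?\<xi> = "cpair f a"
  let ?B = "(\<lambda>j. ?\<xi> (x j)) ` {..<m}"
  have rot_comb: "rot f a (c *\<^sub>R y + z) = c *\<^sub>R rot f a y + rot f a z" for c y z
    using rot_linear[of f a] by (simp add: linear_add linear_scale)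
  have lin: "?\<xi> (c *\<^sub>R y + z) = of_real c *s ?\<xi> y + ?\<xi> z" for c y z
    unfolding cpair_def rot_comb
    by (simp add: vec_eq_iff cvec_def algebra_simps)
  have \<xi>0: "?\<xi> 0 = 0" using rot_linear[of f a] by (simp add: cpair_def linear_0)
  have \<xi>J: "?\<xi> (rot f a y) = \<i> *s ?\<xi> y" if "y \<in> eigsp f a" for y
    using rot_rot[OF O D that] a2 by (simp add: cpair_def vec_eq_iff cvec_def complex_eq_iff)
  have "?\<xi> y \<in> vec.span ?B" if "y \<in> eigsp f a" for y
    using that unfolding fr(5)
  proof (induction rule: span_induct_alt)
    case base
    then show ?case by (simp add: \<xi>0 vec.span_zero)
  next
    case (step c y z)
    have "?\<xi> y \<in> vec.span ?B"
    proof (cases "y \<in> x ` {..<m}")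
      case True
      then show ?thesis by (auto intro: vec.span_base)
    next
      case False
      then obtain j where j: "j < m" "y = rot f a (x j)" using step(1) by auto
      have "?\<xi> (x j) \<in> vec.span ?B" using j by (auto intro: vec.span_base)
      then show ?thesis unfolding j(2) \<xi>J[OF fr(1)[OF j(1)]] by (rule vec.span_scale)
    qed
    then show ?case unfolding lin using step(2) by (intro vec.span_add vec.span_scale)
  qed
  then have sub: "?\<xi> ` eigsp f a \<subseteq> vec.span ?B" by blast
  \<comment> \<open>\<open>L y\<close> is the complex-linear extension of \<open>Q\<close> against
    \<open>y\<close>; the functionals \<open>L (x j)\<close> are dual to the images of the frame and
    prove their independence.\<close>
  define L :: "'n lvec \<Rightarrow> complex ^ ('n option) \<Rightarrow> complex" where
    "L y v = - (v $ None) * of_real (y $ None) + (\<Sum>i\<in>UNIV. v $ Some i * of_real (y $ Some i))" for y v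
  have L_add: "L y (v + w) = L y v + L y w" and L_scale: "L y (c *s v) = c * L y v" for y v w c
    by (simp_all add: L_def algebra_simps sum.distrib sum_distrib_left)
  have L_cvec: "L y (cvec z) = of_real (Qf z y)" for y z
    by (simp add: L_def cvec_def Qf_def)
  have L0: "L y v = 0" if "\<And>w. w \<in> S \<Longrightarrow> L y w = 0" "v \<in> vec.span S" for y v S
    using that(2)
  proof (induction rule: vec.span_induct_alt)
    case base
    then show ?case by (simp add: L_def)
  next
    case (step c v w)
    then show ?case by (simp add: L_add L_scale that(1))
  qed
  have L\<xi>: "L (x j) (?\<xi> (x i)) = (if i = j then 1 else 0)" if "i < m" "j < m" for i j
    using fr(2)[OF that] fr(3)[OF that(2,1)]
    by (simp add: cpair_def L_add L_scale L_cvec Qf_minus_left Qf_commute[of "rot f a (x i)"])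
  have inj: "inj_on (\<lambda>j. ?\<xi> (x j)) {..<m}"
    using L\<xi> by (intro inj_onI) (metis lessThan_iff zero_neq_one)
  have "vec.independent ?B"
    unfolding vec.dependent_def
  proof
    assume "\<exists>b\<in>?B. b \<in> vec.span (?B - {b})"
    then obtain j where j: "j < m" "?\<xi> (x j) \<in> vec.span (?B - {?\<xi> (x j)})" by blast
    have "L (x j) (?\<xi> (x j)) = 0" by (rule L0[OF _ j(2)]) (use L\<xi> j(1) in auto)
    then show False using L\<xi>[OF j(1,1)] by simp
  qed
  moreover have "vec.span ?B = vec.span (?\<xi> ` eigsp f a)"
  proof
    show "vec.span ?B \<subseteq> vec.span (?\<xi> ` eigsp f a)" using fr(1) by (intro vec.span_mono) auto
    show "vec.span (?\<xi> ` eigsp f a) \<subseteq> vec.span ?B" using sub by (rule vec.span_minimal) simp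
  qed
  ultimately have "vec.dim (?\<xi> ` eigsp f a) = card ?B" by (intro vec.dim_eq_card)
  also have "\<dots> = m" using inj by (simp add: card_image)
  finally show ?thesis using fr(6) a2 by simp
qed

definition complex_params :: "'n::finite lmat \<Rightarrow> real set" where
  "complex_params f = {a \<in> pos_params f. \<bar>a\<bar> < 1}"

definition real_params :: "'n::finite lmat \<Rightarrow> real set" where
  "real_params f = pos_params f \<inter> {1, - 1}"

lemma pos_params_split: "pos_params f = complex_params f \<union> real_params f"
  by (auto simp: complex_params_def real_params_def pos_params_def)

text \<open>Eigenvalues on \<open>V_s\<close> have modulus 1, so one with positive imaginary part is
  determined by its real part, the block parameter.\<close>

lemma complex_eigenvalues:
  assumes f: "f \<in> PO1n"
  shows "{c. Im c > 0 \<and> restr_eigenvalue f (Vs f) c} = (\<lambda>a. Complex a (sqrt (1 - a\<^sup>2))) ` complex_params f"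
proof
  have O: "f \<in> O1n" using f PO1n_O1n by blast
  show "{c. Im c > 0 \<and> restr_eigenvalue f (Vs f) c} \<subseteq> (\<lambda>a. Complex a (sqrt (1 - a\<^sup>2))) ` complex_params f"
  proof
    fix c assume "c \<in> {c. Im c > 0 \<and> restr_eigenvalue f (Vs f) c}"
    then have c: "Im c > 0" "restr_eigenvalue f (Vs f) c" by auto
    let ?\<alpha> = "Re c" and ?\<beta> = "Im c"
    obtain x y where xy: "x \<in> Vs f" "y \<in> Vs f" "x \<noteq> 0 \<or> y \<noteq> 0"
      "f *v x = ?\<alpha> *\<^sub>R x - ?\<beta> *\<^sub>R y" "f *v y = ?\<beta> *\<^sub>R x + ?\<alpha> *\<^sub>R y"
      using c(2) unfolding restr_eigenvalue_def complexify_eigenvector_iff[OF Vs_subspace] by blast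
    have x0: "x \<noteq> 0" using xy(3,4) c(1) by auto
    then have xx: "Qf x x > 0" using Vs_posdef[OF f] xy(1) by (simp add: Qposdef_def)
    \<comment> \<open>Eliminating \<open>y\<close> shows that \<open>x\<close> satisfies the real
      quadratic with roots \<open>c\<close> and its conjugate;
      \<open>isometry_quadratic_norm\<close> makes the constant term 1.\<close>
    have "f *v (f *v x) = ?\<alpha> *\<^sub>R (f *v x) - ?\<beta> *\<^sub>R (f *v y)"
      by (subst xy(4)) (simp add: matrix_vector_mult_diff_distrib matrix_vector_mult_scaleR)
    also have "\<dots> = ?\<alpha> *\<^sub>R (f *v x) - (?\<beta>\<^sup>2) *\<^sub>R x - ?\<alpha> *\<^sub>R (?\<beta> *\<^sub>R y)"
      by (simp add: xy(5) scaleR_add_right mult.commute power2_eq_square)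
    also have "?\<beta> *\<^sub>R y = ?\<alpha> *\<^sub>R x - f *v x" using xy(4) by simp
    also have "?\<alpha> *\<^sub>R (f *v x) - (?\<beta>\<^sup>2) *\<^sub>R x - ?\<alpha> *\<^sub>R (?\<alpha> *\<^sub>R x - f *v x)
        = (2 * ?\<alpha>) *\<^sub>R (f *v x) - (?\<alpha>\<^sup>2 + ?\<beta>\<^sup>2) *\<^sub>R x"
    proof -
      have "(2 * ?\<alpha>) *\<^sub>R v = ?\<alpha> *\<^sub>R v + ?\<alpha> *\<^sub>R v" for v :: "'a lvec" by (simp add: scaleR_add_left[symmetric])
      then show ?thesis by (simp add: scaleR_diff_right power2_eq_square scaleR_add_left)
    qed
    finally have ffx: "f *v (f *v x) = (2 * ?\<alpha>) *\<^sub>R (f *v x) - (?\<alpha>\<^sup>2 + ?\<beta>\<^sup>2) *\<^sub>R x" .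
    then have n: "?\<alpha>\<^sup>2 + ?\<beta>\<^sup>2 = 1" using isometry_quadratic_norm[OF O xx ffx] c(1) by simp
    have "x \<in> eigsp f ?\<alpha>" using ffx unfolding n by (simp add: eigsp_eq)
    then have "?\<alpha> \<in> pos_params f" using Vs_eigsp_pos_params[OF f xy(1)] x0 by blast
    moreover have "?\<alpha>\<^sup>2 < 1" using n c(1) zero_less_power[OF c(1), of 2] by linarith
    then have "\<bar>?\<alpha>\<bar> < 1" by (simp add: abs_square_less_1)
    moreover have "?\<beta> = sqrt (1 - ?\<alpha>\<^sup>2)" using n c(1) by (intro real_sqrt_unique[symmetric]) auto
    then have "c = Complex ?\<alpha> (sqrt (1 - ?\<alpha>\<^sup>2))" by (simp add: complex_eq_iff)
    ultimately show "c \<in> (\<lambda>a. Complex a (sqrt (1 - a\<^sup>2))) ` complex_params f" 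
      unfolding complex_params_def by blast
  qed
  show "(\<lambda>a. Complex a (sqrt (1 - a\<^sup>2))) ` complex_params f \<subseteq> {c. Im c > 0 \<and> restr_eigenvalue f (Vs f) c}"
  proof
    fix c assume "c \<in> (\<lambda>a. Complex a (sqrt (1 - a\<^sup>2))) ` complex_params f"
    then obtain a where a: "a \<in> pos_params f" "\<bar>a\<bar> < 1" "c = Complex a (sqrt (1 - a\<^sup>2))"
      by (auto simp: complex_params_def)
    obtain x where x: "x \<in> eigsp f a" "x \<noteq> 0" using pos_params_nonzero[OF a(1)] by blast
    have "cpair f a x \<in> {v \<in> complexify (Vs f). cmat f *v v = c *s v}"
      using complex_eigenspace[OF f a] x(1) by blast
    moreover have "cpair f a x \<noteq> 0" using cvec_ReIm_eq[of x "- rot f a x" 0 0] x(2) by (simp add: cpair_def)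
    ultimately have "restr_eigenvalue f (Vs f) c" unfolding restr_eigenvalue_def by blast
    moreover have "Im c > 0" using a(2) by (simp add: a(3) abs_square_less_1)
    ultimately show "c \<in> {c. Im c > 0 \<and> restr_eigenvalue f (Vs f) c}" by blast
  qed
qed

lemma real_eigenspace:
  assumes f: "f \<in> PO1n" and a: "a \<in> real_params f"
  shows "{v \<in> Vs f. f *v v = a *s v} = eigsp f a"
proof -
  have O: "f \<in> O1n" using f PO1n_O1n by blast
  have a': "a \<in> pos_params f" "a\<^sup>2 = 1" "Qposdef (eigsp f a)" "a \<noteq> 0" "(a + 1 / a) / 2 = a"
    using a by (auto simp: real_params_def pos_params_def)
  then show ?thesis
    using eigsp_subset_Vs[OF O a'(1)] posdef_eigsp_pm1[OF O a'(3,2)] eigenvector_eigsp[of f _ a]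
    by (auto simp: scalar_mult_eq_scaleR)
qed

lemma real_eigenvalues:
  assumes f: "f \<in> PO1n"
  shows "{e \<in> {1, - 1}. \<exists>v\<in>Vs f. v \<noteq> 0 \<and> f *v v = e *s v} = real_params f"
proof
  show "{e \<in> {1, - 1}. \<exists>v\<in>Vs f. v \<noteq> 0 \<and> f *v v = e *s v} \<subseteq> real_params f"
    using Vs_eigsp_pos_params[OF f] fixed_eigsp[of f] negated_eigsp[of f]
    by (fastforce simp: real_params_def scalar_mult_eq_scaleR)
  show "real_params f \<subseteq> {e \<in> {1, - 1}. \<exists>v\<in>Vs f. v \<noteq> 0 \<and> f *v v = e *s v}"
  proof
    fix a assume a: "a \<in> real_params f"
    then have "a \<in> pos_params f" by (simp add: real_params_def)
    then obtain x where "x \<in> eigsp f a" "x \<noteq> 0" using pos_params_nonzero by blast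
    then have "\<exists>v\<in>Vs f. v \<noteq> 0 \<and> f *v v = a *s v" using real_eigenspace[OF f a] by blast
    then show "a \<in> {e \<in> {1, - 1}. \<exists>v\<in>Vs f. v \<noteq> 0 \<and> f *v v = e *s v}"
      using a by (simp add: real_params_def)
  qed
qed

lemma segre_eq_params:
  assumes f: "f \<in> PO1n"
  shows "segre f = (type_of f, dim (Vt f),
    image_mset (\<lambda>a. dim (eigsp f a) div 2) (mset_set (complex_params f)),
    image_mset (\<lambda>a. dim (eigsp f a)) (mset_set (real_params f)))"
proof -
  have O: "f \<in> O1n" using f PO1n_O1n by blast
  let ?c = "\<lambda>a. Complex a (sqrt (1 - a\<^sup>2))"
  have fin: "finite (complex_params f)" "finite (real_params f)"
    using finite_pos_params[OF O] by (simp_all add: complex_params_def real_params_def)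
  have inj: "inj_on ?c (complex_params f)" by (auto simp: inj_on_def)
  have "image_mset (\<lambda>c. vec.dim {v \<in> complexify (Vs f). cmat f *v v = c *s v})
        (mset_set {c. Im c > 0 \<and> restr_eigenvalue f (Vs f) c})
      = image_mset (\<lambda>c. vec.dim {v \<in> complexify (Vs f). cmat f *v v = c *s v})
        (image_mset ?c (mset_set (complex_params f)))"
    unfolding complex_eigenvalues[OF f] image_mset_mset_set[OF inj] ..
  also have "\<dots> = image_mset (\<lambda>a. dim (eigsp f a) div 2) (mset_set (complex_params f))"
    unfolding image_mset.compositionality o_def
  proof (rule image_mset_cong)
    fix a assume "a \<in># mset_set (complex_params f)"
    then have a: "a \<in> pos_params f" "\<bar>a\<bar> < 1" using fin by (auto simp: complex_params_def)
    show "vec.dim {v \<in> complexify (Vs f). cmat f *v v = ?c a *s v} = dim (eigsp f a) div 2"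
      unfolding complex_eigenspace[OF f a refl] dim_complex_eigenspace[OF f a] ..
  qed
  finally have 1: "image_mset (\<lambda>c. vec.dim {v \<in> complexify (Vs f). cmat f *v v = c *s v})
        (mset_set {c. Im c > 0 \<and> restr_eigenvalue f (Vs f) c})
      = image_mset (\<lambda>a. dim (eigsp f a) div 2) (mset_set (complex_params f))" .
  have 2: "image_mset (\<lambda>e. vec.dim {v \<in> Vs f. f *v v = e *s v})
        (mset_set {e \<in> {1, - 1}. \<exists>v\<in>Vs f. v \<noteq> 0 \<and> f *v v = e *s v})
      = image_mset (\<lambda>a. dim (eigsp f a)) (mset_set (real_params f))"
    unfolding real_eigenvalues[OF f]
    by (rule image_mset_cong) (use real_eigenspace[OF f] fin in \<open>simp add: dim_vec_eq\<close>)
  show ?thesis unfolding segre_def segre_orth_def 1 2 by (simp add: dim_vec_eq)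
qed

section \<open>Conjugate centralizers have equal Segre symbols\<close>

text \<open>Negating a nonspacelike vector would reverse time.\<close>

lemma PO1n_not_neg:
  assumes f: "f \<in> PO1n" and y: "y \<noteq> 0" "Qf y y \<le> 0"
  shows "f *v y \<noteq> - y"
proof
  assume n: "f *v y = - y"
  have y0: "y $ None \<noteq> 0" using zero_if_None_zero y by blast
  show False
  proof (cases "y $ None > 0")
    case True
    then show False using PO1n_forward[OF f y(2)] n by simp
  next
    case False
    have "f *v (- y) = y" using n matrix_vector_mult_scaleR[of f "-1" y] by simp
    then show False using PO1n_forward[OF f, of "- y"] False y0 y(2) by (simp add: Qf_simps)
  qed
qed

definition reflection :: "'n::finite lvec \<Rightarrow> 'n lmat" where
  "reflection x = matrix (\<lambda>z. z - (2 * Qf z x / Qf x x) *\<^sub>R x)"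

lemma reflection_apply: "reflection x *v z = z - (2 * Qf z x / Qf x x) *\<^sub>R x"
proof -
  have "linear (\<lambda>z. z - (2 * Qf z x / Qf x x) *\<^sub>R x)"
    by (rule linearI) (simp_all add: Qf_simps scaleR_left_distrib scaleR_diff_right distrib_left add_divide_distrib
        mult.left_commute)
  then show ?thesis unfolding reflection_def by (simp add: matrix_works)
qed

text \<open>The time axis is sent to a vector of time coordinate
  \<open>1 + 2 x_0^2 / Q(x, x)\<close>.\<close>

lemma reflection_PO1n:
  assumes x: "Qf x x > 0"
  shows "reflection x \<in> PO1n"
proof (rule PO1n_I)
  let ?e = "axis None 1 :: 'a lvec"
  show "reflection x \<in> O1n"
    unfolding O1n_def
  proof (intro CollectI allI)
    fix y z
    let ?c = "2 * Qf y x / Qf x x" and ?d = "2 * Qf z x / Qf x x"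
    have "Qf (reflection x *v y) (reflection x *v z) = Qf y z - ?d * Qf y x - ?c * Qf x z + ?c * (?d * Qf x x)"
      by (simp only: reflection_apply Qf_simps) (simp add: algebra_simps)
    also have "?d * Qf x x = 2 * Qf z x" using x by simp
    also have "Qf y z - ?d * Qf y x - ?c * Qf x z + ?c * (2 * Qf z x) = Qf y z"
      by (simp add: Qf_commute[of x z])
    finally show "Qf (reflection x *v y) (reflection x *v z) = Qf y z" .
  qed
  show "Qf ?e ?e \<le> 0" "?e $ None > 0" by (simp_all add: Qf_axis_None)
  have "(reflection x *v ?e) $ None = 1 + 2 * (x $ None * x $ None) / Qf x x"
    by (simp add: reflection_apply Qf_axis_None)
  moreover have "2 * (x $ None * x $ None) / Qf x x \<ge> 0" using x by simp
  ultimately show "(reflection x *v ?e) $ None > 0" by linarith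
qed

text \<open>The line of \<open>x\<close> is the eigenspace of the reflection for -1, so a commuting
  \<open>f\<close> preserves this line, and an isometry scales it by 1 or -1.\<close>

lemma reflection_commute_iff:
  assumes f: "f \<in> O1n" and x: "Qf x x > 0"
  shows "reflection x ** f = f ** reflection x \<longleftrightarrow> f *v x = x \<or> f *v x = - x"
proof
  assume c: "reflection x ** f = f ** reflection x"
  let ?c = "Qf (f *v x) x / Qf x x"
  have "reflection x *v (f *v x) = f *v (reflection x *v x)"
    using c by (simp add: matrix_vector_mul_assoc)
  moreover have "reflection x *v x = - x"
  proof -
    have "2 * Qf x x / Qf x x = 2" using x by simp
    then have "reflection x *v x = (1 - 2) *\<^sub>R x"
      by (simp only: reflection_apply scaleR_diff_left scaleR_one)
    then show ?thesis by simp
  qed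
  ultimately have "reflection x *v (f *v x) = - (f *v x)"
    using matrix_vector_mult_scaleR[of f "- 1" x] by simp
  then have e: "f *v x - (2 * Qf (f *v x) x / Qf x x) *\<^sub>R x = - (f *v x)"
    unfolding reflection_apply .
  define d where "d = f *v x - ?c *\<^sub>R x"
  have c2: "(2 * Qf (f *v x) x / Qf x x) *\<^sub>R x = ?c *\<^sub>R x + ?c *\<^sub>R x"
    by (simp add: scaleR_add_left[symmetric])
  have "2 *\<^sub>R d = d + d" by (rule scaleR_2)
  also have "\<dots> = (f *v x - (2 * Qf (f *v x) x / Qf x x) *\<^sub>R x) + f *v x"
    unfolding c2 d_def by (simp only: diff_conv_add_uminus minus_add_distrib ac_simps)
  also have "\<dots> = 0" unfolding e by simp
  finally have "d = 0" by simp
  then obtain c where fx: "f *v x = c *\<^sub>R x" by (auto simp: d_def)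
  then have "c\<^sup>2 = 1" using isometry_eigenvalue_square[OF f fx] x by simp
  then have "c = 1 \<or> c = - 1" by (simp only: power2_eq_1_iff)
  then show "f *v x = x \<or> f *v x = - x" using fx by auto
next
  assume "f *v x = x \<or> f *v x = - x"
  then have "\<exists>e. f *v x = e *\<^sub>R x \<and> e * e = 1"
    by (elim disjE) (rule exI[of _ 1], simp, rule exI[of _ "- 1"], simp)
  then obtain e where e: "f *v x = e *\<^sub>R x" "e * e = 1" by blast
  have "Qf (f *v z) x = e * Qf z x" for z
  proof -
    have "Qf z x = e * Qf (f *v z) x" using O1n_Qf[OF f, of z x] by (simp add: e(1) Qf_simps)
    then have "e * Qf z x = (e * e) * Qf (f *v z) x" by simp
    then show ?thesis by (simp add: e(2))
  qed
  then have "reflection x *v (f *v z) = f *v (reflection x *v z)" for z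
    by (simp add: reflection_apply matrix_vector_mult_diff_distrib matrix_vector_mult_scaleR e(1))
  then show "reflection x ** f = f ** reflection x"
    by (simp add: matrix_eq matrix_vector_mul_assoc[symmetric])
qed

lemma centralizer_reflection_iff:
  assumes "f \<in> O1n" "Qf x x > 0"
  shows "reflection x \<in> centralizer f \<longleftrightarrow> f *v x = x \<or> f *v x = - x"
  using reflection_commute_iff[OF assms] reflection_PO1n[OF assms(2)] by (simp add: centralizer_def)

lemma centralizer_commute: "h \<in> centralizer f \<Longrightarrow> h *v (f *v x) = f *v (h *v x)"
  by (simp add: centralizer_def matrix_vector_mul_assoc)

lemma self_centralizer: "f \<in> PO1n \<Longrightarrow> f \<in> centralizer f"
  by (simp add: centralizer_def)

text \<open>The spacelike vectors \<open>x\<close>, \<open>x + s y\<close>, \<open>x + 2 s y\<close> are fixed by \<open>g\<close>, hence are eigenvectors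
  of \<open>f\<close> for \<open>1\<close> or \<open>-1\<close>; two of the three share the eigenvalue.\<close>
lemma centralizer_eq_common_fixed:
  assumes f: "f \<in> PO1n" and g: "g \<in> PO1n" and Z: "centralizer f = centralizer g"
    and x: "Qf x x > 0" "g *v x = x" and y: "y \<noteq> 0" "Qf y y \<le> 0" "g *v y = y"
  shows "f *v x = x" "f *v y = y"
proof -
  have Of: "f \<in> O1n" and Og: "g \<in> O1n" using f g PO1n_O1n by auto
  \<comment> \<open>Bounds the linear and quadratic terms of \<open>Q(x + t y, x + t y)\<close> for
    \<open>t\<close> between 0 and 1.\<close>
  define M where "M = 2 * \<bar>Qf x y\<bar> + \<bar>Qf y y\<bar>"
  have M: "M \<ge> 0" by (simp add: M_def)
  have pos: "Qf (x + t *\<^sub>R y) (x + t *\<^sub>R y) > 0" if t: "0 \<le> t" "t \<le> 1" "t * M < Qf x x" for t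
  proof -
    have "Qf (x + t *\<^sub>R y) (x + t *\<^sub>R y) = Qf x x + t * (2 * Qf x y + t * Qf y y)"
      by (simp add: Qf_simps Qf_commute[of y x] algebra_simps)
    moreover have "- M \<le> 2 * Qf x y + t * Qf y y"
    proof -
      have "\<bar>t * Qf y y\<bar> \<le> \<bar>Qf y y\<bar>" using t by (simp add: abs_mult mult_left_le_one_le)
      then show ?thesis unfolding M_def by linarith
    qed
    then have "t * (- M) \<le> t * (2 * Qf x y + t * Qf y y)" using t(1) by (rule mult_left_mono)
    ultimately show ?thesis using t(3) by simp
  qed
  define D where "D = M + Qf x x"
  \<comment> \<open>So small that \<open>x + s y\<close> and \<open>x + 2 s y\<close> are still
    spacelike.\<close>
  define s where "s = Qf x x / (4 * D)"
  have s: "s > 0" "2 * s \<le> 1" "2 * s * M < Qf x x"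
  proof -
    have d: "D > 0" "Qf x x \<le> D" "M < D" using M x by (simp_all add: D_def)
    then show "s > 0" using x by (simp add: s_def)
    show "2 * s \<le> 1" using d by (simp add: s_def divide_le_eq)
    have "2 * s * M = Qf x x * (M / (2 * D))" by (simp add: s_def)
    also have "\<dots> < Qf x x * 1"
      using d M x by (intro mult_strict_left_mono) (simp_all add: divide_less_eq)
    finally show "2 * s * M < Qf x x" by simp
  qed
  have eig: "\<exists>e. (e = 1 \<or> e = - 1) \<and> f *v z = e *\<^sub>R z" if z: "Qf z z > 0" "g *v z = z" for z
  proof -
    have "reflection z \<in> centralizer f" unfolding Z centralizer_reflection_iff[OF Og z(1)] using z(2) by simp
    then have "f *v z = z \<or> f *v z = - z" unfolding centralizer_reflection_iff[OF Of z(1)] .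
    then show ?thesis by (metis scaleR_one scaleR_minus1_left)
  qed
  have gz: "g *v (x + t *\<^sub>R y) = x + t *\<^sub>R y" for t
    by (simp add: matrix_vector_right_distrib matrix_vector_mult_scaleR x y)
  have "s * M < Qf x x" using s(3) mult_nonneg_nonneg[of s M] s(1) M by linarith
  then obtain e0 e1 e2 where e: "e0 = 1 \<or> e0 = - 1" "e1 = 1 \<or> e1 = - 1" "e2 = 1 \<or> e2 = - 1"
    and f0: "f *v x = e0 *\<^sub>R x" and f1: "f *v (x + s *\<^sub>R y) = e1 *\<^sub>R (x + s *\<^sub>R y)"
    and f2: "f *v (x + (2 * s) *\<^sub>R y) = e2 *\<^sub>R (x + (2 * s) *\<^sub>R y)"
    using eig[OF x] eig[OF pos gz, of s] eig[OF pos gz, of "2 * s"] s by auto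
  \<comment> \<open>\<open>x\<close> is spacelike and \<open>y\<close> is not, so they are linearly
    independent.\<close>
  have ind: "\<alpha> = 0 \<and> \<beta> = 0" if "\<alpha> *\<^sub>R x = \<beta> *\<^sub>R y" for \<alpha> \<beta>
  proof (cases "\<alpha> = 0")
    case True
    then show ?thesis using that y by auto
  next
    case False
    have "Qf (\<alpha> *\<^sub>R x) (\<alpha> *\<^sub>R x) = Qf (\<beta> *\<^sub>R y) (\<beta> *\<^sub>R y)" by (simp only: that)
    then have "\<alpha>\<^sup>2 * Qf x x = \<beta>\<^sup>2 * Qf y y" by (simp add: Qf_simps power2_eq_square mult.assoc)
    moreover have "\<alpha>\<^sup>2 * Qf x x > 0" using False x by simp
    moreover have "\<beta>\<^sup>2 * Qf y y \<le> 0" using y by (simp add: mult_nonneg_nonpos)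
    ultimately show ?thesis by simp
  qed
  have s1: "s *\<^sub>R (f *v y) = e1 *\<^sub>R (x + s *\<^sub>R y) - e0 *\<^sub>R x"
    using f1 by (simp add: matrix_vector_right_distrib matrix_vector_mult_scaleR f0 eq_diff_eq add.commute)
  have s2: "(2 * s) *\<^sub>R (f *v y) = e2 *\<^sub>R (x + (2 * s) *\<^sub>R y) - e0 *\<^sub>R x"
    using f2 by (simp add: matrix_vector_right_distrib matrix_vector_mult_scaleR f0 eq_diff_eq add.commute)
  have "(2 * s) *\<^sub>R (f *v y) = 2 *\<^sub>R (e1 *\<^sub>R (x + s *\<^sub>R y) - e0 *\<^sub>R x)"
    unfolding s1[symmetric] by simp
  \<comment> \<open>The three vectors are in arithmetic progression: \<open>f\<close> applied to the
    middle one is the mean of the other two images. Independence then equates the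
    eigenvalues.\<close>
  then have "(2 * e1 - e0 - e2) *\<^sub>R x = (2 * s * (e2 - e1)) *\<^sub>R y"
  proof -
    assume h: "(2 * s) *\<^sub>R (f *v y) = 2 *\<^sub>R (e1 *\<^sub>R (x + s *\<^sub>R y) - e0 *\<^sub>R x)"
    have "(2 * e1 - e0 - e2) * x $ i = 2 * s * (e2 - e1) * y $ i" for i
      using arg_cong[OF h[unfolded s2], of "\<lambda>v. v $ i"] by (simp add: algebra_simps)
    then show ?thesis by (simp add: vec_eq_iff)
  qed
  then have "2 * e1 - e0 - e2 = 0" "2 * s * (e2 - e1) = 0" using ind by blast+
  then have e01: "e0 = e1" using s by simp
  then have "s *\<^sub>R (f *v y) = s *\<^sub>R (e0 *\<^sub>R y)" using s1 by (simp add: scaleR_add_right mult.commute)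
  then have fy: "f *v y = e0 *\<^sub>R y" using s by (auto simp only: scaleR_cancel_left)
  \<comment> \<open>The common eigenvalue also belongs to the nonspacelike \<open>y\<close>, which
    an element of \<open>PO1n\<close> cannot negate.\<close>
  then have "e0 = 1" using e(1) PO1n_not_neg[OF f y(1,2)] by auto
  then show "f *v x = x" "f *v y = y" using f0 fy by simp_all
qed

text \<open>The forward eigenvector \<open>u\<close> lies in one block, of parameter
  \<open>c\<close>. Every other block is positive: a nonspacelike vector in it is orthogonal to
  \<open>u\<close>, hence a multiple of \<open>u\<close>. If \<open>b = c\<close>, then
  \<open>b \<le> 1\<close> forces the eigenvalue of \<open>u\<close> to be 1.\<close>

lemma pos_params_or_fixed:
  assumes g: "g \<in> PO1n" and x: "x \<in> eigsp g b" "x \<noteq> 0" and b: "- 1 \<le> b" "b \<le> 1"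
  shows "b \<in> pos_params g \<or> (b = 1 \<and> (\<exists>y. y \<noteq> 0 \<and> Qf y y \<le> 0 \<and> g *v y = y))"
proof -
  have O: "g \<in> O1n" using g PO1n_O1n by blast
  obtain u \<mu> where u: "u $ None > 0" "Qf u u \<le> 0" "\<mu> > 0" "g *v u = \<mu> *\<^sub>R u"
    using exists_forward_eigenvector[OF g] by blast
  then have u0: "u \<noteq> 0" by auto
  define c where "c = (\<mu> + 1 / \<mu>) / 2"
  have uc: "u \<in> eigsp g c" unfolding c_def using eigenvector_eigsp u by blast
  have "b \<in> pos_params g" if bc: "b \<noteq> c"
  proof -
    have "Qposdef (eigsp g b)"
      unfolding Qposdef_def
    proof (intro ballI impI, rule ccontr)
      fix z assume z: "z \<in> eigsp g b" "z \<noteq> 0" "\<not> Qf z z > 0"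
      have "Qf u z = 0" using eigsp_orthogonal[OF O uc z(1)] bc by blast
      then obtain t where "z = t *\<^sub>R u" using nonspacelike_orthogonal[of u z] u0 u z by auto
      then have "z \<in> eigsp g c" using uc subspace_scale[OF eigsp_subspace] by blast
      then have zc: "g *v (g *v z) + z = (2 * c) *\<^sub>R (g *v z)" by (simp add: eigsp_def)
      have "g *v (g *v z) + z = (2 * b) *\<^sub>R (g *v z)" using z(1) by (simp add: eigsp_def)
      then have "(2 * b) *\<^sub>R (g *v z) = (2 * c) *\<^sub>R (g *v z)" unfolding zc by (rule sym)
      then have "g *v z = 0" by (simp only: scaleR_cancel_right) (use bc in auto)
      then show False using O1n_injective[OF O] z(2) by blast
    qed
    then show ?thesis using x b by (auto simp: pos_params_def)
  qed
  moreover have "\<mu> = 1" if "b = c"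
    using half_sum_inverse_gt_1[OF u(3)] that b(2) unfolding c_def by force
  ultimately show ?thesis using u u0 unfolding c_def by (cases "\<mu> = 1") auto
qed

text \<open>If \<open>x\<close>, \<open>y\<close>, \<open>x + y\<close> have parameters
  \<open>a\<close>, \<open>b\<close>, \<open>c\<close>, then \<open>(a - c) x = (c - b) y\<close>
  after cancelling \<open>g\<close>; so \<open>x\<close> and \<open>y\<close> are proportional or
  the parameters agree. This turns pointwise containment into containment of whole blocks.\<close>

lemma subspace_in_one_eigsp:
  assumes g: "g \<in> O1n" and W: "subspace W" "W \<subseteq> (\<Union>b\<in>B. eigsp g b)" "x \<in> W" "x \<noteq> 0"
  shows "\<exists>b\<in>B. W \<subseteq> eigsp g b"
proof -
  obtain a where a: "a \<in> B" "x \<in> eigsp g a" using W by blast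
  have "y \<in> eigsp g a" if y: "y \<in> W" for y
  proof -
    obtain b where b: "y \<in> eigsp g b" using y W by blast
    obtain c where c: "x + y \<in> eigsp g c" using subspace_add[OF W(1,3) y] W(2) by blast
    show ?thesis
    proof (cases "b = a \<or> y = 0")
      case True
      then show ?thesis using b subspace_0[OF eigsp_subspace] by blast
    next
      case False
      have eqs: "g *v (g *v x) + x = (2 * a) *\<^sub>R (g *v x)" "g *v (g *v y) + y = (2 * b) *\<^sub>R (g *v y)"
        "g *v (g *v (x + y)) + (x + y) = (2 * c) *\<^sub>R (g *v (x + y))"
        using a(2) b c unfolding eigsp_def by blast+
      have "(2 * a) *\<^sub>R (g *v x) + (2 * b) *\<^sub>R (g *v y) = g *v (g *v (x + y)) + (x + y)"
        unfolding eqs(1,2)[symmetric] by (simp add: matrix_vector_right_distrib ac_simps)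
      also have "\<dots> = (2 * c) *\<^sub>R (g *v x) + (2 * c) *\<^sub>R (g *v y)"
        unfolding eqs(3) by (simp add: matrix_vector_right_distrib scaleR_add_right)
      finally have h: "(2 * a) *\<^sub>R (g *v x) + (2 * b) *\<^sub>R (g *v y) = (2 * c) *\<^sub>R (g *v x) + (2 * c) *\<^sub>R (g *v y)" .
      have "(a - c) * (g *v x) $ i = (c - b) * (g *v y) $ i" for i
        using arg_cong[OF h, of "\<lambda>v. v $ i"] by (simp add: algebra_simps)
      then have "(a - c) *\<^sub>R (g *v x) = (c - b) *\<^sub>R (g *v y)" by (simp add: vec_eq_iff)
      then have "g *v ((a - c) *\<^sub>R x - (c - b) *\<^sub>R y) = 0"
        by (simp add: matrix_vector_mult_diff_distrib matrix_vector_mult_scaleR)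
      then have e': "(a - c) *\<^sub>R x = (c - b) *\<^sub>R y" using O1n_injective[OF g] by force
      show ?thesis
      proof (cases "c = b")
        case True
        then show ?thesis using e' W(4) False by simp
      next
        case False
        then have "y = ((a - c) / (c - b)) *\<^sub>R x"
          using arg_cong[OF e', of "\<lambda>v. (1 / (c - b)) *\<^sub>R v"] by simp
        then show ?thesis using a(2) subspace_scale[OF eigsp_subspace] by blast
      qed
    qed
  qed
  then show ?thesis using a(1) by blast
qed

lemma centralizer_eq_real_block:
  assumes f: "f \<in> PO1n" and g: "g \<in> PO1n" and Z: "centralizer f = centralizer g" and a: "a \<in> real_params f"
  shows "\<exists>b\<in>real_params g. eigsp f a \<subseteq> eigsp g b"
proof -
  have Of: "f \<in> O1n" and Og: "g \<in> O1n" using f g PO1n_O1n by auto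
  have a': "a \<in> pos_params f" "a = 1 \<or> a = - 1" "a\<^sup>2 = 1" "Qposdef (eigsp f a)" using a by (auto simp: real_params_def pos_params_def)
  have "\<exists>b\<in>real_params g. x \<in> eigsp g b" if x: "x \<in> eigsp f a" "x \<noteq> 0" for x
  proof -
    have xx: "Qf x x > 0" using x a'(4) by (simp add: Qposdef_def)
    have fx: "f *v x = a *\<^sub>R x" using posdef_eigsp_pm1[OF Of a'(4,3) x(1)] .
    then have "reflection x \<in> centralizer g"
      unfolding Z[symmetric] centralizer_reflection_iff[OF Of xx] using a'(2) by auto
    then have gx: "g *v x = x \<or> g *v x = - x" unfolding centralizer_reflection_iff[OF Og xx] .
    then obtain b where b: "b = 1 \<or> b = - 1" "x \<in> eigsp g b" "b = 1 \<Longrightarrow> g *v x = x"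
      using fixed_eigsp[of g x] negated_eigsp[of g x] by (metis one_neq_neg_one)
    \<comment> \<open>The reflection allows \<open>x\<close> to be fixed inside \<open>V_t\<close>
      of \<open>g\<close>. Then \<open>centralizer_eq_common_fixed\<close> makes \<open>f\<close>
      fix both \<open>x\<close> and a nonspacelike \<open>y\<close>, so \<open>a = 1\<close> and the
      block of \<open>f\<close> is not positive.\<close>
    have "\<not> (b = 1 \<and> (\<exists>y. y \<noteq> 0 \<and> Qf y y \<le> 0 \<and> g *v y = y))"
    proof
      assume "b = 1 \<and> (\<exists>y. y \<noteq> 0 \<and> Qf y y \<le> 0 \<and> g *v y = y)"
      then obtain y where y: "y \<noteq> 0" "Qf y y \<le> 0" "g *v y = y" and gx: "g *v x = x" using b(3) by blast
      have fxy: "f *v x = x" "f *v y = y" using centralizer_eq_common_fixed[OF f g Z xx gx y] by auto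
      then have "a *\<^sub>R x = 1 *\<^sub>R x" using fx by simp
      then have "a = 1" using x(2) by (simp only: scaleR_cancel_right) simp
      then show False using not_posdef_eigsp_1[OF fxy(2) y(1,2)] a'(1) by simp
    qed
    then have "b \<in> pos_params g" using pos_params_or_fixed[OF g b(2) x(2)] b(1) by auto
    then show ?thesis using b(1,2) by (auto simp: real_params_def)
  qed
  moreover obtain x where x: "x \<in> eigsp f a" "x \<noteq> 0" using pos_params_nonzero[OF a'(1)] by blast
  ultimately have "eigsp f a \<subseteq> (\<Union>b\<in>real_params g. eigsp g b)"
    using subspace_0[OF eigsp_subspace] by (metis UN_I subsetI)
  then show ?thesis using subspace_in_one_eigsp[OF Og eigsp_subspace _ x] by blast
qed

lemma centralizer_eq_complex_block_point:
  assumes f: "f \<in> PO1n" and g: "g \<in> PO1n" and Z: "centralizer f = centralizer g"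
    and a: "a \<in> complex_params f" and x: "x \<in> eigsp f a" "x \<noteq> 0"
  shows "\<exists>b\<in>complex_params g. x \<in> eigsp g b"
proof -
  have Of: "f \<in> O1n" and Og: "g \<in> O1n" using f g PO1n_O1n by auto
  have a': "a \<in> pos_params f" "\<bar>a\<bar> < 1" "a\<^sup>2 \<noteq> 1" "Qposdef (eigsp f a)" "- 1 \<le> a" "a \<le> 1"
    using a by (auto simp: complex_params_def pos_params_def abs_square_eq_1)
  define b where "b = sqrt (1 - a\<^sup>2)"
  define y where "y = rot f a x"
  have y: "y \<in> eigsp f a" using rot_eigsp[OF x(1)] by (simp add: y_def)
  have fx: "f *v x = a *\<^sub>R x + b *\<^sub>R y" using rot_eq[OF a'(2)] by (simp add: b_def y_def)
  have Jy: "rot f a y = - x" using rot_rot[OF Of a'(4-6) x(1)] a'(3) by (simp add: y_def)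
  have fy: "f *v y = a *\<^sub>R y - b *\<^sub>R x" using rot_eq[OF a'(2), of f y] Jy by (simp add: b_def)
  define q where "q = Qf x x"
  have q: "q > 0" using a'(4) x by (simp add: q_def Qposdef_def)
  have b2: "a * a + b * b = 1" using a'(2) by (simp add: b_def power2_eq_square[symmetric] abs_square_less_1 less_imp_le)
  have xy: "Qf x y = 0" "Qf y x = 0"
    using rot_skew[OF Of x(1), of x] by (simp_all add: y_def Qf_commute[of "rot f a x"])
  have yy: "Qf y y = q"
    using rot_skew[OF Of x(1), of y] Jy by (simp add: y_def q_def Qf_simps)
  \<comment> \<open>Orthogonal projection to the plane of \<open>x\<close> and
    \<open>y = J x\<close>; the product of the two reflections is the half-turn
    \<open>1 - 2 P\<close>.\<close>
  define P where "P z = (Qf z x / q) *\<^sub>R x + (Qf z y / q) *\<^sub>R y" for z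
  let ?R = "reflection x ** reflection y"
  have R: "?R *v z = z - 2 *\<^sub>R P z" for z
    using xy yy by (simp add: matrix_vector_mul_assoc[symmetric] reflection_apply P_def q_def[symmetric] Qf_simps
        scaleR_add_right)
  \<comment> \<open>On the plane the adjoint of \<open>f\<close> is the inverse rotation; this gives
    \<open>P f = f P\<close>.\<close>
  have Qfz: "Qf (f *v z) x = a * Qf z x - b * Qf z y" "Qf (f *v z) y = b * Qf z x + a * Qf z y" for z
  proof -
    have "f *v (a *\<^sub>R x - b *\<^sub>R y) = (a * a + b * b) *\<^sub>R x"
      by (simp add: matrix_vector_mult_diff_distrib matrix_vector_mult_scaleR fx fy scaleR_add_right scaleR_diff_right
          scaleR_add_left mult.commute)
    then have "Qf (f *v z) x = Qf (f *v z) (f *v (a *\<^sub>R x - b *\<^sub>R y))" by (simp add: b2)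
    then show "Qf (f *v z) x = a * Qf z x - b * Qf z y" by (simp add: O1n_Qf[OF Of] Qf_simps)
    have "f *v (b *\<^sub>R x + a *\<^sub>R y) = (a * a + b * b) *\<^sub>R y"
      by (simp add: matrix_vector_right_distrib matrix_vector_mult_scaleR fx fy scaleR_add_right scaleR_diff_right
          scaleR_add_left mult.commute)
    then have "Qf (f *v z) y = Qf (f *v z) (f *v (b *\<^sub>R x + a *\<^sub>R y))" by (simp add: b2)
    then show "Qf (f *v z) y = b * Qf z x + a * Qf z y" by (simp add: O1n_Qf[OF Of] Qf_simps)
  qed
  have "P (f *v z) = f *v P z" for z
  proof -
    have "P (f *v z) $ i = (f *v P z) $ i" for i
      unfolding P_def Qfz by (simp add: matrix_vector_right_distrib matrix_vector_mult_scaleR fx fy algebra_simps add_divide_distrib diff_divide_distrib)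
    then show ?thesis by (simp add: vec_eq_iff)
  qed
  then have "?R *v (f *v z) = f *v (?R *v z)" for z
    unfolding R by (simp add: matrix_vector_mult_diff_distrib matrix_vector_mult_scaleR)
  then have "?R ** f = f ** ?R" by (simp add: matrix_eq matrix_vector_mul_assoc[symmetric])
  moreover have "?R \<in> PO1n"
    using q yy by (intro PO1n_mult reflection_PO1n) (simp_all add: q_def)
  ultimately have "?R \<in> centralizer g" unfolding Z[symmetric] by (simp add: centralizer_def)
  then have Rg: "?R *v (g *v z) = g *v (?R *v z)" for z by (rule centralizer_commute)
  have Px: "P x = x" using q xy by (simp add: P_def q_def)
  have "g *v x - 2 *\<^sub>R P (g *v x) = g *v (x - 2 *\<^sub>R x)" using Rg[of x] unfolding R Px .
  then have h: "g *v x - 2 *\<^sub>R P (g *v x) = g *v x - 2 *\<^sub>R (g *v x)"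
    by (simp only: matrix_vector_mult_diff_distrib matrix_vector_mult_scaleR)
  then have "P (g *v x) = g *v x" by simp
  then obtain \<alpha> \<beta> where gx: "g *v x = \<alpha> *\<^sub>R x + \<beta> *\<^sub>R y" unfolding P_def by metis
  have gf: "g *v (f *v z) = f *v (g *v z)" for z
    using centralizer_commute[of f g z] self_centralizer[OF f] Z by simp
  \<comment> \<open>\<open>g\<close> lies in its own centralizer, which is that of \<open>f\<close>;
    so it commutes with \<open>f\<close> and with the complex structure
    \<open>rot f a\<close>.\<close>
  have gy: "g *v y = \<alpha> *\<^sub>R y - \<beta> *\<^sub>R x"
  proof -
    have "g *v y = rot f a (g *v x)"
      unfolding y_def rot_def by (simp add: matrix_vector_mult_scaleR matrix_vector_mult_diff_distrib gf)
    also have "\<dots> = \<alpha> *\<^sub>R y + \<beta> *\<^sub>R rot f a y"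
      unfolding gx using rot_linear[of f a] by (simp add: linear_add linear_scale y_def)
    finally show ?thesis by (simp add: Jy)
  qed
  have "Qf (g *v x) (g *v x) = (\<alpha> * \<alpha> + \<beta> * \<beta>) * q"
    unfolding gx by (simp add: Qf_simps xy yy q_def[symmetric] algebra_simps)
  then have n: "\<alpha> * \<alpha> + \<beta> * \<beta> = 1" using q by (simp add: O1n_Qf[OF Og] q_def)
  \<comment> \<open>Otherwise \<open>g\<close> fixes or negates \<open>x\<close>, and the reflection
    in \<open>x\<close> centralizes \<open>g\<close> and hence \<open>f\<close>. Then
    \<open>x\<close> lies in a block of 1 or -1, orthogonal to that of \<open>a\<close>.\<close>
  have "\<beta> \<noteq> 0"
  proof
    assume "\<beta> = 0"
    then have "g *v x = \<alpha> *\<^sub>R x" "\<alpha>\<^sup>2 = 1" using gx n by (simp_all add: power2_eq_square)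
    then have "g *v x = x \<or> g *v x = - x" by (auto simp: power2_eq_1_iff)
    then have "reflection x \<in> centralizer f"
      unfolding Z using centralizer_reflection_iff[OF Og] q by (simp add: q_def)
    then have "f *v x = x \<or> f *v x = - x" using centralizer_reflection_iff[OF Of] q by (simp add: q_def)
    then have "x \<in> eigsp f 1 \<or> x \<in> eigsp f (- 1)" using fixed_eigsp negated_eigsp by blast
    then have "Qf x x = 0" using eigsp_orthogonal[OF Of x(1), of x] a'(3) by (metis power2_eq_1_iff)
    then show False using q by (simp add: q_def)
  qed
  then have "\<beta> * \<beta> > 0" by (auto simp: zero_less_mult_iff)
  then have "\<alpha>\<^sup>2 < 1" using n by (simp add: power2_eq_square)
  then have \<alpha>: "\<bar>\<alpha>\<bar> < 1" by (simp add: abs_square_less_1)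
  have "g *v (g *v x) + x = (2 * \<alpha>) *\<^sub>R (g *v x)"
  proof -
    have "g *v (g *v x) = \<alpha> *\<^sub>R (g *v x) + \<beta> *\<^sub>R (g *v y)"
      by (subst gx) (simp add: matrix_vector_right_distrib matrix_vector_mult_scaleR)
    also have "\<dots> + x = (2 * \<alpha>) *\<^sub>R (g *v x) + (1 - (\<alpha> * \<alpha> + \<beta> * \<beta>)) *\<^sub>R x"
      unfolding gx gy by (simp add: vec_eq_iff algebra_simps)
    finally show ?thesis by (simp add: n)
  qed
  then have xg: "x \<in> eigsp g \<alpha>" by (simp add: eigsp_def)
  have "- 1 \<le> \<alpha>" "\<alpha> \<le> 1" "\<alpha> \<noteq> 1" using \<alpha> by (auto simp: abs_less_iff)
  then have "\<alpha> \<in> pos_params g" using pos_params_or_fixed[OF g xg x(2)] by blast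
  then show ?thesis using xg \<alpha> by (auto simp: complex_params_def)
qed

lemma centralizer_eq_complex_block:
  assumes f: "f \<in> PO1n" and g: "g \<in> PO1n" and Z: "centralizer f = centralizer g" and a: "a \<in> complex_params f"
  shows "\<exists>b\<in>complex_params g. eigsp f a \<subseteq> eigsp g b"
proof -
  have a': "a \<in> pos_params f" using a by (auto simp: complex_params_def)
  obtain x where x: "x \<in> eigsp f a" "x \<noteq> 0" using pos_params_nonzero[OF a'] by blast
  have "eigsp f a \<subseteq> (\<Union>b\<in>complex_params g. eigsp g b)"
  proof
    fix z assume z: "z \<in> eigsp f a"
    show "z \<in> (\<Union>b\<in>complex_params g. eigsp g b)"
    proof (cases "z = 0")
      case True
      then show ?thesis
        using centralizer_eq_complex_block_point[OF f g Z a x] subspace_0[OF eigsp_subspace] by blast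
    next
      case False
      then show ?thesis using centralizer_eq_complex_block_point[OF f g Z a z] by blast
    qed
  qed
  then show ?thesis using subspace_in_one_eigsp[OF PO1n_O1n[OF g] eigsp_subspace _ x] by blast
qed

text \<open>A chain of inclusions from block \<open>a\<close> of \<open>f\<close> through a block of
  \<open>g\<close> to block \<open>a'\<close> of \<open>f\<close> forces \<open>a = a'\<close>,
  since distinct blocks are orthogonal and the first contains a spacelike vector.\<close>

lemma blocks_subset:
  assumes f: "f \<in> O1n" and A: "A \<subseteq> pos_params f"
    and fg: "\<And>a. a \<in> A \<Longrightarrow> \<exists>b\<in>B. eigsp f a \<subseteq> eigsp g b" and gf: "\<And>b. b \<in> B \<Longrightarrow> \<exists>a\<in>A. eigsp g b \<subseteq> eigsp f a"
  shows "eigsp f ` A \<subseteq> eigsp g ` B"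
proof
  fix W assume "W \<in> eigsp f ` A"
  then obtain a where a: "a \<in> A" "W = eigsp f a" by blast
  obtain b where b: "b \<in> B" "eigsp f a \<subseteq> eigsp g b" using fg[OF a(1)] by blast
  obtain a' where a': "a' \<in> A" "eigsp g b \<subseteq> eigsp f a'" using gf[OF b(1)] by blast
  obtain x where x: "x \<in> eigsp f a" "Qf x x > 0" using pos_params_nonzero A a(1) by blast
  have "a = a'"
    using eigsp_orthogonal[OF f x(1), of x a'] x a'(2) b(2) by (metis less_irrefl subsetD)
  then show "W \<in> eigsp g ` B" using a b a' by blast
qed

lemma centralizer_eq_blocks:
  assumes f: "f \<in> PO1n" and g: "g \<in> PO1n" and Z: "centralizer f = centralizer g"
  shows "eigsp f ` complex_params f = eigsp g ` complex_params g" "eigsp f ` real_params f = eigsp g ` real_params g"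
proof -
  have O: "f \<in> O1n" "g \<in> O1n" using f g PO1n_O1n by auto
  have s: "complex_params h \<subseteq> pos_params h" "real_params h \<subseteq> pos_params h" for h :: "'a lmat"
    by (auto simp: complex_params_def real_params_def)
  note c = centralizer_eq_complex_block[OF f g Z] centralizer_eq_complex_block[OF g f Z[symmetric]]
  note r = centralizer_eq_real_block[OF f g Z] centralizer_eq_real_block[OF g f Z[symmetric]]
  show "eigsp f ` complex_params f = eigsp g ` complex_params g"
    using blocks_subset[OF O(1) s(1) c] blocks_subset[OF O(2) s(1) c(2,1)] by blast
  show "eigsp f ` real_params f = eigsp g ` real_params g"
    using blocks_subset[OF O(1) s(2) r] blocks_subset[OF O(2) s(2) r(2,1)] by blast
qed

lemma Vs_eq_of_blocks:
  assumes "f \<in> O1n" "g \<in> O1n"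
    "eigsp f ` complex_params f = eigsp g ` complex_params g" "eigsp f ` real_params f = eigsp g ` real_params g"
  shows "Vs f = Vs g"
proof -
  have "eigsp f ` pos_params f = eigsp g ` pos_params g"
    unfolding pos_params_split image_Un assms(3,4) ..
  then show ?thesis unfolding Vs_eq_span_eigsp[OF assms(1)] Vs_eq_span_eigsp[OF assms(2)] by simp
qed

section \<open>The centralizer determines the type\<close>

lemma Vt_mult_closed:
  assumes "x \<in> Vt f"
  shows "f *v x \<in> Vt f"
  using assms unfolding Vt_def
proof (induction rule: span_induct_alt)
  case base
  then show ?case by (simp add: span_zero)
next
  case (step c y z)
  have "f *v y \<in> span (\<Union>{primary_comp f p | p. p \<in> prime_factors_cp f \<and> \<not> Qposdef (primary_comp f p)})"
    using step(1) primary_comp_mult_closed by (intro span_base) blast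
  then show ?case using step(2)
    by (simp add: matrix_vector_right_distrib matrix_vector_mult_scaleR span_add span_scale)
qed

text \<open>In the other two types such an eigenvector would be null and orthogonal to the fixed
  \<open>v\<close>: impossible for timelike \<open>v\<close>, while for null \<open>v\<close> it
  would be a multiple of \<open>v\<close> with eigenvalue 1.\<close>

lemma type_of_Hyp_iff:
  assumes f: "f \<in> PO1n"
  shows "type_of f = Hyp \<longleftrightarrow> (\<exists>u \<mu>. \<mu> > 0 \<and> \<mu> \<noteq> 1 \<and> u \<noteq> 0 \<and> f *v u = \<mu> *\<^sub>R u)"
proof -
  have O: "f \<in> O1n" using f PO1n_O1n by blast
  have null: "Qf u u = 0" if "\<mu> > 0" "\<mu> \<noteq> 1" "f *v u = \<mu> *\<^sub>R u" for u \<mu>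
  proof (rule ccontr)
    assume "Qf u u \<noteq> 0"
    then have "\<mu>\<^sup>2 = 1" using isometry_eigenvalue_square[OF O that(3)] by blast
    then show False using that by (auto simp: power2_eq_1_iff)
  qed
  have orth: "Qf v u = 0" if "\<mu> \<noteq> 1" "f *v u = \<mu> *\<^sub>R u" "f *v v = v" for u v \<mu>
    using O1n_Qf[OF O, of v u] that by (simp add: Qf_simps)
  from f show ?thesis
  proof (cases rule: PO1n_trichotomy)
    case (elliptic v)
    have "type_of f = Ell" using elliptic by (intro elliptic_type[OF f, of v]) auto
    moreover have "\<not> (\<exists>u \<mu>. \<mu> > 0 \<and> \<mu> \<noteq> 1 \<and> u \<noteq> 0 \<and> f *v u = \<mu> *\<^sub>R u)"
      using null orth[OF _ _ elliptic(3)] timelike_orthogonal[OF elliptic(2)] by force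
    ultimately show ?thesis by simp
  next
    case (parabolic v)
    have v0: "v \<noteq> 0" using parabolic by auto
    have "type_of f = Par" using parabolic v0 by (intro parabolic_type[OF f, of v]) auto
    moreover have "\<not> (\<exists>u \<mu>. \<mu> > 0 \<and> \<mu> \<noteq> 1 \<and> u \<noteq> 0 \<and> f *v u = \<mu> *\<^sub>R u)"
    proof
      assume "\<exists>u \<mu>. \<mu> > 0 \<and> \<mu> \<noteq> 1 \<and> u \<noteq> 0 \<and> f *v u = \<mu> *\<^sub>R u"
      then obtain u \<mu> where u: "\<mu> > 0" "\<mu> \<noteq> 1" "u \<noteq> 0" "f *v u = \<mu> *\<^sub>R u" by blast
      obtain t where t: "u = t *\<^sub>R v"
        using null_orthogonal_null[OF parabolic(3) null[OF u(1,2,4)] v0 orth[OF u(2,4) parabolic(4)]] by blast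
      then have "\<mu> *\<^sub>R u = 1 *\<^sub>R u" using u(4) parabolic(4) by (simp add: matrix_vector_mult_scaleR)
      then show False using u(2,3) by (simp only: scaleR_cancel_right) simp
    qed
    ultimately show ?thesis by simp
  next
    case (hyperbolic u w \<mu>)
    then have "u \<in> Vt f" using Vt_hyperbolic[OF O] by (simp add: span_base)
    then have "type_of f = Hyp" using hyperbolic by (intro hyperbolic_type[of u f \<mu>]) auto
    moreover have "u \<noteq> 0" using hyperbolic by auto
    ultimately show ?thesis using hyperbolic(1,2,7) by blast
  qed
qed

text \<open>A spacelike vector in \<open>V_t\<close> is fixed together with \<open>v\<close>, and
  \<open>centralizer_eq_common_fixed\<close> transfers both to \<open>g\<close>. Without one,
  another argument is needed for \<open>v\<close>.\<close>

lemma centralizer_eq_Ell: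
  assumes f: "f \<in> PO1n" and g: "g \<in> PO1n" and Z: "centralizer f = centralizer g" and Vt: "Vt f = Vt g"
    and t: "type_of f = Ell"
  shows "type_of g = Ell"
proof -
  have Of: "f \<in> O1n" and Og: "g \<in> O1n" using f g PO1n_O1n by auto
  obtain v where v: "f *v v = v" "Qf v v < 0" using t type_of_Ell_iff[OF f] by blast
  have v0: "v \<noteq> 0" using v by auto
  have fixed: "Vt f = {x. f *v x = x}" by (rule elliptic_Vt[OF f v])
  have "g *v v = v"
  proof (cases "\<exists>x\<in>Vt f. Qf x x > 0")
    case True
    then obtain x where "f *v x = x" "Qf x x > 0" using fixed by blast
    then show ?thesis using centralizer_eq_common_fixed(2)[OF g f Z[symmetric] _ _ v0 _ v(1)] v(2) by simp
  next
    \<comment> \<open>Here \<open>V_t\<close> is the line of \<open>v\<close>, which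
      \<open>g\<close> preserves because it is also its own \<open>V_t\<close>; the factor is 1 or
      -1, and -1 would reverse time.\<close>
    case False
    have "v \<in> Vt f" using fixed v by simp
    then have "g *v v \<in> Vt f" using Vt_mult_closed[of v g] Vt by simp
    define c where "c = Qf (g *v v) v / Qf v v"
    define z where "z = g *v v - c *\<^sub>R v"
    have "z \<in> Vt f" unfolding z_def
      using \<open>g *v v \<in> Vt f\<close> fixed v by (intro subspace_diff subspace_scale Vt_subspace) auto
    moreover have "Qf v z = 0" using v(2) by (simp add: z_def c_def Qf_simps Qf_commute[of v "g *v v"])
    ultimately have "z = 0" using timelike_orthogonal[OF v(2)] False by blast
    then have gv: "g *v v = c *\<^sub>R v" by (simp add: z_def)
    then have "c\<^sup>2 = 1" using isometry_eigenvalue_square[OF Og gv] v(2) by simp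
    moreover have "c \<noteq> - 1" using PO1n_not_neg[OF g v0] gv v(2) by auto
    ultimately have "c = 1" by (simp add: power2_eq_1_iff)
    then show ?thesis using gv by simp
  qed
  then show ?thesis using elliptic_type[OF g] v(2) by blast
qed

text \<open>\<open>g\<close> commutes with \<open>f\<close> and so preserves the two null
  eigenlines. If its factor on \<open>u\<close> is 1, then so is the one on \<open>w\<close>, and
  \<open>g\<close> fixes the timelike \<open>u + w\<close>: it is elliptic, and by
  \<open>centralizer_eq_Ell\<close> so is \<open>f\<close>.\<close>

lemma centralizer_eq_Hyp:
  assumes f: "f \<in> PO1n" and g: "g \<in> PO1n" and Z: "centralizer f = centralizer g" and Vt: "Vt f = Vt g"
    and t: "type_of f = Hyp"
  shows "type_of g = Hyp"
proof -
  have Of: "f \<in> O1n" and Og: "g \<in> O1n" using f g PO1n_O1n by auto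
  have fg: "f *v (g *v z) = g *v (f *v z)" for z
    using centralizer_commute[of f g z] self_centralizer[OF f] Z by simp
  from f show ?thesis
  proof (cases rule: PO1n_trichotomy)
    case (elliptic v)
    then have "type_of f = Ell" by (intro elliptic_type[OF f, of v]) auto
    then show ?thesis using t by simp
  next
    case (parabolic v)
    then have "type_of f = Par" by (intro parabolic_type[OF f, of v]) auto
    then show ?thesis using t by simp
  next
    case (hyperbolic u w \<mu>)
    \<comment> \<open>\<open>z\<close> and \<open>g z\<close> are null eigenvectors for the same
      \<open>\<nu>\<close>; as \<open>\<nu>^2 \<noteq> 1\<close> they are orthogonal, hence
      proportional.\<close>
    have scal: "\<exists>\<alpha>. g *v z = \<alpha> *\<^sub>R z" if z: "f *v z = \<nu> *\<^sub>R z" "\<nu>\<^sup>2 \<noteq> 1" "Qf z z = 0" "z \<noteq> 0" for z \<nu>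
    proof (rule null_orthogonal_null[OF z(3) _ z(4)])
      show "Qf (g *v z) (g *v z) = 0" by (simp add: O1n_Qf[OF Og] z(3))
      have "f *v (g *v z) = \<nu> *\<^sub>R (g *v z)" by (simp add: fg z(1) matrix_vector_mult_scaleR)
      then have "Qf z (g *v z) = \<nu>\<^sup>2 * Qf z (g *v z)"
        using O1n_Qf[OF Of, of z "g *v z"] z(1) by (simp add: Qf_simps power2_eq_square)
      then show "Qf z (g *v z) = 0" using z(2) by simp
    qed
    have ne1: "\<mu>\<^sup>2 \<noteq> 1" using hyperbolic(1,2) by (auto simp: power2_eq_1_iff)
    then have ne: "\<mu>\<^sup>2 \<noteq> 1" "(1 / \<mu>)\<^sup>2 \<noteq> 1" by (auto simp: power_divide)
    have nz: "u \<noteq> 0" "w \<noteq> 0" using hyperbolic(6) by auto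
    obtain \<alpha> \<beta> where g1: "g *v u = \<alpha> *\<^sub>R u" "g *v w = \<beta> *\<^sub>R w"
      using scal[OF hyperbolic(7) ne(1) hyperbolic(4) nz(1)] scal[OF hyperbolic(8) ne(2) hyperbolic(5) nz(2)] by blast
    have "(g *v u) $ None > 0" using PO1n_forward[OF g _ hyperbolic(3)] hyperbolic(4) by simp
    then have \<alpha>: "\<alpha> > 0" using g1(1) hyperbolic(3) by (simp add: zero_less_mult_iff)
    show ?thesis
    proof (cases "\<alpha> = 1")
      case True
      have "Qf (g *v u) (g *v w) = - 1" by (simp add: O1n_Qf[OF Og] hyperbolic(6))
      then have "\<beta> = 1" unfolding g1 by (simp add: Qf_simps hyperbolic(6) True)
      then have "g *v (u + w) = u + w" using g1 True by (simp add: matrix_vector_right_distrib)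
      moreover have "Qf (u + w) (u + w) < 0"
        using hyperbolic(4,5,6) by (simp add: Qf_simps Qf_commute[of w u])
      ultimately have "type_of g = Ell" using elliptic_type[OF g] by blast
      then have "type_of f = Ell" using centralizer_eq_Ell[OF g f Z[symmetric] Vt[symmetric]] by blast
      then show ?thesis using t by simp
    next
      case False
      then show ?thesis unfolding type_of_Hyp_iff[OF g] using \<alpha> g1(1) nz(1) by blast
    qed
  qed
qed

text \<open>Indexes the multisets by the subspaces instead of their parameters, because equal
  centralizers have equal blocks but not equal parameters.\<close>

lemma segre_eq_blocks:
  assumes f: "f \<in> PO1n"
  shows "segre f = (type_of f, dim (Vt f),
    image_mset (\<lambda>W. dim W div 2) (mset_set (eigsp f ` complex_params f)),
    image_mset dim (mset_set (eigsp f ` real_params f)))"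
proof -
  have i: "inj_on (eigsp f) (complex_params f)" "inj_on (eigsp f) (real_params f)"
    using pos_params_inj[OF PO1n_O1n[OF f]]
    by (auto simp: complex_params_def real_params_def intro: inj_on_subset)
  show ?thesis
    unfolding segre_eq_params[OF f] image_mset_mset_set[OF i(1), symmetric] image_mset_mset_set[OF i(2), symmetric]
    by (simp add: image_mset.compositionality o_def)
qed

lemma segre_eq_of_centralizer_eq:
  assumes f: "f \<in> PO1n" and g: "g \<in> PO1n" and Z: "centralizer f = centralizer g"
  shows "segre f = segre g"
proof -
  note b = centralizer_eq_blocks[OF f g Z]
  have Vs: "Vs f = Vs g" using Vs_eq_of_blocks[OF _ _ b] f g PO1n_O1n by blast
  then have Vt: "Vt f = Vt g" unfolding Vt_eq_orthogonal[OF f] Vt_eq_orthogonal[OF g] by simp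
  have "type_of f = type_of g"
    using centralizer_eq_Ell[OF f g Z Vt] centralizer_eq_Ell[OF g f Z[symmetric] Vt[symmetric]]
      centralizer_eq_Hyp[OF f g Z Vt] centralizer_eq_Hyp[OF g f Z[symmetric] Vt[symmetric]]
    by (metis ttype.exhaust)
  then show ?thesis unfolding segre_eq_blocks[OF f] segre_eq_blocks[OF g] b Vt by simp
qed

text \<open>All ingredients are expressed by blocks, \<open>Q\<close> and eigenvectors, which
  \<open>k\<close> carries over. This reduces conjugate centralizers to equal ones.\<close>

lemma segre_conj:
  assumes f: "f \<in> PO1n" and k: "k \<in> PO1n"
  shows "segre (k ** f ** matrix_inv k) = segre f"
proof -
  define g where "g = k ** f ** matrix_inv k"
  have Ok: "k \<in> O1n" and Of: "f \<in> O1n" using f k PO1n_O1n by auto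
  have g: "g \<in> PO1n" unfolding g_def using f k by (intro PO1n_mult PO1n_matrix_inv)
  have gk: "g *v (k *v x) = k *v (f *v x)" for x
    by (simp add: g_def matrix_vector_mul_assoc[symmetric] O1n_inv[OF Ok])
  have kinj: "k *v x = k *v y \<longleftrightarrow> x = y" for x y by (metis O1n_inv(4)[OF Ok])
  have img: "S = (*v) k ` T" if "\<And>x. k *v x \<in> S \<longleftrightarrow> x \<in> T" for S T
  proof
    show "S \<subseteq> (*v) k ` T" using that by (metis O1n_inv(3)[OF Ok] imageI subsetI)
    show "(*v) k ` T \<subseteq> S" using that by blast
  qed
  have eig: "eigsp g a = (*v) k ` eigsp f a" for a
  proof (rule img)
    fix x
    have "k *v x \<in> eigsp g a \<longleftrightarrow> k *v (f *v (f *v x) + x) = k *v ((2 * a) *\<^sub>R (f *v x))"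
      by (simp add: eigsp_def gk matrix_vector_right_distrib matrix_vector_mult_scaleR)
    then show "k *v x \<in> eigsp g a \<longleftrightarrow> x \<in> eigsp f a" unfolding kinj by (simp add: eigsp_def)
  qed
  have pd: "Qposdef ((*v) k ` W) \<longleftrightarrow> Qposdef W" for W
    using O1n_injective[OF Ok] by (auto simp: Qposdef_def O1n_Qf[OF Ok])
  have z: "(*v) k ` W = {0} \<longleftrightarrow> W = {0}" for W
  proof -
    have "{0} = (*v) k ` {0}" by simp
    then show ?thesis using kinj by (metis inj_image_eq_iff injI)
  qed
  have pos: "pos_params g = pos_params f" unfolding pos_params_def eig pd z ..
  have dim: "dim ((*v) k ` W) = dim W" for W
    by (rule dim_image_eq) (use kinj in \<open>auto simp: inj_on_def\<close>)
  have "Vs g = (*v) k ` Vs f"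
    unfolding Vs_eq_span_eigsp[OF Of] Vs_eq_span_eigsp[OF PO1n_O1n[OF g]] pos eig
    by (simp add: linear_span_image[symmetric] image_UN)
  then have "Vt g = (*v) k ` Vt f"
    unfolding Vt_eq_orthogonal[OF f] Vt_eq_orthogonal[OF g] by (intro img) (auto simp: O1n_Qf[OF Ok])
  moreover have "type_of g = type_of f"
  proof -
    have "type_of g = Ell \<longleftrightarrow> type_of f = Ell"
      unfolding type_of_Ell_iff[OF f] type_of_Ell_iff[OF g]
      by (metis O1n_inv(3)[OF Ok] gk kinj O1n_Qf[OF Ok])
    moreover have "type_of g = Hyp \<longleftrightarrow> type_of f = Hyp"
    proof -
      have "g *v (k *v u) = \<mu> *\<^sub>R (k *v u) \<longleftrightarrow> f *v u = \<mu> *\<^sub>R u" for u \<mu>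
        by (simp add: gk matrix_vector_mult_scaleR[symmetric] kinj)
      moreover have "k *v u \<noteq> 0 \<longleftrightarrow> u \<noteq> 0" for u using O1n_injective[OF Ok] by auto
      ultimately show ?thesis
        unfolding type_of_Hyp_iff[OF f] type_of_Hyp_iff[OF g] by (metis O1n_inv(3)[OF Ok])
    qed
    ultimately show ?thesis by (metis ttype.exhaust)
  qed
  ultimately show ?thesis
    unfolding g_def[symmetric] segre_eq_params[OF f] segre_eq_params[OF g]
    by (simp add: complex_params_def real_params_def pos eig dim)
qed

lemma centralizer_conj:
  assumes f: "f \<in> PO1n" and k: "k \<in> PO1n"
  shows "centralizer (k ** f ** matrix_inv k) = (\<lambda>h. k ** h ** matrix_inv k) ` centralizer f"
proof -
  have Ok: "k \<in> O1n" using k PO1n_O1n by auto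
  note ki = O1n_inv(1,2)[OF Ok]
  have c1: "matrix_inv k ** (k ** A) = A" "k ** (matrix_inv k ** A) = A" for A :: "'a lmat"
    by (simp_all add: matrix_mul_assoc ki)
  show ?thesis
  proof
    show "(\<lambda>h. k ** h ** matrix_inv k) ` centralizer f \<subseteq> centralizer (k ** f ** matrix_inv k)"
      using k by (auto simp: centralizer_def PO1n_mult PO1n_matrix_inv matrix_mul_assoc[symmetric] c1)
        (simp add: matrix_mul_assoc)
    show "centralizer (k ** f ** matrix_inv k) \<subseteq> (\<lambda>h. k ** h ** matrix_inv k) ` centralizer f"
    proof
      fix h assume h: "h \<in> centralizer (k ** f ** matrix_inv k)"
      let ?h = "matrix_inv k ** h ** k"
      have "h ** (k ** f ** matrix_inv k) = (k ** f ** matrix_inv k) ** h" using h by (simp add: centralizer_def)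
      then have "matrix_inv k ** (h ** (k ** f ** matrix_inv k)) ** k = matrix_inv k ** ((k ** f ** matrix_inv k) ** h) ** k"
        by simp
      then have "?h ** f = f ** ?h"
        by (simp add: matrix_mul_assoc[symmetric] c1 ki)
      then have "?h \<in> centralizer f"
        using h k by (simp add: centralizer_def PO1n_mult PO1n_matrix_inv)
      moreover have "h = k ** ?h ** matrix_inv k" by (simp add: matrix_mul_assoc[symmetric] c1 ki)
      ultimately show "h \<in> (\<lambda>h. k ** h ** matrix_inv k) ` centralizer f" by blast
    qed
  qed
qed

lemma segre_eq_of_conj_centralizers:
  assumes f: "f \<in> PO1n" and g: "g \<in> PO1n" and c: "conj_subgroups (centralizer f) (centralizer g)"
  shows "segre f = segre g"
proof -
  obtain k where k: "k \<in> PO1n" "(\<lambda>h. k ** h ** matrix_inv k) ` centralizer f = centralizer g"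
    using c by (auto simp: conj_subgroups_def)
  let ?f = "k ** f ** matrix_inv k"
  have "?f \<in> PO1n" using f k by (intro PO1n_mult PO1n_matrix_inv)
  then have "segre ?f = segre g"
    using segre_eq_of_centralizer_eq[OF _ g] centralizer_conj[OF f k(1)] k(2) by simp
  then show ?thesis using segre_conj[OF f k(1)] by simp
qed

section \<open>Equal Segre symbols give conjugate centralizers\<close>

text \<open>A set of pairs stands for a partial linear map given by its graph; bilinearity extends
  agreement of Gram matrices to the span.\<close>

lemma Qf_span_pairs:
  assumes "\<And>p q. p \<in> S \<Longrightarrow> q \<in> S \<Longrightarrow> Qf (snd p) (snd q) = Qf (fst p) (fst q)"
    and "p \<in> span S" "q \<in> span S"
  shows "Qf (snd p) (snd q) = Qf (fst p) (fst q)"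
proof -
  have 1: "Qf (snd p) (snd q) = Qf (fst p) (fst q)" if "p \<in> span S" "q \<in> S" for p q
    using that(1)
  proof (induction rule: span_induct_alt)
    case (step c x y)
    then show ?case using assms(1)[OF step(1) that(2)] by (simp add: Qf_simps)
  qed simp
  show ?thesis
    using assms(3)
  proof (induction rule: span_induct_alt)
    case (step c x y)
    then show ?case using 1[OF assms(2) step(1)] by (simp add: Qf_simps)
  qed simp
qed

text \<open>Extend linearly from a basis chosen among the first components; equal Gram matrices make
  \<open>k\<close> an isometry. For any further pair, \<open>k (fst p) - snd p\<close> is orthogonal
  to the image of \<open>k\<close>, which is everything.\<close>

lemma Witt_extension:
  fixes R :: "('n::finite lvec \<times> 'n lvec) set"
  assumes sp: "span (fst ` R) = UNIV"
    and gram: "\<And>p q. p \<in> R \<Longrightarrow> q \<in> R \<Longrightarrow> Qf (snd p) (snd q) = Qf (fst p) (fst q)"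
  obtains k where "k \<in> O1n" "\<And>p. p \<in> R \<Longrightarrow> k *v fst p = snd p"
proof -
  obtain B where B: "B \<subseteq> fst ` R" "independent B" "fst ` R \<subseteq> span B"
    using maximal_independent_subset[of "fst ` R"] by blast
  have spB: "span B = UNIV" using B sp by (metis span_mono span_span top.extremum_unique)
  have "\<forall>b\<in>B. \<exists>c. (b, c) \<in> R" using B(1) by force
  then obtain c where c: "\<And>b. b \<in> B \<Longrightarrow> (b, c b) \<in> R" by metis
  obtain g where g: "linear g" "\<And>b. b \<in> B \<Longrightarrow> g b = c b"
    using linear_independent_extend[OF B(2), of c] by blast
  define k where "k = matrix g"
  have k: "k *v x = g x" for x using g(1) by (simp add: k_def matrix_works)
  have kB: "k *v b = c b" if "b \<in> B" for b using g(2)[OF that] k by simp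
  have iso: "Qf (k *v x) (k *v y) = Qf x y" for x y
  proof -
    let ?S = "(\<lambda>b. (b, k *v b)) ` B"
    have graph: "(x, k *v x) \<in> span ?S" for x
    proof -
      have "x \<in> span B" by (simp add: spB)
      then show ?thesis
      proof (induction rule: span_induct_alt)
        case base
        then show ?case by (simp add: zero_prod_def[symmetric] span_zero)
      next
        case (step c x y)
        have "(c *\<^sub>R x + y, k *v (c *\<^sub>R x + y)) = c *\<^sub>R (x, k *v x) + (y, k *v y)"
          by (simp add: matrix_vector_right_distrib matrix_vector_mult_scaleR)
        moreover have "(x, k *v x) \<in> span ?S" using step(1) by (intro span_base) blast
        ultimately show ?case using step(2) by (simp add: span_add span_scale del: scaleR_Pair)
      qed
    qed
    have "Qf (snd (x, k *v x)) (snd (y, k *v y)) = Qf (fst (x, k *v x)) (fst (y, k *v y))"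
      by (rule Qf_span_pairs[OF _ graph graph]) (use gram[OF c c] kB in force)
    then show ?thesis by simp
  qed
  then have kO: "k \<in> O1n" by (simp add: O1n_def)
  have "k *v fst p = snd p" if p: "p \<in> R" for p
  proof -
    have 0: "Qf (k *v fst p - snd p) y = 0" if y: "y \<in> (*v) k ` B" for y
    proof -
      obtain b where b: "b \<in> B" "y = k *v b" using y by blast
      show ?thesis using gram[OF p c[OF b(1)]] kB[OF b(1)] iso[of "fst p" b] by (simp add: b(2) Qf_simps)
    qed
    have "span ((*v) k ` B) = (*v) k ` UNIV" using spB by (simp add: linear_span_image)
    also have "\<dots> = UNIV" using O1n_inv(3)[OF kO] by (metis surjI)
    finally have "k *v fst p - snd p = 0" using 0 by (rule Qf_nondegenerate_span)
    then show ?thesis by simp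
  qed
  then show thesis using that kO by blast
qed

text \<open>If \<open>R\<close> is the graph of \<open>k\<close> on a block of \<open>f\<close>, this says that \<open>k\<^sup>-\<^sup>1 g k\<close> is an affine function of \<open>f\<close> there.\<close>
definition half_matched :: "'n::finite lmat \<Rightarrow> 'n lmat \<Rightarrow> ('n lvec \<times> 'n lvec) set \<Rightarrow> bool" where
  "half_matched f g R \<longleftrightarrow> (\<exists>\<alpha> \<beta>. \<forall>p\<in>R. (\<alpha> *\<^sub>R fst p + \<beta> *\<^sub>R (f *v fst p), g *v snd p) \<in> R)"

lemma half_matched_spanI:
  assumes "\<And>p. p \<in> S \<Longrightarrow> (\<alpha> *\<^sub>R fst p + \<beta> *\<^sub>R (f *v fst p), g *v snd p) \<in> span S"
  shows "half_matched f g (span S)"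
proof -
  have "(\<alpha> *\<^sub>R fst p + \<beta> *\<^sub>R (f *v fst p), g *v snd p) \<in> span S" if "p \<in> span S" for p
    using that
  proof (induction rule: span_induct_alt)
    case base
    then show ?case by (simp add: zero_prod_def[symmetric] span_zero)
  next
    case (step c x y)
    have "(\<alpha> *\<^sub>R fst (c *\<^sub>R x + y) + \<beta> *\<^sub>R (f *v fst (c *\<^sub>R x + y)), g *v snd (c *\<^sub>R x + y))
      = c *\<^sub>R (\<alpha> *\<^sub>R fst x + \<beta> *\<^sub>R (f *v fst x), g *v snd x) + (\<alpha> *\<^sub>R fst y + \<beta> *\<^sub>R (f *v fst y), g *v snd y)"
      by (simp add: matrix_vector_right_distrib matrix_vector_mult_scaleR scaleR_add_right mult.commute)
    then show ?case using assms[OF step(1)] step(2) by (simp only: span_add span_scale)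
  qed
  then show ?thesis unfolding half_matched_def by blast
qed

lemma commuting_on_span:
  fixes A B :: "'n::finite lmat"
  assumes "span S = UNIV" "\<And>x. x \<in> S \<Longrightarrow> A *v (B *v x) = B *v (A *v x)"
  shows "A ** B = B ** A"
proof -
  have "A *v (B *v x) = B *v (A *v x)" for x
  proof -
    have "x \<in> span S" using assms(1) by simp
    then show ?thesis
      by (induction rule: span_induct_alt)
        (simp_all add: assms(2) matrix_vector_right_distrib matrix_vector_mult_scaleR)
  qed
  then show ?thesis by (simp add: matrix_eq matrix_vector_mul_assoc[symmetric])
qed

text \<open>On each block \<open>k^-1 g k\<close> is an affine function of \<open>f\<close>, with
  which \<open>h\<close> commutes; since \<open>h\<close> keeps the block, the identity can be
  checked there, and the blocks span.\<close>

lemma centralizer_transport: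
  assumes k: "k \<in> PO1n" and kR: "\<And>R p. R \<in> \<R> \<Longrightarrow> p \<in> R \<Longrightarrow> k *v fst p = snd p"
    and sp: "span (\<Union>R\<in>\<R>. snd ` R) = UNIV"
    and m: "\<And>R. R \<in> \<R> \<Longrightarrow> half_matched f g R"
    and st: "\<And>R x. R \<in> \<R> \<Longrightarrow> x \<in> fst ` R \<Longrightarrow> h *v x \<in> fst ` R"
    and h: "h \<in> centralizer f"
  shows "k ** h ** matrix_inv k \<in> centralizer g"
proof -
  have kO: "k \<in> O1n" using k PO1n_O1n by blast
  let ?h = "k ** h ** matrix_inv k"
  have hk: "?h *v (k *v x) = k *v (h *v x)" for x
    by (simp add: matrix_vector_mul_assoc[symmetric] O1n_inv[OF kO])
  have "?h ** g = g ** ?h"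
  proof (rule commuting_on_span[OF sp])
    fix y assume "y \<in> (\<Union>R\<in>\<R>. snd ` R)"
    then obtain R p where R: "R \<in> \<R>" "p \<in> R" "y = snd p" by blast
    let ?x = "fst p"
    have y: "y = k *v ?x" using kR[OF R(1,2)] R(3) by simp
    obtain \<alpha> \<beta> where ab: "\<And>q. q \<in> R \<Longrightarrow> (\<alpha> *\<^sub>R fst q + \<beta> *\<^sub>R (f *v fst q), g *v snd q) \<in> R"
      using m[OF R(1)] unfolding half_matched_def by blast
    have gk: "g *v (k *v fst q) = k *v (\<alpha> *\<^sub>R fst q + \<beta> *\<^sub>R (f *v fst q))" if "q \<in> R" for q
      using kR[OF R(1) ab[OF that]] kR[OF R(1) that] by simp
    obtain q where q: "q \<in> R" "h *v ?x = fst q" using st[OF R(1)] R(2) by force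
    have "?h *v (g *v y) = k *v (h *v (\<alpha> *\<^sub>R ?x + \<beta> *\<^sub>R (f *v ?x)))"
      unfolding y gk[OF R(2)] hk ..
    also have "\<dots> = k *v (\<alpha> *\<^sub>R (h *v ?x) + \<beta> *\<^sub>R (f *v (h *v ?x)))"
      using centralizer_commute[OF h] by (simp add: matrix_vector_right_distrib matrix_vector_mult_scaleR)
    also have "\<dots> = g *v (?h *v y)" unfolding y hk q(2) gk[OF q(1)] ..
    finally show "?h *v (g *v y) = g *v (?h *v y)" .
  qed
  moreover have "h \<in> PO1n" using h by (simp add: centralizer_def)
  ultimately show ?thesis using k by (simp add: centralizer_def PO1n_mult PO1n_matrix_inv)
qed

text \<open>\<open>Witt_extension\<close> glues all pairs into one isometry, so \<open>gram\<close>
  includes products across blocks. The two families of \<open>half_matched\<close> serve the two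
  inclusions, the second one with \<open>k^-1\<close> and swapped pairs.\<close>

lemma conj_centralizers_of_blocks:
  fixes f g :: "'n::finite lmat"
  assumes sp: "span (\<Union>R\<in>\<R>. fst ` R) = UNIV"
    and gram: "\<And>R R' p q. R \<in> \<R> \<Longrightarrow> R' \<in> \<R> \<Longrightarrow> p \<in> R \<Longrightarrow> q \<in> R' \<Longrightarrow> Qf (snd p) (snd q) = Qf (fst p) (fst q)"
    and m: "\<And>R. R \<in> \<R> \<Longrightarrow> half_matched f g R" "\<And>R. R \<in> \<R> \<Longrightarrow> half_matched g f (prod.swap ` R)"
    and st: "\<And>R h x. R \<in> \<R> \<Longrightarrow> h \<in> centralizer f \<Longrightarrow> x \<in> fst ` R \<Longrightarrow> h *v x \<in> fst ` R"
      "\<And>R h x. R \<in> \<R> \<Longrightarrow> h \<in> centralizer g \<Longrightarrow> x \<in> snd ` R \<Longrightarrow> h *v x \<in> snd ` R"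
    and fwd: "R0 \<in> \<R>" "p0 \<in> R0" "Qf (fst p0) (fst p0) \<le> 0" "fst p0 $ None > 0" "snd p0 $ None > 0"
  shows "conj_subgroups (centralizer f) (centralizer g)"
proof -
  have "span (fst ` \<Union>\<R>) = UNIV" using sp by (simp add: image_Union)
  then obtain k where kO: "k \<in> O1n" and k: "\<And>p. p \<in> \<Union>\<R> \<Longrightarrow> k *v fst p = snd p"
    using Witt_extension[of "\<Union>\<R>"] gram by blast
  have "p0 \<in> \<Union>\<R>" using fwd(1,2) by blast
  \<comment> \<open>The distinguished pair \<open>p0\<close> shows that \<open>k\<close> preserves
    the time direction.\<close>
  then have kP: "k \<in> PO1n" using PO1n_I[OF kO fwd(3,4)] k fwd(5) by simp
  have kiP: "matrix_inv k \<in> PO1n" using PO1n_matrix_inv[OF kP] .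
  have kk: "matrix_inv (matrix_inv k) = k"
  proof -
    have "matrix_inv (matrix_inv k) = (k ** matrix_inv k) ** matrix_inv (matrix_inv k)" using O1n_inv(1)[OF kO] by simp
    also have "\<dots> = k" unfolding matrix_mul_assoc[symmetric] O1n_inv(1)[OF O1n_matrix_inv[OF kO]] by simp
    finally show ?thesis .
  qed
  have sp': "span (\<Union>R\<in>\<R>. snd ` R) = UNIV"
  proof -
    have "snd p = k *v fst p" if "p \<in> \<Union>\<R>" for p using k[OF that] by simp
    then have "(\<Union>R\<in>\<R>. snd ` R) = (*v) k ` (\<Union>R\<in>\<R>. fst ` R)" by (force simp: image_UN)
    then have "span (\<Union>R\<in>\<R>. snd ` R) = (*v) k ` UNIV" using sp by (simp add: linear_span_image)
    then show ?thesis using O1n_inv(3)[OF kO] by (metis surjI)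
  qed
  have 1: "k ** h ** matrix_inv k \<in> centralizer g" if "h \<in> centralizer f" for h
    by (rule centralizer_transport[of k \<R> f g h]) (use kP k sp' m(1) st(1) that in auto)
  have 2: "matrix_inv k ** h ** k \<in> centralizer f" if h: "h \<in> centralizer g" for h
  proof -
    have "matrix_inv k ** h ** matrix_inv (matrix_inv k) \<in> centralizer f"
    proof (rule centralizer_transport[of "matrix_inv k" "(\<lambda>R. prod.swap ` R) ` \<R>" g f h])
      show "matrix_inv k \<in> PO1n" by (rule kiP)
      show "matrix_inv k *v fst p = snd p" if Rp: "R \<in> (\<lambda>R. prod.swap ` R) ` \<R>" "p \<in> R" for R p
      proof -
        obtain q where "q \<in> \<Union>\<R>" "p = prod.swap q" using Rp by blast
        then show ?thesis using k[of q] O1n_inv(4)[OF kO, of "fst q"] by simp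
      qed
      show "span (\<Union>R\<in>(\<lambda>R. prod.swap ` R) ` \<R>. snd ` R) = UNIV" using sp by (simp add: image_image)
      show "half_matched g f R" if "R \<in> (\<lambda>R. prod.swap ` R) ` \<R>" for R using that m(2) by blast
      show "h *v x \<in> fst ` R" if Rx: "R \<in> (\<lambda>R. prod.swap ` R) ` \<R>" "x \<in> fst ` R" for R x
      proof -
        obtain R' where R': "R' \<in> \<R>" "R = prod.swap ` R'" using Rx(1) by blast
        have "fst ` R = snd ` R'" by (simp add: R'(2) image_image)
        then show ?thesis using st(2)[OF R'(1) h] Rx(2) by simp
      qed
      show "h \<in> centralizer g" by (rule h)
    qed
    then show ?thesis unfolding kk .
  qed
  have "(\<lambda>h. k ** h ** matrix_inv k) ` centralizer f = centralizer g"
  proof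
    show "(\<lambda>h. k ** h ** matrix_inv k) ` centralizer f \<subseteq> centralizer g" using 1 by blast
    show "centralizer g \<subseteq> (\<lambda>h. k ** h ** matrix_inv k) ` centralizer f"
    proof
      fix h assume h: "h \<in> centralizer g"
      have c: "k ** (matrix_inv k ** A) = A" for A :: "'n lmat" by (simp add: matrix_mul_assoc O1n_inv[OF kO])
      have "h = k ** (matrix_inv k ** h ** k) ** matrix_inv k"
        by (simp add: matrix_mul_assoc[symmetric] c O1n_inv[OF kO])
      then show "h \<in> (\<lambda>h. k ** h ** matrix_inv k) ` centralizer f" using 2[OF h] by blast
    qed
  qed
  then show ?thesis using kP unfolding conj_subgroups_def by blast
qed

section \<open>Matching the positive definite blocks\<close>

lemma eigsp_mult_rot:
  assumes f: "f \<in> O1n" and a: "a \<in> pos_params f" and x: "x \<in> eigsp f a"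
  shows "f *v x = a *\<^sub>R x + sqrt (1 - a\<^sup>2) *\<^sub>R rot f a x"
proof (cases "a\<^sup>2 = 1")
  case True
  then show ?thesis using posdef_eigsp_pm1[OF f _ True x] a by (simp add: pos_params_def)
next
  case False
  then show ?thesis by (simp add: rot_def)
qed

text \<open>Solves \<open>rot\<close> for an affine function of \<open>f\<close>, with division by 0
  giving 0: at the endpoints both \<open>rot\<close> and the quotient vanish, and the premise makes
  the right side consistent.\<close>

lemma affine_rot:
  assumes "sqrt (1 - a\<^sup>2) = 0 \<Longrightarrow> s = 0"
  shows "(b - s / sqrt (1 - a\<^sup>2) * a) *\<^sub>R x + (s / sqrt (1 - a\<^sup>2)) *\<^sub>R (f *v x) = b *\<^sub>R x + s *\<^sub>R rot f a x"
  using assms by (simp add: rot_def scaleR_diff_left scaleR_diff_right)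

text \<open>Pair the two frames and their images under the complex structures. Then
  \<open>rot f a\<close> corresponds to \<open>rot g b\<close>, and \<open>g\<close>, being
  \<open>b\<close> plus a multiple of \<open>rot g b\<close>, becomes affine in
  \<open>f\<close>.\<close>

lemma eigsp_block:
  fixes f g :: "'n::finite lmat"
  assumes f: "f \<in> O1n" and g: "g \<in> O1n" and a: "a \<in> pos_params f" and b: "b \<in> pos_params g"
    and d: "dim (eigsp f a) = dim (eigsp g b)" and ab: "a\<^sup>2 = 1 \<longleftrightarrow> b\<^sup>2 = 1"
  obtains R where "fst ` R = eigsp f a" "snd ` R = eigsp g b"
    "\<And>p q. p \<in> R \<Longrightarrow> q \<in> R \<Longrightarrow> Qf (snd p) (snd q) = Qf (fst p) (fst q)"
    "half_matched f g R" "half_matched g f (prod.swap ` R)"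
proof -
  obtain m x where x: "\<And>j. j < (m::nat) \<Longrightarrow> x j \<in> eigsp f a"
    "\<And>i j. i < m \<Longrightarrow> j < m \<Longrightarrow> Qf (x i) (x j) = (if i = j then 1 else 0)"
    "\<And>i j. i < m \<Longrightarrow> j < m \<Longrightarrow> Qf (x i) (rot f a (x j)) = 0"
    "\<And>i j. i < m \<Longrightarrow> j < m \<Longrightarrow> Qf (rot f a (x i)) (rot f a (x j)) = (if i = j \<and> a\<^sup>2 \<noteq> 1 then 1 else 0)"
    "eigsp f a = span (x ` {..<m} \<union> (\<lambda>j. rot f a (x j)) ` {..<m})"
    "dim (eigsp f a) = (if a\<^sup>2 = 1 then m else 2 * m)"
    using pos_params_frame[OF f a] by blast
  obtain m' y where y: "\<And>j. j < (m'::nat) \<Longrightarrow> y j \<in> eigsp g b"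
    "\<And>i j. i < m' \<Longrightarrow> j < m' \<Longrightarrow> Qf (y i) (y j) = (if i = j then 1 else 0)"
    "\<And>i j. i < m' \<Longrightarrow> j < m' \<Longrightarrow> Qf (y i) (rot g b (y j)) = 0"
    "\<And>i j. i < m' \<Longrightarrow> j < m' \<Longrightarrow> Qf (rot g b (y i)) (rot g b (y j)) = (if i = j \<and> b\<^sup>2 \<noteq> 1 then 1 else 0)"
    "eigsp g b = span (y ` {..<m'} \<union> (\<lambda>j. rot g b (y j)) ` {..<m'})"
    "dim (eigsp g b) = (if b\<^sup>2 = 1 then m' else 2 * m')"
    using pos_params_frame[OF g b] by blast
  have mm: "m' = m" using d x(6) y(6) ab by (auto split: if_splits)
  define S where "S = (\<lambda>j. (x j, y j)) ` {..<m} \<union> (\<lambda>j. (rot f a (x j), rot g b (y j))) ` {..<m}"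
  have fstS: "fst ` S = x ` {..<m} \<union> (\<lambda>j. rot f a (x j)) ` {..<m}"
    and sndS: "snd ` S = y ` {..<m} \<union> (\<lambda>j. rot g b (y j)) ` {..<m}"
    by (simp_all add: S_def image_Un image_image)
  have fR: "fst ` span S = eigsp f a"
    unfolding x(5) fstS[symmetric] by (rule linear_span_image[OF linear_fst, symmetric])
  have sR: "snd ` span S = eigsp g b"
    unfolding y(5) mm sndS[symmetric] by (rule linear_span_image[OF linear_snd, symmetric])
  have Sx: "fst p \<in> eigsp f a" "snd p \<in> eigsp g b" if "p \<in> span S" for p
    using that fR sR by blast+
  have D: "Qposdef (eigsp f a)" "- 1 \<le> a" "a \<le> 1" "Qposdef (eigsp g b)" "- 1 \<le> b" "b \<le> 1"
    using a b by (auto simp: pos_params_def)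
  have rotS: "(rot f a (fst p), rot g b (snd p)) \<in> span S" if p: "p \<in> S" for p
  proof -
    consider j where "j < m" "p = (x j, y j)" | j where "j < m" "p = (rot f a (x j), rot g b (y j))"
      using p unfolding S_def by blast
    then show ?thesis
    proof cases
      case 1
      then show ?thesis unfolding S_def by (intro span_base) auto
    next
      case 2
      let ?e = "if a\<^sup>2 = 1 then 0 else 1 :: real"
      have "(rot f a (fst p), rot g b (snd p)) = (- ?e) *\<^sub>R (x j, y j)"
        using rot_rot[OF f D(1-3) x(1)[OF 2(1)]] rot_rot[OF g D(4-6) y(1)[of j]] 2 ab mm by simp
      moreover have "(x j, y j) \<in> span S" unfolding S_def using 2(1) by (intro span_base) auto
      ultimately show ?thesis by (simp only: span_scale)
    qed
  qed
  have gramS: "Qf (snd p) (snd q) = Qf (fst p) (fst q)" if "p \<in> S" "q \<in> S" for p q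
  proof -
    have c: "Qf (rot f a (x i)) (x j) = 0" "Qf (rot g b (y i)) (y j) = 0" if "i < m" "j < m" for i j
      using x(3)[OF that(2,1)] y(3)[of j i] that mm
      by (simp_all add: Qf_commute[of "rot f a (x i)"] Qf_commute[of "rot g b (y i)"])
    show ?thesis using that c x(2-4) y(2-4) ab mm unfolding S_def by auto
  qed
  let ?s = "sqrt (1 - a\<^sup>2)" and ?t = "sqrt (1 - b\<^sup>2)"
  have st: "?s = 0 \<longleftrightarrow> ?t = 0" using ab by auto
  have comb: "c *\<^sub>R p + e *\<^sub>R (rot f a (fst p), rot g b (snd p)) \<in> span S" if "p \<in> S" for c e p
    using rotS[OF that] span_base[OF that] by (intro span_add span_scale)
  have "half_matched f g (span S)"
  proof (rule half_matched_spanI[of _ "b - ?t / ?s * a" "?t / ?s"])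
    fix p assume p: "p \<in> S"
    have "((b - ?t / ?s * a) *\<^sub>R fst p + (?t / ?s) *\<^sub>R (f *v fst p), g *v snd p)
        = b *\<^sub>R p + ?t *\<^sub>R (rot f a (fst p), rot g b (snd p))"
      using affine_rot[of a ?t b "fst p" f] eigsp_mult_rot[OF g b Sx(2)[OF span_base[OF p]]] st
      by (simp add: prod_eq_iff)
    then show "((b - ?t / ?s * a) *\<^sub>R fst p + (?t / ?s) *\<^sub>R (f *v fst p), g *v snd p) \<in> span S"
      using comb[OF p] by (simp only:)
  qed
  moreover have "half_matched g f (prod.swap ` span S)"
  proof -
    have sw: "prod.swap ` span S = span (prod.swap ` S)"
      by (rule linear_span_image[symmetric]) (auto intro!: linearI simp: prod_eq_iff)
    have "half_matched g f (span (prod.swap ` S))"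
    proof (rule half_matched_spanI[of _ "a - ?s / ?t * b" "?s / ?t"])
      fix p' assume "p' \<in> prod.swap ` S"
      then obtain p where p: "p \<in> S" "p' = prod.swap p" by blast
      have "((a - ?s / ?t * b) *\<^sub>R fst p' + (?s / ?t) *\<^sub>R (g *v fst p'), f *v snd p')
          = prod.swap (a *\<^sub>R p + ?s *\<^sub>R (rot f a (fst p), rot g b (snd p)))"
        using affine_rot[of b ?s a "snd p" g] eigsp_mult_rot[OF f a Sx(1)[OF span_base[OF p(1)]]] st p(2)
        by (simp add: prod_eq_iff)
      then show "((a - ?s / ?t * b) *\<^sub>R fst p' + (?s / ?t) *\<^sub>R (g *v fst p'), f *v snd p') \<in> span (prod.swap ` S)"
        using comb[OF p(1)] unfolding sw[symmetric] by (simp only:) blast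
    qed
    then show ?thesis unfolding sw .
  qed
  ultimately show thesis using that[of "span S"] fR sR Qf_span_pairs[of S] gramS by blast
qed

lemma ex_bij_of_image_mset_eq:
  assumes "finite A" "finite B" "image_mset h (mset_set A) = image_mset h' (mset_set B)"
  shows "\<exists>\<sigma>. bij_betw \<sigma> A B \<and> (\<forall>a\<in>A. h' (\<sigma> a) = h a)"
  using assms
proof (induction A arbitrary: B rule: finite_induct)
  case empty
  then have "B = {}" by (simp add: mset_set_empty_iff)
  then show ?case by (simp add: bij_betw_def)
next
  case (insert a A)
  have "h a \<in># image_mset h' (mset_set B)" using insert by (metis finite_set_mset_mset_set image_mset_add_mset mset_set.insert union_single_eq_member finite_insert)
  then obtain b where b: "b \<in> B" "h' b = h a" using insert.prems(1) by auto
  have "mset_set B = add_mset b (mset_set (B - {b}))" using b(1) insert.prems(1) by (metis mset_set.remove)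
  then have "image_mset h (mset_set A) = image_mset h' (mset_set (B - {b}))"
    using insert b(2) by simp
  then obtain \<sigma> where \<sigma>: "bij_betw \<sigma> A (B - {b})" "\<forall>x\<in>A. h' (\<sigma> x) = h x"
    using insert.IH[of "B - {b}"] insert.prems(1) by auto
  have img: "\<sigma> ` A = B - {b}" and inj: "inj_on \<sigma> A" using \<sigma>(1) by (simp_all add: bij_betw_def)
  have "(\<sigma>(a := b)) ` A = B - {b}" using img insert.hyps(2) by (auto simp: image_iff)
  moreover have "inj_on (\<sigma>(a := b)) A" using inj insert.hyps(2) by (auto simp: inj_on_def)
  ultimately have "bij_betw (\<sigma>(a := b)) (insert a A) B"
    using b(1) insert.hyps(2) unfolding bij_betw_def by (auto simp: inj_on_insert)
  moreover have "\<forall>x\<in>insert a A. h' ((\<sigma>(a := b)) x) = h x" using \<sigma>(2) b(2) insert.hyps(2) by auto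
  ultimately show ?case by blast
qed

section \<open>Normal forms on \<open>V_t\<close> and their matching\<close>

lemma poly_mat_commutes:
  assumes "h ** f = f ** (h :: real ^ 'm ^ 'm)"
  shows "h *v (poly_mat p f *v x) = poly_mat p f *v (h *v x)"
proof (induction p)
  case (pCons a p)
  have "h *v (f *v y) = f *v (h *v y)" for y using assms by (simp add: matrix_vector_mul_assoc)
  then show ?case using pCons.IH
    by (simp add: poly_mat_pCons matrix_vector_mult_add_rdistrib scaleR_matrix_vector
        matrix_vector_mul_assoc[symmetric] matrix_vector_right_distrib matrix_vector_mult_scaleR)
qed simp

lemma Vt_commute_closed:
  assumes h: "h ** f = f ** h" and x: "x \<in> Vt f"
  shows "h *v x \<in> Vt f"
  using x unfolding Vt_def
proof (induction rule: span_induct_alt)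
  case base
  then show ?case by (simp add: span_zero)
next
  case (step c y z)
  have "h *v y \<in> primary_comp f p" if "y \<in> primary_comp f p" for p
    using that poly_mat_commutes[OF h, of "p ^ CARD('a option)" y] unfolding primary_comp_iff by simp
  then have "h *v y \<in> span (\<Union>{primary_comp f p | p. p \<in> prime_factors_cp f \<and> \<not> Qposdef (primary_comp f p)})"
    using step(1) by (intro span_base) blast
  then show ?case using step(2)
    by (simp add: matrix_vector_right_distrib matrix_vector_mult_scaleR span_add span_scale)
qed

text \<open>Pairing with \<open>q\<close> vanishes on the span of \<open>S\<close> but not at
  \<open>y\<close>.\<close>

lemma dim_insert_pairing:
  assumes "Qf y q \<noteq> 0" "\<And>s. s \<in> S \<Longrightarrow> Qf s q = 0"
  shows "dim (insert y S) = Suc (dim S)"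
proof -
  have "y \<notin> span S" using Qf_span_left[of S q y] assms by blast
  then show ?thesis by (simp add: dim_insert)
qed

lemma ex_orthonormal_frame:
  assumes W: "subspace W" "Qposdef W"
  obtains m e where "\<And>j. j < (m::nat) \<Longrightarrow> e j \<in> W"
    "\<And>i j. i < m \<Longrightarrow> j < m \<Longrightarrow> Qf (e i) (e j) = (if i = j then 1 else 0)"
    "W = span (e ` {..<m})" "dim (e ` {..<m}) = m"
proof -
  have lin: "linear (\<lambda>_. 0 :: 'a lvec)" by (rule module_hom_zero)
  obtain m e where e: "\<And>j. j < (m::nat) \<Longrightarrow> e j \<in> W"
    "\<And>i j. i < m \<Longrightarrow> j < m \<Longrightarrow> Qf (e i) (e j) = (if i = j then 1 else 0)"
    "\<And>i j. i < m \<Longrightarrow> j < m \<Longrightarrow> Qf (e i) 0 = 0"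
    "W = span (e ` {..<m} \<union> (\<lambda>j. 0) ` {..<m})"
    by (rule ex_skew_frame[OF W lin, of 0]) (use subspace_0[OF W(1)] in auto)
  have "e ` {..<m} \<union> (\<lambda>j. 0) ` {..<m} \<subseteq> insert 0 (e ` {..<m})" by auto
  then have "W \<subseteq> span (e ` {..<m})" unfolding e(4) by (metis span_insert_0 span_mono)
  moreover have "span (e ` {..<m}) \<subseteq> W" unfolding e(4) by (rule span_mono) simp
  ultimately have "W = span (e ` {..<m})" by blast
  moreover have "independent (e ` {..<m})" by (rule Qf_orthogonal_independent) (use e(2) in auto)
  then have "dim (e ` {..<m}) = card (e ` {..<m})" by (rule dim_eq_card_independent)
  moreover have "inj_on e {..<m}" using e(2) by (intro inj_onI) (metis lessThan_iff zero_neq_one)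
  ultimately have "dim (e ` {..<m}) = m" by (simp add: card_image)
  then show thesis using that[of m e] e(1,2) \<open>W = span (e ` {..<m})\<close> by blast
qed

lemma elliptic_frame:
  assumes f: "f \<in> PO1n" and t: "type_of f = Ell"
  obtains v m e where "v $ None > 0" "Qf v v = - 1" 
    "\<And>i j. i < (m::nat) \<Longrightarrow> j < m \<Longrightarrow> Qf (e i) (e j) = (if i = j then 1 else 0)"
    "\<And>j. j < m \<Longrightarrow> Qf (e j) v = 0" "Vt f = span (insert v (e ` {..<m}))" "dim (Vt f) = Suc m"
    "\<And>x. x \<in> Vt f \<Longrightarrow> f *v x = x"
proof -
  obtain v0 where v0: "f *v v0 = v0" "Qf v0 v0 < 0" using t type_of_Ell_iff[OF f] by blast
  have Vt: "Vt f = {x. f *v x = x}" by (rule elliptic_Vt[OF f v0])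
  have "v0 $ None \<noteq> 0" using zero_if_None_zero[of v0] v0(2) by fastforce
  \<comment> \<open>The sign makes \<open>v\<close> forward, the root normalizes its square to
    -1.\<close>
  define c where "c = sgn (v0 $ None) / sqrt (- Qf v0 v0)"
  define v where "v = c *\<^sub>R v0"
  have v: "v $ None > 0" "Qf v v = - 1" "f *v v = v"
  proof -
    show "v $ None > 0" using \<open>v0 $ None \<noteq> 0\<close> v0(2) by (simp add: v_def c_def sgn_if)
    have "c * c = 1 / (- Qf v0 v0)" using \<open>v0 $ None \<noteq> 0\<close> v0(2) by (simp add: c_def sgn_if)
    moreover have "Qf v v = (c * c) * Qf v0 v0" by (simp add: v_def Qf_simps)
    ultimately show "Qf v v = - 1" using v0(2) by simp
    show "f *v v = v" by (simp add: v_def matrix_vector_mult_scaleR v0(1))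
  qed
  define W where "W = {y \<in> Vt f. Qf y v = 0}"
  have "subspace W" using Vt_subspace[of f] by (auto simp: W_def subspace_def Qf_simps)
  moreover have "Qposdef W"
    unfolding Qposdef_def
  proof (intro ballI impI)
    fix y assume y: "y \<in> W" "y \<noteq> 0"
    then have "Qf v y = 0" by (simp add: W_def Qf_commute[of v y])
    then show "Qf y y > 0" using timelike_orthogonal[of v y] v(2) y(2) by simp
  qed
  ultimately obtain m e where e: "\<And>j. j < (m::nat) \<Longrightarrow> e j \<in> W"
    "\<And>i j. i < m \<Longrightarrow> j < m \<Longrightarrow> Qf (e i) (e j) = (if i = j then 1 else 0)"
    "W = span (e ` {..<m})" "dim (e ` {..<m}) = m"
    using ex_orthonormal_frame by blast
  have ev: "Qf (e j) v = 0" "e j \<in> Vt f" if "j < m" for j using e(1)[OF that] by (auto simp: W_def)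
  have sp: "Vt f = span (insert v (e ` {..<m}))"
  proof
    show "span (insert v (e ` {..<m})) \<subseteq> Vt f"
      using ev v(3) Vt by (intro span_minimal Vt_subspace) auto
    show "Vt f \<subseteq> span (insert v (e ` {..<m}))"
    proof
      fix x assume x: "x \<in> Vt f"
      let ?y = "x + Qf x v *\<^sub>R v"
      have "v \<in> Vt f" using v(3) Vt by simp
      then have "?y \<in> Vt f" by (intro subspace_add subspace_scale Vt_subspace x)
      then have "?y \<in> W" using v(2) by (simp add: W_def Qf_simps)
      then have "?y \<in> span (insert v (e ` {..<m}))" unfolding e(3) by (meson span_mono subset_insertI subsetD)
      moreover have "Qf x v *\<^sub>R v \<in> span (insert v (e ` {..<m}))" by (intro span_scale span_base) simp
      ultimately show "x \<in> span (insert v (e ` {..<m}))" using span_diff[of ?y _ "Qf x v *\<^sub>R v"] by simp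
    qed
  qed
  have "dim (insert v (e ` {..<m})) = Suc m"
    using dim_insert_pairing[of v v "e ` {..<m}"] v(2) ev(1) e(4) by auto
  then have "dim (Vt f) = Suc m" unfolding sp by simp
  moreover have "f *v x = x" if "x \<in> Vt f" for x using that unfolding Vt by simp
  ultimately show thesis using that[OF v(1,2) e(2) ev(1) sp] by blast
qed

text \<open>By induction \<open>f n = n + l u\<close> for \<open>n = f y - y\<close>. Comparing
  \<open>Q(f n, f y)\<close> with \<open>Q(n, y)\<close> makes \<open>n\<close> null; as it is
  orthogonal to the null vector \<open>u\<close>, it is a multiple of \<open>u\<close>.\<close>

lemma parabolic_unipotent_step:
  assumes f: "f \<in> O1n" and u: "f *v u = u" "Qf u u = 0" "u \<noteq> 0"
    and y: "Qf y u = 0" "y \<in> primary_comp f [:- 1, 1:]"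
  shows "\<exists>l. f *v y = y + l *\<^sub>R u"
proof -
  have "\<exists>l. f *v y = y + l *\<^sub>R u" if "Qf y u = 0" "poly_mat ([:- 1, 1:] ^ k) f *v y = c *\<^sub>R u" for k y c
    using that
  proof (induction k arbitrary: y)
    case 0
    then have "f *v y = y + 0 *\<^sub>R u" by (simp add: poly_mat_1 matrix_vector_mult_scaleR u(1))
    then show ?case by blast
  next
    case (Suc k)
    let ?n = "f *v y - y"
    have N1: "poly_mat [:- 1, 1:] f *v y = ?n" using poly_mat_linear[of 1 f y] by simp
    have "poly_mat ([:- 1, 1:] ^ k) f *v ?n = c *\<^sub>R u"
      using Suc.prems(2) by (simp only: N1[symmetric] matrix_vector_mul_assoc poly_mat_mult[symmetric] power_Suc2)
    moreover have nu: "Qf ?n u = 0" using O1n_Qf[OF f, of y u] u(1) by (simp add: Qf_simps)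
    ultimately obtain l where l: "f *v ?n = ?n + l *\<^sub>R u" using Suc.IH by blast
    have fy: "f *v y = y + ?n" by simp
    have "Qf (f *v ?n) (f *v y) = Qf ?n y" by (rule O1n_Qf[OF f])
    also have "Qf (f *v ?n) (f *v y) = Qf (?n + l *\<^sub>R u) (y + ?n)" unfolding l by simp
    also have "\<dots> = Qf ?n y + Qf ?n ?n + l * (Qf y u + Qf ?n u)"
      by (simp only: Qf_add_left Qf_add_right Qf_scaleR_left Qf_commute[of u]) (simp add: algebra_simps)
    finally have "Qf ?n ?n = 0" using Suc.prems(1) nu by simp
    then obtain t where "?n = t *\<^sub>R u"
      using null_orthogonal_null[OF u(2) _ u(3), of ?n] nu by (auto simp: Qf_commute[of u])
    then show ?case using fy by metis
  qed
  then show ?thesis using y unfolding primary_comp_iff by (metis scaleR_zero_left)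
qed

text \<open>A normal form without parameters: for a given dimension of \<open>V_t\<close>, all
  parabolic maps have the same matrix and the same Gram matrix in such a frame.\<close>

lemma parabolic_frame:
  assumes f: "f \<in> PO1n" and t: "type_of f = Par"
  obtains u w z m e where "u $ None > 0" "Qf u u = 0" "Qf w w = 0" "Qf u w = - 1" "Qf z z = 1" "Qf z u = 0" "Qf z w = 0"
    "\<And>i j. i < (m::nat) \<Longrightarrow> j < m \<Longrightarrow> Qf (e i) (e j) = (if i = j then 1 else 0)"
    "\<And>j. j < m \<Longrightarrow> Qf (e j) u = 0" "\<And>j. j < m \<Longrightarrow> Qf (e j) w = 0" "\<And>j. j < m \<Longrightarrow> Qf (e j) z = 0"
    "Vt f = span (insert u (insert w (insert z (e ` {..<m}))))" "dim (Vt f) = Suc (Suc (Suc m))"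
    "f *v u = u" "f *v w = w + z + (1 / 2) *\<^sub>R u" "f *v z = z + u" "\<And>j. j < m \<Longrightarrow> f *v e j = e j"
proof -
  have O: "f \<in> O1n" using f PO1n_O1n by blast
  from f obtain u0 where n0: "\<And>v. f *v v = v \<Longrightarrow> Qf v v \<ge> 0" and u0: "u0 $ None > 0" "Qf u0 u0 = 0" "f *v u0 = u0"
  proof (cases rule: PO1n_trichotomy)
    case (elliptic v)
    then have "type_of f = Ell" by (intro elliptic_type[OF f, of v]) auto
    then show ?thesis using t by simp
  next
    case (parabolic v)
    then show ?thesis using that by blast
  next
    case (hyperbolic u w \<mu>)
    have "u \<noteq> 0" using hyperbolic by auto
    then have "type_of f = Hyp" unfolding type_of_Hyp_iff[OF f] using hyperbolic(1,2,7) by blast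
    then show ?thesis using t by simp
  qed
  have u0n: "u0 \<noteq> 0" using u0 by auto
  have Vt: "Vt f = primary_comp f [:- 1, 1:]" using Vt_of_fixed[OF O u0(3) u0n] u0(2) by simp
  have u0V: "u0 \<in> Vt f" unfolding Vt using eigenvector_primary_comp[of f u0 1] u0(3) by simp
  obtain t0 where t0: "t0 \<in> Vt f" "Qf t0 t0 < 0" using Vt_timelike[OF f] .
  have tu: "Qf t0 u0 \<noteq> 0" using timelike_orthogonal[OF t0(2) _ u0n] u0(2) by auto
  \<comment> \<open>Subtracting a multiple of \<open>u0\<close> makes the timelike \<open>t0\<close>
    null; the factor sets the product with \<open>u0\<close> to -1.\<close>
  define w0 where "w0 = (- 1 / Qf t0 u0) *\<^sub>R (t0 - (Qf t0 t0 / (2 * Qf t0 u0)) *\<^sub>R u0)"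
  have w0V: "w0 \<in> Vt f"
    unfolding w0_def by (intro subspace_scale subspace_diff Vt_subspace t0(1) u0V)
  have w0w0: "Qf w0 w0 = 0"
  proof -
    have "Qf (t0 - (Qf t0 t0 / (2 * Qf t0 u0)) *\<^sub>R u0) (t0 - (Qf t0 t0 / (2 * Qf t0 u0)) *\<^sub>R u0) = 0"
      using tu by (simp add: Qf_simps u0(2) Qf_commute[of u0 t0])
    then show ?thesis by (simp only: w0_def Qf_scaleR_left Qf_scaleR_right mult_zero_right)
  qed
  have w0u0: "Qf w0 u0 = - 1" "Qf u0 w0 = - 1" using tu by (simp_all add: w0_def Qf_simps u0(2) Qf_commute[of u0 t0])
  define n where "n = f *v w0 - w0"
  have nV: "n \<in> Vt f" unfolding n_def by (intro subspace_diff Vt_subspace w0V Vt_mult_closed)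
  have nu: "Qf n u0 = 0" using O1n_Qf[OF O, of w0 u0] u0(3) by (simp add: n_def Qf_simps)
  \<comment> \<open>Chosen so that \<open>z0\<close> is orthogonal to \<open>w0\<close> as well as
    to \<open>u0\<close>; that \<open>f w0\<close> is null then gives
    \<open>Q(z0, z0) = 2 s\<close>.\<close>
  define s where "s = - Qf n w0"
  define z0 where "z0 = n - s *\<^sub>R u0"
  have z0V: "z0 \<in> Vt f" unfolding z0_def by (intro subspace_diff subspace_scale Vt_subspace nV u0V)
  have z0u0: "Qf z0 u0 = 0" by (simp add: z0_def Qf_simps nu u0(2))
  have z0w0: "Qf z0 w0 = 0" by (simp add: z0_def Qf_simps w0u0 s_def)
  have fw0: "f *v w0 = w0 + z0 + s *\<^sub>R u0" by (simp add: z0_def n_def)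
  have "Qf (w0 + z0 + s *\<^sub>R u0) (w0 + z0 + s *\<^sub>R u0) = 0"
    using O1n_Qf[OF O, of w0 w0] w0w0 unfolding fw0 by simp
  then have zz: "Qf z0 z0 = 2 * s"
    using w0w0 w0u0 z0w0 z0u0 u0(2) by (simp add: Qf_simps Qf_commute[of w0 z0] Qf_commute[of u0 z0])
  have uw: "Qf (u0 + w0) (u0 + w0) < 0" by (simp add: Qf_simps u0(2) w0w0 w0u0)
  have "z0 \<noteq> 0"
  proof
    assume z: "z0 = 0"
    then have "s = 0" using zz by simp
    then have "f *v (u0 + w0) = u0 + w0" using fw0 z u0(3) by (simp add: matrix_vector_right_distrib)
    then show False using n0 uw by force
  qed
  moreover have "Qf (u0 + w0) z0 = 0" using z0u0 z0w0 by (simp add: Qf_simps Qf_commute[of _ z0])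
  ultimately have z0pos: "Qf z0 z0 > 0" using timelike_orthogonal[OF uw] by blast
  \<comment> \<open>Scaling \<open>u0\<close> by \<open>c\<close> and \<open>w0\<close> by
    \<open>1 / c\<close> keeps their product, makes \<open>z\<close> a unit vector and turns the
    coefficient \<open>s\<close> into 1/2, since \<open>c^2 = 2 s\<close>.\<close>
  define c where "c = sqrt (Qf z0 z0)"
  have c: "c > 0" "c * c = 2 * s" using z0pos zz by (simp_all add: c_def)
  define u where "u = c *\<^sub>R u0"
  define w where "w = (1 / c) *\<^sub>R w0"
  define z where "z = (1 / c) *\<^sub>R z0"
  have u: "u $ None > 0" "f *v u = u" "u \<in> Vt f" "u \<noteq> 0"
    using c u0 u0V u0n by (simp_all add: u_def matrix_vector_mult_scaleR subspace_scale[OF Vt_subspace])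
  have wz: "w \<in> Vt f" "z \<in> Vt f" using w0V z0V by (simp_all add: w_def z_def subspace_scale[OF Vt_subspace])
  have "s > 0" using z0pos zz by simp
  then have Q: "Qf u u = 0" "Qf w w = 0" "Qf u w = - 1" "Qf z z = 1" "Qf z u = 0" "Qf z w = 0"
    using c zz by (simp_all add: u_def w_def z_def Qf_simps u0(2) w0w0 w0u0 z0u0 z0w0)
  have fw: "f *v w = w + z + (1 / 2) *\<^sub>R u"
  proof -
    have "(1 / c) * s = (1 / 2) * c" using c by (simp add: field_simps)
    then show ?thesis
      unfolding w_def z_def u_def matrix_vector_mult_scaleR fw0 scaleR_add_right scaleR_scaleR by simp
  qed
  have step: "\<exists>l. f *v y = y + l *\<^sub>R u" if "Qf y u = 0" "y \<in> Vt f" for y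
    using parabolic_unipotent_step[OF O u(2) Q(1) u(4) that(1)] that(2) Vt by simp
  \<comment> \<open>Comparing products with \<open>f w\<close> identifies the shear coefficient: it
    is 1 for \<open>z\<close> and 0 for vectors orthogonal to \<open>z\<close>.\<close>
  have coeff: "l = Qf y z" if "f *v y = y + l *\<^sub>R u" "Qf y u = 0" "Qf y w = 0" for y l
  proof -
    have "Qf (f *v y) (f *v w) = 0" by (simp add: O1n_Qf[OF O] that(3))
    then have "Qf (y + l *\<^sub>R u) (w + z + (1 / 2) *\<^sub>R u) = 0" unfolding that(1) fw .
    then show ?thesis using that(2,3) Q by (simp add: Qf_simps Qf_commute[of u z])
  qed
  have fz: "f *v z = z + u"
  proof -
    obtain c where c: "f *v z = z + c *\<^sub>R u" using step[OF Q(5) wz(2)] by blast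
    then have "c = 1" using coeff[OF c Q(5,6)] Q(4) by simp
    then show ?thesis using c by simp
  qed
  define W where "W = {y \<in> Vt f. Qf y u = 0 \<and> Qf y w = 0 \<and> Qf y z = 0}"
  have "subspace W" using Vt_subspace[of f] by (auto simp: W_def subspace_def Qf_simps)
  moreover have "Qposdef W"
  proof -
    have "Qf (u + w) (u + w) < 0" using Q by (simp add: Qf_simps Qf_commute[of w u])
    moreover have "Qf (u + w) y = 0" if "y \<in> W" for y
      using that by (simp add: W_def Qf_add_left Qf_commute[of u y] Qf_commute[of w y])
    ultimately show ?thesis using timelike_orthogonal[of "u + w"] by (simp add: Qposdef_def)
  qed
  ultimately obtain m e where e: "\<And>j. j < (m::nat) \<Longrightarrow> e j \<in> W"
    "\<And>i j. i < m \<Longrightarrow> j < m \<Longrightarrow> Qf (e i) (e j) = (if i = j then 1 else 0)"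
    "W = span (e ` {..<m})" "dim (e ` {..<m}) = m"
    using ex_orthonormal_frame by blast
  have ev: "Qf (e j) u = 0" "Qf (e j) w = 0" "Qf (e j) z = 0" "e j \<in> Vt f" if "j < m" for j
    using e(1)[OF that] by (auto simp: W_def)
  have fe: "f *v e j = e j" if j: "j < m" for j
  proof -
    obtain l where l': "f *v e j = e j + l *\<^sub>R u" using step[OF ev(1,4)[OF j]] by blast
    then have "l = 0" using ev[OF j] coeff[OF l'] by simp
    then show ?thesis using l' by simp
  qed
  let ?S = "insert u (insert w (insert z (e ` {..<m})))"
  have sp: "Vt f = span ?S"
  proof
    show "span ?S \<subseteq> Vt f" using ev u(3) wz by (intro span_minimal Vt_subspace) auto
    show "Vt f \<subseteq> span ?S"
    proof
      fix x assume x: "x \<in> Vt f"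
      \<comment> \<open>Adding \<open>?d\<close> removes the components of \<open>x\<close> along
        \<open>u\<close>, \<open>w\<close>, \<open>z\<close>; the signs reflect
        \<open>Q(u, w) = -1\<close> and \<open>Q(z, z) = 1\<close>.\<close>
      let ?d = "Qf x w *\<^sub>R u + Qf x u *\<^sub>R w - Qf x z *\<^sub>R z"
      have "x + ?d \<in> Vt f"
        by (intro subspace_add subspace_diff subspace_scale Vt_subspace x u(3) wz)
      then have "x + ?d \<in> W"
        using Q by (simp add: W_def Qf_simps Qf_commute[of w u] Qf_commute[of u z] Qf_commute[of w z])
      then have "x + ?d \<in> span ?S" unfolding e(3) by (rule subsetD[OF span_mono, rotated]) auto
      moreover have "?d \<in> span ?S" by (intro span_add span_diff span_scale span_base) auto
      ultimately show "x \<in> span ?S" using span_diff[of "x + ?d" ?S ?d] by simp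
    qed
  qed
  moreover have "dim ?S = Suc (Suc (Suc m))"
  proof -
    have 1: "dim (insert z (e ` {..<m})) = Suc m"
      using dim_insert_pairing[of z z "e ` {..<m}"] Q(4) ev(3) e(4) by auto
    have 2: "dim (insert w (insert z (e ` {..<m}))) = Suc (Suc m)"
      using dim_insert_pairing[of w u "insert z (e ` {..<m})"] Q ev(1) 1 by (auto simp: Qf_commute[of w u])
    show ?thesis
      using dim_insert_pairing[of u w "insert w (insert z (e ` {..<m}))"] Q ev(2) 2 by auto
  qed
  ultimately have "dim (Vt f) = Suc (Suc (Suc m))" by simp
  then show thesis using that[OF u(1) Q(1-6) e(2) ev(1-3) sp _ u(2) fw fz fe] by blast
qed

lemma swap_span: "prod.swap ` span S = span (prod.swap ` (S :: ('a::real_vector \<times> 'b::real_vector) set))"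
  by (rule linear_span_image[symmetric]) (auto intro!: linearI simp: prod_eq_iff)

text \<open>The case in which the pairs intertwine \<open>f\<close> and \<open>g\<close> exactly,
  with \<open>\<alpha> = 0\<close> and \<open>\<beta> = 1\<close>. It covers elliptic and parabolic
  \<open>V_t\<close>.\<close>

lemma half_matched_equivariant:
  assumes "\<And>p. p \<in> S \<Longrightarrow> (f *v fst p, g *v snd p) \<in> span S"
  shows "half_matched f g (span S)" "half_matched g f (prod.swap ` span S)"
proof -
  show "half_matched f g (span S)"
    by (rule half_matched_spanI[of _ 0 1]) (use assms in simp)
  have "half_matched g f (span (prod.swap ` S))"
  proof (rule half_matched_spanI[of _ 0 1])
    fix p' assume "p' \<in> prod.swap ` S"
    then obtain p where p: "p \<in> S" "p' = prod.swap p" by blast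
    have "prod.swap (f *v fst p, g *v snd p) \<in> prod.swap ` span S" using assms[OF p(1)] by blast
    then show "(0 *\<^sub>R fst p' + 1 *\<^sub>R (g *v fst p'), f *v snd p') \<in> span (prod.swap ` S)"
      unfolding swap_span p(2) by simp
  qed
  then show "half_matched g f (prod.swap ` span S)" unfolding swap_span .
qed

lemma half_matched_hyperbolic:
  assumes f: "f *v u = \<mu> *\<^sub>R u" "f *v w = (1 / \<mu>) *\<^sub>R w" and \<mu>: "\<mu> - 1 / \<mu> \<noteq> 0"
    and g: "g *v u' = \<nu> *\<^sub>R u'" "g *v w' = (1 / \<nu>) *\<^sub>R w'"
  shows "half_matched f g (span {(u, u'), (w, w')})"
proof -
  \<comment> \<open>Solution of \<open>\<alpha> + \<beta> \<mu> = \<nu>\<close> and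
    \<open>\<alpha> + \<beta> / \<mu> = 1 / \<nu>\<close>: an affine function may move both
    eigenvalues independently.\<close>
  define \<beta> where "\<beta> = (\<nu> - 1 / \<nu>) / (\<mu> - 1 / \<mu>)"
  define \<alpha> where "\<alpha> = \<nu> - \<beta> * \<mu>"
  have e1: "\<alpha> + \<beta> * \<mu> = \<nu>" by (simp add: \<alpha>_def)
  have "\<beta> * (\<mu> - 1 / \<mu>) = \<nu> - 1 / \<nu>" using \<mu> by (simp add: \<beta>_def)
  then have e2: "\<alpha> + \<beta> * (1 / \<mu>) = 1 / \<nu>" unfolding \<alpha>_def right_diff_distrib by linarith
  show ?thesis
  proof (rule half_matched_spanI[of _ \<alpha> \<beta>])
    fix p assume "p \<in> {(u, u'), (w, w')}"
    then consider "p = (u, u')" | "p = (w, w')" by blast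
    then show "(\<alpha> *\<^sub>R fst p + \<beta> *\<^sub>R (f *v fst p), g *v snd p) \<in> span {(u, u'), (w, w')}"
    proof cases
      case 1
      have "(\<alpha> *\<^sub>R fst p + \<beta> *\<^sub>R (f *v fst p), g *v snd p) = \<nu> *\<^sub>R (u, u')"
        unfolding 1 fst_conv snd_conv f(1) g(1) scaleR_scaleR scaleR_add_left[symmetric] e1 by simp
      then show ?thesis by (simp only: span_scale span_base insertI1)
    next
      case 2
      have "(\<alpha> *\<^sub>R fst p + \<beta> *\<^sub>R (f *v fst p), g *v snd p) = (1 / \<nu>) *\<^sub>R (w, w')"
        unfolding 2 fst_conv snd_conv f(2) g(2) scaleR_scaleR scaleR_add_left[symmetric] e2 by simp
      moreover have "(w, w') \<in> span {(u, u'), (w, w')}" by (intro span_base) simp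
      ultimately show ?thesis by (simp only: span_scale)
    qed
  qed
qed

text \<open>Elliptic and parabolic \<open>V_t\<close> are matched by their normal forms, hyperbolic
  planes by \<open>half_matched_hyperbolic\<close> since the multipliers may differ. The pair
  \<open>p\<close> is the forward witness for \<open>k\<close>.\<close>

lemma Vt_block:
  fixes f g :: "'n::finite lmat"
  assumes f: "f \<in> PO1n" and g: "g \<in> PO1n" and t: "type_of f = type_of g" and d: "dim (Vt f) = dim (Vt g)"
  obtains R p where "fst ` R = Vt f" "snd ` R = Vt g"
    "\<And>p q. p \<in> R \<Longrightarrow> q \<in> R \<Longrightarrow> Qf (snd p) (snd q) = Qf (fst p) (fst q)"
    "half_matched f g R" "half_matched g f (prod.swap ` R)"
    "p \<in> R" "Qf (fst p) (fst p) \<le> 0" "fst p $ None > 0" "snd p $ None > 0"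
proof -
  have images: "fst ` span S = Vt f \<and> snd ` span S = Vt g"
    if "Vt f = span (fst ` S)" "Vt g = span (snd ` S)" for S
    using that linear_span_image[OF linear_fst, of S] linear_span_image[OF linear_snd, of S] by simp
  show thesis
  proof (cases "type_of f")
    case Ell
    obtain v m e where v: "v $ None > 0" "Qf v v = - 1" 
      "\<And>i j. i < (m::nat) \<Longrightarrow> j < m \<Longrightarrow> Qf (e i) (e j) = (if i = j then 1 else 0)"
      "\<And>j. j < m \<Longrightarrow> Qf (e j) v = 0" "Vt f = span (insert v (e ` {..<m}))" "dim (Vt f) = Suc m"
      "\<And>x. x \<in> Vt f \<Longrightarrow> f *v x = x"
      using elliptic_frame[OF f Ell] by blast
    obtain v' m' e' where v': "v' $ None > 0" "Qf v' v' = - 1" 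
      "\<And>i j. i < (m'::nat) \<Longrightarrow> j < m' \<Longrightarrow> Qf (e' i) (e' j) = (if i = j then 1 else 0)"
      "\<And>j. j < m' \<Longrightarrow> Qf (e' j) v' = 0" "Vt g = span (insert v' (e' ` {..<m'}))" "dim (Vt g) = Suc m'"
      "\<And>x. x \<in> Vt g \<Longrightarrow> g *v x = x"
      using elliptic_frame[OF g] t Ell by metis
    have mm: "m' = m" using d v(6) v'(6) by simp
    define S where "S = insert (v, v') ((\<lambda>j. (e j, e' j)) ` {..<m})"
    have im: "fst ` span S = Vt f" "snd ` span S = Vt g"
      using images[of S] v(5) v'(5) mm by (simp_all add: S_def image_image)
    have "(f *v fst p, g *v snd p) \<in> span S" if "p \<in> S" for p
    proof -
      have p: "p \<in> span S" using that by (rule span_base)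
      then have "fst p \<in> Vt f" "snd p \<in> Vt g" using im by blast+
      then show ?thesis using v(7) v'(7) p by simp
    qed
    note hm = half_matched_equivariant[of S f g, OF this]
    have gramS: "Qf (snd p) (snd q) = Qf (fst p) (fst q)" if "p \<in> S" "q \<in> S" for p q
    proof -
      have c: "Qf v (e j) = 0" "Qf v' (e' j) = 0" if "j < m" for j
        using v(4)[OF that] v'(4)[of j] that mm by (simp_all add: Qf_commute[of v "e j"] Qf_commute[of v' "e' j"])
      show ?thesis using that c v(2-4) v'(2-4) mm unfolding S_def by auto
    qed
    have "(v, v') \<in> span S" unfolding S_def by (intro span_base) simp
    then show thesis using that[of "span S" "(v, v')"] im Qf_span_pairs[of S] gramS hm v(1,2) v'(1) by simp
  next
    case Par
    obtain u w z m e where F: "u $ None > 0" "Qf u u = 0" "Qf w w = 0" "Qf u w = - 1" "Qf z z = 1" "Qf z u = 0" "Qf z w = 0"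
      "\<And>i j. i < (m::nat) \<Longrightarrow> j < m \<Longrightarrow> Qf (e i) (e j) = (if i = j then 1 else 0)"
      "\<And>j. j < m \<Longrightarrow> Qf (e j) u = 0" "\<And>j. j < m \<Longrightarrow> Qf (e j) w = 0" "\<And>j. j < m \<Longrightarrow> Qf (e j) z = 0"
      "Vt f = span (insert u (insert w (insert z (e ` {..<m}))))" "dim (Vt f) = Suc (Suc (Suc m))"
      "f *v u = u" "f *v w = w + z + (1 / 2) *\<^sub>R u" "f *v z = z + u" "\<And>j. j < m \<Longrightarrow> f *v e j = e j"
      by (rule parabolic_frame[OF f Par]) blast
    have "type_of g = Par" using t Par by simp
    then obtain u' w' z' m' e' where G: "u' $ None > 0" "Qf u' u' = 0" "Qf w' w' = 0" "Qf u' w' = - 1" "Qf z' z' = 1" "Qf z' u' = 0" "Qf z' w' = 0"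
      "\<And>i j. i < (m'::nat) \<Longrightarrow> j < m' \<Longrightarrow> Qf (e' i) (e' j) = (if i = j then 1 else 0)"
      "\<And>j. j < m' \<Longrightarrow> Qf (e' j) u' = 0" "\<And>j. j < m' \<Longrightarrow> Qf (e' j) w' = 0" "\<And>j. j < m' \<Longrightarrow> Qf (e' j) z' = 0"
      "Vt g = span (insert u' (insert w' (insert z' (e' ` {..<m'}))))" "dim (Vt g) = Suc (Suc (Suc m'))"
      "g *v u' = u'" "g *v w' = w' + z' + (1 / 2) *\<^sub>R u'" "g *v z' = z' + u'" "\<And>j. j < m' \<Longrightarrow> g *v e' j = e' j"
      by (rule parabolic_frame[OF g]) blast
    have mm: "m' = m" using d F(13) G(13) by simp
    define S where "S = insert (u, u') (insert (w, w') (insert (z, z') ((\<lambda>j. (e j, e' j)) ` {..<m})))"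
    have im: "fst ` span S = Vt f" "snd ` span S = Vt g"
      using images[of S] F(12) G(12) mm by (simp_all add: S_def image_image)
    have base: "(u, u') \<in> span S" "(w, w') \<in> span S" "(z, z') \<in> span S" "j < m \<Longrightarrow> (e j, e' j) \<in> span S" for j
      unfolding S_def by (auto intro: span_base)
    have "(f *v fst p, g *v snd p) \<in> span S" if pS: "p \<in> S" for p
    proof -
      consider "p = (u, u')" | "p = (w, w')" | "p = (z, z')" | j where "j < m" "p = (e j, e' j)"
        using pS unfolding S_def by blast
      then show ?thesis
      proof cases
        case 1
        then show ?thesis using base(1) F(14) G(14) by simp
      next
        case 2
        have "(w, w') + (z, z') + (1 / 2) *\<^sub>R (u, u') \<in> span S"
          by (intro span_add span_scale base(1-3))
        then show ?thesis using F(15) G(15) 2 by simp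
      next
        case 3
        have "(z, z') + (u, u') \<in> span S" by (intro span_add base(1,3))
        then show ?thesis using F(16) G(16) 3 by simp
      next
        case 4
        then show ?thesis using base(4)[OF 4(1)] F(17)[OF 4(1)] G(17)[of j] mm by simp
      qed
    qed
    note hm = half_matched_equivariant[of S f g, OF this]
    have gramS: "Qf (snd p) (snd q) = Qf (fst p) (fst q)" if "p \<in> S" "q \<in> S" for p q
    proof -
      have c: "Qf u (e j) = 0" "Qf w (e j) = 0" "Qf z (e j) = 0" "Qf u' (e' j) = 0" "Qf w' (e' j) = 0" "Qf z' (e' j) = 0"
        if "j < m" for j
        using F(9-11)[OF that] G(9-11)[of j] that mm
        by (simp_all add: Qf_commute[of _ "e j"] Qf_commute[of _ "e' j"])
      have c': "Qf w u = - 1" "Qf u z = 0" "Qf w z = 0" "Qf w' u' = - 1" "Qf u' z' = 0" "Qf w' z' = 0"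
        using F(4,6,7) G(4,6,7)
        by (simp_all add: Qf_commute[of w u] Qf_commute[of u z] Qf_commute[of w z]
            Qf_commute[of w' u'] Qf_commute[of u' z'] Qf_commute[of w' z'])
      show ?thesis using that c c' F(2-11) G(2-11) mm unfolding S_def by auto
    qed
    show thesis using that[of "span S" "(u, u')"] im Qf_span_pairs[of S] gramS hm base(1) F(1,2) G(1) by simp
  next
    case Hyp
    have ex: "\<exists>u w \<mu>. \<mu> > 0 \<and> \<mu> \<noteq> 1 \<and> u $ None > 0 \<and> Qf u u = 0 \<and> Qf w w = 0 \<and> Qf u w = - 1 \<and>
        h *v u = \<mu> *\<^sub>R u \<and> h *v w = (1 / \<mu>) *\<^sub>R w"
      if h: "h \<in> PO1n" "type_of h = Hyp" for h :: "'n lmat"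
      using h(1)
    proof (cases rule: PO1n_trichotomy)
      case (elliptic v)
      then have "type_of h = Ell" by (intro elliptic_type[OF h(1), of v]) auto
      then show ?thesis using h by simp
    next
      case (parabolic v)
      then have "type_of h = Par" by (intro parabolic_type[OF h(1), of v]) auto
      then show ?thesis using h by simp
    next
      case (hyperbolic u w \<mu>)
      then show ?thesis by blast
    qed
    obtain u w \<mu> where F: "\<mu> > 0" "\<mu> \<noteq> 1" "u $ None > 0" "Qf u u = 0" "Qf w w = 0" "Qf u w = - 1"
      "f *v u = \<mu> *\<^sub>R u" "f *v w = (1 / \<mu>) *\<^sub>R w" using ex[OF f Hyp] by blast
    obtain u' w' \<nu> where G: "\<nu> > 0" "\<nu> \<noteq> 1" "u' $ None > 0" "Qf u' u' = 0" "Qf w' w' = 0" "Qf u' w' = - 1"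
      "g *v u' = \<nu> *\<^sub>R u'" "g *v w' = (1 / \<nu>) *\<^sub>R w'" using ex[OF g] t Hyp by auto
    have ne: "x - 1 / x \<noteq> 0" if "x > 0" "x \<noteq> 1" for x :: real
    proof
      assume "x - 1 / x = 0"
      then have "x\<^sup>2 = 1" using that(1) by (simp add: power2_eq_square field_simps)
      then show False using that by (auto simp: power2_eq_1_iff)
    qed
    define S where "S = {(u, u'), (w, w')}"
    have im: "fst ` span S = Vt f" "snd ` span S = Vt g"
      using images[of S] Vt_hyperbolic[OF PO1n_O1n[OF f] F(1,2,4-8)] Vt_hyperbolic[OF PO1n_O1n[OF g] G(1,2,4-8)]
      by (simp_all add: S_def)
    have hm1: "half_matched f g (span S)"
      unfolding S_def by (rule half_matched_hyperbolic[OF F(7,8) ne[OF F(1,2)] G(7,8)])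
    have hm2: "half_matched g f (prod.swap ` span S)"
      unfolding swap_span S_def using half_matched_hyperbolic[OF G(7,8) ne[OF G(1,2)] F(7,8)] by simp
    have gramS: "Qf (snd p) (snd q) = Qf (fst p) (fst q)" if "p \<in> S" "q \<in> S" for p q
      using that F(4-6) G(4-6) Qf_commute[of w u] Qf_commute[of w' u'] unfolding S_def by auto
    have "(u, u') \<in> span S" unfolding S_def by (intro span_base) simp
    then show thesis using that[of "span S" "(u, u')"] im Qf_span_pairs[of S] gramS hm1 hm2 F(3,4) G(3) by simp
  qed
qed

lemma conj_centralizers_of_segre_eq:
  fixes f g :: "'n::finite lmat"
  assumes f: "f \<in> PO1n" and g: "g \<in> PO1n" and s: "segre f = segre g"
  shows "conj_subgroups (centralizer f) (centralizer g)"
proof -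
  have Of: "f \<in> O1n" and Og: "g \<in> O1n" using f g PO1n_O1n by auto
  have S: "type_of f = type_of g" "dim (Vt f) = dim (Vt g)"
    "image_mset (\<lambda>a. dim (eigsp f a) div 2) (mset_set (complex_params f)) = image_mset (\<lambda>a. dim (eigsp g a) div 2) (mset_set (complex_params g))"
    "image_mset (\<lambda>a. dim (eigsp f a)) (mset_set (real_params f)) = image_mset (\<lambda>a. dim (eigsp g a)) (mset_set (real_params g))"
    using s unfolding segre_eq_params[OF f] segre_eq_params[OF g] by simp_all
  have fin: "finite (complex_params h)" "finite (real_params h)" if "h \<in> O1n" for h :: "'n lmat"
    using finite_pos_params[OF that] by (simp_all add: complex_params_def real_params_def)
  obtain \<sigma>c where \<sigma>c: "bij_betw \<sigma>c (complex_params f) (complex_params g)"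
    "\<And>a. a \<in> complex_params f \<Longrightarrow> dim (eigsp g (\<sigma>c a)) div 2 = dim (eigsp f a) div 2"
    using ex_bij_of_image_mset_eq[OF fin(1)[OF Of] fin(1)[OF Og] S(3)] by blast
  obtain \<sigma>r where \<sigma>r: "bij_betw \<sigma>r (real_params f) (real_params g)"
    "\<And>a. a \<in> real_params f \<Longrightarrow> dim (eigsp g (\<sigma>r a)) = dim (eigsp f a)"
    using ex_bij_of_image_mset_eq[OF fin(2)[OF Of] fin(2)[OF Og] S(4)] by blast
  \<comment> \<open>Makes the halved dimensions in the symbol lossless.\<close>
  have even: "even (dim (eigsp h a))" if "h \<in> O1n" "a \<in> complex_params h" for h :: "'n lmat" and a
  proof -
    have a: "a \<in> pos_params h" "a\<^sup>2 \<noteq> 1" using that(2) by (auto simp: complex_params_def abs_square_eq_1)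
    show ?thesis by (rule pos_params_frame[OF that(1) a(1)]) (use a(2) in simp)
  qed
  \<comment> \<open>Glues the two bijections; \<open>|a| < 1\<close> separates complex from real
    parameters, so \<open>\<sigma>\<close> is injective and respects the kind of block.\<close>
  define \<sigma> where "\<sigma> a = (if \<bar>a\<bar> < 1 then \<sigma>c a else \<sigma>r a)" for a
  have split: "pos_params h = complex_params h \<union> real_params h" "a \<in> complex_params h \<Longrightarrow> \<bar>a\<bar> < 1 \<and> a\<^sup>2 \<noteq> 1"
    "a \<in> real_params h \<Longrightarrow> \<not> \<bar>a\<bar> < 1 \<and> a\<^sup>2 = 1" for h :: "'n lmat" and a
    by (rule pos_params_split) (auto simp: complex_params_def real_params_def abs_square_eq_1)
  have \<sigma>: "\<sigma> a \<in> pos_params g" "dim (eigsp f a) = dim (eigsp g (\<sigma> a))" "a\<^sup>2 = 1 \<longleftrightarrow> (\<sigma> a)\<^sup>2 = 1"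
    if "a \<in> pos_params f" for a
  proof -
    have "\<sigma> a \<in> pos_params g \<and> dim (eigsp f a) = dim (eigsp g (\<sigma> a)) \<and> (a\<^sup>2 = 1 \<longleftrightarrow> (\<sigma> a)\<^sup>2 = 1)"
    proof (cases "\<bar>a\<bar> < 1")
      case True
      then have a: "a \<in> complex_params f" "\<sigma> a = \<sigma>c a" using that by (simp_all add: complex_params_def \<sigma>_def)
      then have b: "\<sigma> a \<in> complex_params g" using \<sigma>c(1) by (auto simp: bij_betw_def)
      have "dim (eigsp f a) = dim (eigsp g (\<sigma> a))"
        using \<sigma>c(2)[OF a(1)] even[OF Of a(1)] even[OF Og b] a(2) by (metis dvd_mult_div_cancel)
      then show ?thesis using b a(1) split by blast
    next
      case False
      then have a: "a \<in> real_params f" "\<sigma> a = \<sigma>r a" using that False split(2) unfolding \<sigma>_def split(1)[of f] by auto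
      then have b: "\<sigma> a \<in> real_params g" using \<sigma>r(1) by (auto simp: bij_betw_def)
      then show ?thesis using \<sigma>r(2)[OF a(1)] a split by (metis UnCI)
    qed
    then show "\<sigma> a \<in> pos_params g" "dim (eigsp f a) = dim (eigsp g (\<sigma> a))" "a\<^sup>2 = 1 \<longleftrightarrow> (\<sigma> a)\<^sup>2 = 1"
      by blast+
  qed
  have inj: "inj_on \<sigma> (pos_params f)"
  proof (rule inj_onI)
    fix a b assume ab: "a \<in> pos_params f" "b \<in> pos_params f" "\<sigma> a = \<sigma> b"
    have "a\<^sup>2 = 1 \<longleftrightarrow> b\<^sup>2 = 1" using \<sigma>(3)[OF ab(1)] \<sigma>(3)[OF ab(2)] ab(3) by simp
    then consider "a \<in> complex_params f" "b \<in> complex_params f" | "a \<in> real_params f" "b \<in> real_params f"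
      using ab(1,2) split by blast
    then show "a = b"
    proof cases
      case 1
      then have "\<sigma>c a = \<sigma>c b" using ab(3) split(2) by (simp add: \<sigma>_def)
      then show ?thesis using \<sigma>c(1) 1 by (meson bij_betw_def inj_onD)
    next
      case 2
      then have "\<sigma>r a = \<sigma>r b" using ab(3) split(3) by (simp add: \<sigma>_def)
      then show ?thesis using \<sigma>r(1) 2 by (meson bij_betw_def inj_onD)
    qed
  qed
  define is_block where "is_block a R \<longleftrightarrow> fst ` R = eigsp f a \<and> snd ` R = eigsp g (\<sigma> a) \<and>
      (\<forall>p\<in>R. \<forall>q\<in>R. Qf (snd p) (snd q) = Qf (fst p) (fst q)) \<and> half_matched f g R \<and> half_matched g f (prod.swap ` R)"
    for a R
  have "\<exists>R. is_block a R" if a: "a \<in> pos_params f" for a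
    unfolding is_block_def by (rule eigsp_block[OF Of Og a \<sigma>[OF a]]) blast
  then obtain B where B: "\<And>a. a \<in> pos_params f \<Longrightarrow> is_block a (B a)" by metis
  obtain R p where R: "fst ` R = Vt f" "snd ` R = Vt g"
    "\<And>p q. p \<in> R \<Longrightarrow> q \<in> R \<Longrightarrow> Qf (snd p) (snd q) = Qf (fst p) (fst q)"
    "half_matched f g R" "half_matched g f (prod.swap ` R)"
    "p \<in> R" "Qf (fst p) (fst p) \<le> 0" "fst p $ None > 0" "snd p $ None > 0"
    using Vt_block[OF f g S(1,2)] by blast
  have Bf: "fst q \<in> eigsp f a" "snd q \<in> eigsp g (\<sigma> a)" "fst q \<in> Vs f" "snd q \<in> Vs g"
    if "a \<in> pos_params f" "q \<in> B a" for a q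
    using B[OF that(1)] that eigsp_subset_Vs[OF Of that(1)] eigsp_subset_Vs[OF Og \<sigma>(1)[OF that(1)]]
    unfolding is_block_def by blast+
  \<comment> \<open>The pairing of \<open>V_t\<close> together with one pairing for each positive
    block.\<close>
  let ?\<R> = "insert R (B ` pos_params f)"
  show ?thesis
  proof (rule conj_centralizers_of_blocks[of ?\<R> f g R p])
    have "Vs f \<union> Vt f \<subseteq> span (\<Union>R\<in>?\<R>. fst ` R)"
    proof -
      have "Vs f \<subseteq> span (\<Union>R\<in>?\<R>. fst ` R)"
        unfolding Vs_eq_span_eigsp[OF Of]
      proof (rule span_mono, rule UN_least)
        fix a assume a: "a \<in> pos_params f"
        then have "eigsp f a = fst ` B a" using B unfolding is_block_def by blast
        then show "eigsp f a \<subseteq> (\<Union>R\<in>?\<R>. fst ` R)" using a by blast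
      qed
      moreover have "Vt f \<subseteq> span (\<Union>R\<in>?\<R>. fst ` R)" unfolding R(1)[symmetric] by (auto intro: span_base)
      ultimately show ?thesis by blast
    qed
    then have "span (Vs f \<union> Vt f) \<subseteq> span (\<Union>R\<in>?\<R>. fst ` R)" by (rule span_minimal) simp
    then show "span (\<Union>R\<in>?\<R>. fst ` R) = UNIV" unfolding span_Vs_Vt by blast
    have VB: "Qf (snd p) (snd q) = Qf (fst p) (fst q) \<and> Qf (snd q) (snd p) = Qf (fst q) (fst p)"
      if "p \<in> R" "a \<in> pos_params f" "q \<in> B a" for p q a
    proof -
      have "fst p \<in> Vt f" "snd p \<in> Vt g" using R(1,2) that(1) by blast+
      then have "Qf (fst q) (fst p) = 0" "Qf (snd q) (snd p) = 0"
        using Vs_orthogonal_Vt[OF f] Vs_orthogonal_Vt[OF g] Bf[OF that(2,3)] by blast+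
      then show ?thesis by (simp add: Qf_commute[of "fst p" "fst q"] Qf_commute[of "snd p" "snd q"])
    qed
    have BB: "Qf (snd p) (snd q) = Qf (fst p) (fst q)"
      if "a \<in> pos_params f" "p \<in> B a" "b \<in> pos_params f" "q \<in> B b" for p q a b
    proof (cases "a = b")
      case True
      then show ?thesis using B[OF that(1)] that unfolding is_block_def by blast
    next
      case False
      \<comment> \<open>Injectivity of \<open>\<sigma>\<close> sends distinct blocks of
        \<open>f\<close> to distinct, hence orthogonal, blocks of \<open>g\<close>, so mixed
        products vanish on both sides.\<close>
      then have "\<sigma> a \<noteq> \<sigma> b" using inj that by (auto simp: inj_on_def)
      then have "Qf (snd p) (snd q) = 0" using eigsp_orthogonal[OF Og] Bf(2)[OF that(1,2)] Bf(2)[OF that(3,4)] by blast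
      moreover have "Qf (fst p) (fst q) = 0"
        using eigsp_orthogonal[OF Of] Bf(1)[OF that(1,2)] Bf(1)[OF that(3,4)] False by blast
      ultimately show ?thesis by simp
    qed
    show "Qf (snd p) (snd q) = Qf (fst p) (fst q)" if "R1 \<in> ?\<R>" "R2 \<in> ?\<R>" "p \<in> R1" "q \<in> R2" for R1 R2 p q
      using that R(3) VB BB by blast
    show "half_matched f g R1" if "R1 \<in> ?\<R>" for R1 using that R(4) B unfolding is_block_def by blast
    show "half_matched g f (prod.swap ` R1)" if "R1 \<in> ?\<R>" for R1 using that R(5) B unfolding is_block_def by blast
    show "h *v x \<in> fst ` R1" if R1: "R1 \<in> ?\<R>" and h: "h \<in> centralizer f" and x: "x \<in> fst ` R1" for R1 h x
    proof -
      have c: "h ** f = f ** h" using h by (simp add: centralizer_def)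
      consider "R1 = R" | a where "a \<in> pos_params f" "R1 = B a" using R1 by blast
      then show ?thesis
      proof cases
        case 1
        then show ?thesis using Vt_commute_closed[OF c] x R(1) by simp
      next
        case 2
        then have "fst ` R1 = eigsp f a" using B unfolding is_block_def by blast
        then show ?thesis using eigsp_commute_closed[OF c] x by simp
      qed
    qed
    show "h *v x \<in> snd ` R1" if R1: "R1 \<in> ?\<R>" and h: "h \<in> centralizer g" and x: "x \<in> snd ` R1" for R1 h x
    proof -
      have c: "h ** g = g ** h" using h by (simp add: centralizer_def)
      consider "R1 = R" | a where "a \<in> pos_params f" "R1 = B a" using R1 by blast
      then show ?thesis
      proof cases
        case 1
        then show ?thesis using Vt_commute_closed[OF c] x R(2) by simp
      next
        case 2
        then have "snd ` R1 = eigsp g (\<sigma> a)" using B unfolding is_block_def by blast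
        then show ?thesis using eigsp_commute_closed[OF c] x by simp
      qed
    qed
    show "R \<in> ?\<R>" by simp
    show "p \<in> R" "Qf (fst p) (fst p) \<le> 0" "fst p $ None > 0" "snd p $ None > 0" by (fact R(6-9))+
  qed
qed

theorem mainTheorem3:
  fixes f g :: "real ^ ('n::finite option) ^ ('n option)"
  assumes "f \<in> PO1n" and "g \<in> PO1n"
  shows "segre f = segre g \<longleftrightarrow> conj_subgroups (centralizer f) (centralizer g)"
  using conj_centralizers_of_segre_eq[OF assms] segre_eq_of_conj_centralizers[OF assms] by blast

end
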